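(* Let $\Gamma$ be a finite group. Then every $\mathbb{Z}\Gamma$-module has a permutation presentation if and only if every Sylow subgroup of $\Gamma$ is cyclic.
   Context: All modules are left modules and are not assumed finitely generated. A $\mathbb{Z}\Gamma$-module $F$ is a permutation module if it has a basis as a $\mathbb{Z}$-module (in particular it is free over $\mathbb{Z}$) which is permuted by the action of $\Gamma$. A permutation presentation of a $\mathbb{Z}\Gamma$-module $M$ is an exact sequence $0\to F\to F\to M\to 0$ of $\mathbb{Z}\Gamma$-modules where $F$ is a permutation $\mathbb{Z}\Gamma$-module (the same $F$ in both places). *)

theory Defs
  imports
    "HOL-Algebra.Algebra"
    "HOL-Computational_Algebra.Primes"
    "HOL-Library.Equipollence"
begin

text \<open>
  The elements of the integral group ring of \<open>G\<close> are the finitely supported functions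
  \<open>carrier G \<rightarrow> \<int>\<close>, extended by 0 outside \<open>carrier G\<close>; multiplication is convolution.
\<close>

definition int_group_ring :: "('g, 'x) monoid_scheme \<Rightarrow> ('g \<Rightarrow> int) ring" where
  "int_group_ring G =
    \<lparr> carrier = {x. finite {g. x g \<noteq> 0} \<and> {g. x g \<noteq> 0} \<subseteq> carrier G},
      monoid.mult = (\<lambda>x y g. \<Sum>h | x h \<noteq> 0. \<Sum>k | y k \<noteq> 0. if h \<otimes>\<^bsub>G\<^esub> k = g then x h * y k else 0),
      one = (\<lambda>g. if g = \<one>\<^bsub>G\<^esub> then 1 else 0),
      ring.zero = (\<lambda>_. 0),
      ring.add = (\<lambda>x y g. x g + y g) \<rparr>"

definition group_ring_elem :: "'g \<Rightarrow> 'g \<Rightarrow> int" where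
  "group_ring_elem g = (\<lambda>h. if h = g then 1 else 0)"

text \<open>
  The locale \<^locale>\<open>module\<close> of the library requires a commutative ring of scalars.  The
  following is the same notion for left modules over an arbitrary ring; the fields \<open>mult\<close> and
  \<open>one\<close> of the record \<open>M\<close> are not used.
\<close>

locale left_module = R?: ring R + M?: abelian_group M
  for R :: "('r, 'x) ring_scheme" (structure) and M :: "('r, 'm, 'y) module_scheme" (structure) +
  assumes smult_closed:
      "\<lbrakk> a \<in> carrier R; x \<in> carrier M \<rbrakk> \<Longrightarrow> a \<odot>\<^bsub>M\<^esub> x \<in> carrier M"
    and smult_l_distr:
      "\<lbrakk> a \<in> carrier R; b \<in> carrier R; x \<in> carrier M \<rbrakk> \<Longrightarrow>
      (a \<oplus> b) \<odot>\<^bsub>M\<^esub> x = a \<odot>\<^bsub>M\<^esub> x \<oplus>\<^bsub>M\<^esub> b \<odot>\<^bsub>M\<^esub> x"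
    and smult_r_distr:
      "\<lbrakk> a \<in> carrier R; x \<in> carrier M; y \<in> carrier M \<rbrakk> \<Longrightarrow>
      a \<odot>\<^bsub>M\<^esub> (x \<oplus>\<^bsub>M\<^esub> y) = a \<odot>\<^bsub>M\<^esub> x \<oplus>\<^bsub>M\<^esub> a \<odot>\<^bsub>M\<^esub> y"
    and smult_assoc:
      "\<lbrakk> a \<in> carrier R; b \<in> carrier R; x \<in> carrier M \<rbrakk> \<Longrightarrow>
      (a \<otimes> b) \<odot>\<^bsub>M\<^esub> x = a \<odot>\<^bsub>M\<^esub> (b \<odot>\<^bsub>M\<^esub> x)"
    and smult_one:
      "x \<in> carrier M \<Longrightarrow> \<one> \<odot>\<^bsub>M\<^esub> x = x"

definition left_module_hom ::
    "('r, 'x) ring_scheme \<Rightarrow> ('r, 'm, 'y) module_scheme \<Rightarrow> ('r, 'n, 'z) module_scheme \<Rightarrow>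
     ('m \<Rightarrow> 'n) set" where
  "left_module_hom R M N =
    {f \<in> hom (add_monoid M) (add_monoid N).
      \<forall>a\<in>carrier R. \<forall>x\<in>carrier M. f (a \<odot>\<^bsub>M\<^esub> x) = a \<odot>\<^bsub>N\<^esub> f x}"

text \<open>\<open>B\<close> is a basis of the additive group of \<open>M\<close> as a \<open>\<int>\<close>-module.\<close>

definition is_int_basis :: "('m, 'x) ring_scheme \<Rightarrow> 'm set \<Rightarrow> bool" where
  "is_int_basis M B \<longleftrightarrow>
    B \<subseteq> carrier M \<and>
    (\<forall>x\<in>carrier M. \<exists>!c :: 'm \<Rightarrow> int.
      finite {b. c b \<noteq> 0} \<and> {b. c b \<noteq> 0} \<subseteq> B \<and>
      x = (\<Oplus>\<^bsub>M\<^esub>b\<in>{b. c b \<noteq> 0}. add_pow M (c b) b))"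

definition permutation_module ::
    "('g, 'x) monoid_scheme \<Rightarrow> ('g \<Rightarrow> int, 'f, 'y) module_scheme \<Rightarrow> bool" where
  "permutation_module G F \<longleftrightarrow>
    left_module (int_group_ring G) F \<and>
    (\<exists>B. is_int_basis F B \<and>
      (\<forall>g\<in>carrier G. bij_betw (\<lambda>b. group_ring_elem g \<odot>\<^bsub>F\<^esub> b) B B))"

text \<open>The sequence \<open>0 \<rightarrow> F \<rightarrow> F \<rightarrow> M \<rightarrow> 0\<close> with maps \<open>i\<close> and \<open>p\<close>.\<close>

definition permutation_presentation ::
    "('g, 'x) monoid_scheme \<Rightarrow> ('g \<Rightarrow> int, 'm, 'y) module_scheme \<Rightarrow>
     ('g \<Rightarrow> int, 'f, 'z) module_scheme \<Rightarrow> ('f \<Rightarrow> 'f) \<Rightarrow> ('f \<Rightarrow> 'm) \<Rightarrow> bool" where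
  "permutation_presentation G M F i p \<longleftrightarrow>
    permutation_module G F \<and>
    i \<in> left_module_hom (int_group_ring G) F F \<and>
    p \<in> left_module_hom (int_group_ring G) F M \<and>
    inj_on i (carrier F) \<and>
    i ` carrier F = a_kernel F M p \<and>
    p ` carrier F = carrier M"

definition sylow_subgroup :: "nat \<Rightarrow> 'g set \<Rightarrow> ('g, 'x) monoid_scheme \<Rightarrow> bool" where
  "sylow_subgroup p P G \<longleftrightarrow>
    Factorial_Ring.prime p \<and> subgroup P G \<and> card P = p ^ multiplicity p (order G)"

lemma sum_swap3:
  "(\<Sum>u\<in>U. \<Sum>a\<in>A. \<Sum>b\<in>B. f u a b) = (\<Sum>a\<in>A. \<Sum>b\<in>B. \<Sum>u\<in>U. f u a b)"
  by (rule trans[OF sum.swap], rule sum.cong[OF refl], rule sum.swap)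

lemma sum_swap4:
  "(\<Sum>u\<in>U. \<Sum>c\<in>C. \<Sum>a\<in>A. \<Sum>b\<in>B. f u c a b) =
    (\<Sum>a\<in>A. \<Sum>b\<in>B. \<Sum>c\<in>C. \<Sum>u\<in>U. f u c a b)"
proof -
  have "(\<Sum>u\<in>U. \<Sum>c\<in>C. \<Sum>a\<in>A. \<Sum>b\<in>B. f u c a b) =
    (\<Sum>u\<in>U. \<Sum>a\<in>A. \<Sum>b\<in>B. \<Sum>c\<in>C. f u c a b)"
    by (rule sum.cong[OF refl], rule sum_swap3)
  also have "\<dots> = (\<Sum>a\<in>A. \<Sum>b\<in>B. \<Sum>u\<in>U. \<Sum>c\<in>C. f u c a b)"
    by (rule sum_swap3)
  also have "\<dots> = (\<Sum>a\<in>A. \<Sum>b\<in>B. \<Sum>c\<in>C. \<Sum>u\<in>U. f u c a b)"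
    by (rule sum.cong[OF refl], rule sum.cong[OF refl], rule sum.swap)
  finally show ?thesis .
qed

lemma int_group_ring_mult_eq:
  assumes "finite A" "finite B" "{h. x h \<noteq> 0} \<subseteq> A" "{k. y k \<noteq> 0} \<subseteq> B"
  shows "(x \<otimes>\<^bsub>int_group_ring G\<^esub> y) g =
    (\<Sum>h\<in>A. \<Sum>k\<in>B. if h \<otimes>\<^bsub>G\<^esub> k = g then x h * y k else 0)"
proof -
  have "(\<Sum>h\<in>A. \<Sum>k\<in>B. if h \<otimes>\<^bsub>G\<^esub> k = g then x h * y k else 0) =
    (\<Sum>h | x h \<noteq> 0. \<Sum>k\<in>B. if h \<otimes>\<^bsub>G\<^esub> k = g then x h * y k else 0)"
    using assms by (intro sum.mono_neutral_right) (auto intro!: sum.neutral)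
  also have "\<dots> = (\<Sum>h | x h \<noteq> 0. \<Sum>k | y k \<noteq> 0. if h \<otimes>\<^bsub>G\<^esub> k = g then x h * y k else 0)"
    using assms by (intro sum.cong sum.mono_neutral_right) auto
  finally show ?thesis by (simp add: int_group_ring_def)
qed

lemma int_group_ring_add: "(x \<oplus>\<^bsub>int_group_ring G\<^esub> y) g = x g + y g"
  by (simp add: int_group_ring_def)

lemma int_group_ring_l_distr:
  assumes "x \<in> carrier (int_group_ring G)" "y \<in> carrier (int_group_ring G)"
    "z \<in> carrier (int_group_ring G)"
  shows "(x \<oplus>\<^bsub>int_group_ring G\<^esub> y) \<otimes>\<^bsub>int_group_ring G\<^esub> z = x \<otimes>\<^bsub>int_group_ring G\<^esub> z \<oplus>\<^bsub>int_group_ring G\<^esub> y \<otimes>\<^bsub>int_group_ring G\<^esub> z"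
proof
  fix g
  have fin: "finite {h. x h \<noteq> 0}" "finite {h. y h \<noteq> 0}" "finite {h. z h \<noteq> 0}"
    using assms by (auto simp: int_group_ring_def)
  have supp: "{h. (x \<oplus>\<^bsub>int_group_ring G\<^esub> y) h \<noteq> 0} \<subseteq> {h. x h \<noteq> 0} \<union> {h. y h \<noteq> 0}"
    by (auto simp: int_group_ring_add)
  note eqs =
    int_group_ring_mult_eq[of "{h. x h \<noteq> 0} \<union> {h. y h \<noteq> 0}" "{h. z h \<noteq> 0}" "x \<oplus>\<^bsub>int_group_ring G\<^esub> y" z G g]
    int_group_ring_mult_eq[of "{h. x h \<noteq> 0} \<union> {h. y h \<noteq> 0}" "{h. z h \<noteq> 0}" "x" z G g]
    int_group_ring_mult_eq[of "{h. x h \<noteq> 0} \<union> {h. y h \<noteq> 0}" "{h. z h \<noteq> 0}" "y" z G g]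
  have "((x \<oplus>\<^bsub>int_group_ring G\<^esub> y) \<otimes>\<^bsub>int_group_ring G\<^esub> z) g = (x \<otimes>\<^bsub>int_group_ring G\<^esub> z) g + (y \<otimes>\<^bsub>int_group_ring G\<^esub> z) g"
    apply (subst (1) eqs(1))
        apply (use fin supp in simp_all)[4]
    apply (subst eqs(2))
        apply (use fin in simp_all)[4]
    apply (subst eqs(3))
        apply (use fin in simp_all)[4]
    unfolding sum.distrib[symmetric]
    apply (intro sum.cong refl)
    apply (simp add: int_group_ring_add algebra_simps)
    done
  then show "((x \<oplus>\<^bsub>int_group_ring G\<^esub> y) \<otimes>\<^bsub>int_group_ring G\<^esub> z) g = (x \<otimes>\<^bsub>int_group_ring G\<^esub> z \<oplus>\<^bsub>int_group_ring G\<^esub> y \<otimes>\<^bsub>int_group_ring G\<^esub> z) g"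
    by (simp only: int_group_ring_add)
qed

lemma int_group_ring_r_distr:
  assumes "x \<in> carrier (int_group_ring G)" "y \<in> carrier (int_group_ring G)"
    "z \<in> carrier (int_group_ring G)"
  shows "z \<otimes>\<^bsub>int_group_ring G\<^esub> (x \<oplus>\<^bsub>int_group_ring G\<^esub> y) = z \<otimes>\<^bsub>int_group_ring G\<^esub> x \<oplus>\<^bsub>int_group_ring G\<^esub> z \<otimes>\<^bsub>int_group_ring G\<^esub> y"
proof
  fix g
  have fin: "finite {h. x h \<noteq> 0}" "finite {h. y h \<noteq> 0}" "finite {h. z h \<noteq> 0}"
    using assms by (auto simp: int_group_ring_def)
  have supp: "{h. (x \<oplus>\<^bsub>int_group_ring G\<^esub> y) h \<noteq> 0} \<subseteq> {h. x h \<noteq> 0} \<union> {h. y h \<noteq> 0}"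
    by (auto simp: int_group_ring_add)
  note eqs =
    int_group_ring_mult_eq[of "{h. z h \<noteq> 0}" "{h. x h \<noteq> 0} \<union> {h. y h \<noteq> 0}" z "x \<oplus>\<^bsub>int_group_ring G\<^esub> y" G g]
    int_group_ring_mult_eq[of "{h. z h \<noteq> 0}" "{h. x h \<noteq> 0} \<union> {h. y h \<noteq> 0}" z "x" G g]
    int_group_ring_mult_eq[of "{h. z h \<noteq> 0}" "{h. x h \<noteq> 0} \<union> {h. y h \<noteq> 0}" z "y" G g]
  have "(z \<otimes>\<^bsub>int_group_ring G\<^esub> (x \<oplus>\<^bsub>int_group_ring G\<^esub> y)) g = (z \<otimes>\<^bsub>int_group_ring G\<^esub> x) g + (z \<otimes>\<^bsub>int_group_ring G\<^esub> y) g"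
    apply (subst (1) eqs(1))
        apply (use fin supp in simp_all)[4]
    apply (subst eqs(2))
        apply (use fin in simp_all)[4]
    apply (subst eqs(3))
        apply (use fin in simp_all)[4]
    unfolding sum.distrib[symmetric]
    apply (intro sum.cong refl)
    apply (simp add: int_group_ring_add algebra_simps)
    done
  then show "(z \<otimes>\<^bsub>int_group_ring G\<^esub> (x \<oplus>\<^bsub>int_group_ring G\<^esub> y)) g = (z \<otimes>\<^bsub>int_group_ring G\<^esub> x \<oplus>\<^bsub>int_group_ring G\<^esub> z \<otimes>\<^bsub>int_group_ring G\<^esub> y) g"
    by (simp only: int_group_ring_add)
qed

lemma ring_int_group_ring:
  assumes "group G"
  shows "ring (int_group_ring G)"
proof -
  interpret G: group G by fact
  let ?R = "int_group_ring G"
  let ?s = "\<lambda>x :: 'a \<Rightarrow> int. {g. x g \<noteq> 0}"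
  have carr: "x \<in> carrier ?R \<longleftrightarrow> finite (?s x) \<and> ?s x \<subseteq> carrier G" for x
    by (simp add: int_group_ring_def)
  have add [simp]: "(x \<oplus>\<^bsub>?R\<^esub> y) g = x g + y g" for x y g
    by (simp add: int_group_ring_def)
  have zero [simp]: "\<zero>\<^bsub>?R\<^esub> g = 0" for g
    by (simp add: int_group_ring_def)
  have supp_mult: "?s (x \<otimes>\<^bsub>?R\<^esub> y) \<subseteq> (\<lambda>(h, k). h \<otimes>\<^bsub>G\<^esub> k) ` (?s x \<times> ?s y)" for x y
  proof
    fix g assume "g \<in> ?s (x \<otimes>\<^bsub>?R\<^esub> y)"
    then have "(\<Sum>h\<in>?s x. \<Sum>k\<in>?s y. if h \<otimes>\<^bsub>G\<^esub> k = g then x h * y k else 0) \<noteq> 0"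
      by (simp add: int_group_ring_def)
    then obtain h where h: "h \<in> ?s x"
        "(\<Sum>k\<in>?s y. if h \<otimes>\<^bsub>G\<^esub> k = g then x h * y k else 0) \<noteq> 0"
      by (rule sum.not_neutral_contains_not_neutral)
    from h(2) obtain k where k: "k \<in> ?s y" "(if h \<otimes>\<^bsub>G\<^esub> k = g then x h * y k else 0) \<noteq> 0"
      by (rule sum.not_neutral_contains_not_neutral)
    from k(2) have "g = h \<otimes>\<^bsub>G\<^esub> k" by (simp split: if_splits)
    with h(1) k(1) show "g \<in> (\<lambda>(h, k). h \<otimes>\<^bsub>G\<^esub> k) ` (?s x \<times> ?s y)" by blast
  qed
  have mult_closed: "x \<otimes>\<^bsub>?R\<^esub> y \<in> carrier ?R" if "x \<in> carrier ?R" "y \<in> carrier ?R" for x y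
  proof -
    have "finite ((\<lambda>(h, k). h \<otimes>\<^bsub>G\<^esub> k) ` (?s x \<times> ?s y))"
      using that by (simp add: carr)
    moreover have "(\<lambda>(h, k). h \<otimes>\<^bsub>G\<^esub> k) ` (?s x \<times> ?s y) \<subseteq> carrier G"
      using that by (auto simp: carr subset_iff)
    ultimately show ?thesis
      unfolding carr by (intro conjI finite_subset[OF supp_mult] order_trans[OF supp_mult])
  qed
  have add_closed: "x \<oplus>\<^bsub>?R\<^esub> y \<in> carrier ?R" if "x \<in> carrier ?R" "y \<in> carrier ?R" for x y
  proof -
    have supp: "?s (x \<oplus>\<^bsub>?R\<^esub> y) \<subseteq> ?s x \<union> ?s y" by auto
    have "finite (?s x \<union> ?s y)" "?s x \<union> ?s y \<subseteq> carrier G"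
      using that by (simp_all add: carr)
    then show ?thesis
      unfolding carr by (intro conjI finite_subset[OF supp] order_trans[OF supp])
  qed
  have one_closed: "\<one>\<^bsub>?R\<^esub> \<in> carrier ?R"
    by (auto simp: int_group_ring_def)
  show ?thesis
  proof (rule ringI)
    show "abelian_group ?R"
    proof (rule abelian_groupI)
      fix x assume x: "x \<in> carrier ?R"
      then have "(\<lambda>g. - x g) \<in> carrier ?R" "(\<lambda>g. - x g) \<oplus>\<^bsub>?R\<^esub> x = \<zero>\<^bsub>?R\<^esub>"
        by (auto simp: carr)
      then show "\<exists>y\<in>carrier ?R. y \<oplus>\<^bsub>?R\<^esub> x = \<zero>\<^bsub>?R\<^esub>" by blast
    next
      show "\<zero>\<^bsub>?R\<^esub> \<in> carrier ?R" by (simp add: carr)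
    qed (simp_all add: add_closed fun_eq_iff add.assoc add.commute)
    show "monoid ?R"
    proof (rule monoidI)
      fix x y z assume x: "x \<in> carrier ?R" and y: "y \<in> carrier ?R" and z: "z \<in> carrier ?R"
      define P where "P u v = (\<lambda>(h, k). h \<otimes>\<^bsub>G\<^esub> k) ` (?s u \<times> ?s v)" for u v
      have fin: "finite (?s x)" "finite (?s y)" "finite (?s z)" "finite (P x y)" "finite (P y z)"
        using x y z by (auto simp: carr P_def)
      have sub: "?s (x \<otimes>\<^bsub>?R\<^esub> y) \<subseteq> P x y" "?s (y \<otimes>\<^bsub>?R\<^esub> z) \<subseteq> P y z"
        using supp_mult by (auto simp: P_def)
      show "x \<otimes>\<^bsub>?R\<^esub> y \<otimes>\<^bsub>?R\<^esub> z = x \<otimes>\<^bsub>?R\<^esub> (y \<otimes>\<^bsub>?R\<^esub> z)"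
      proof
        fix g
        have L: "(x \<otimes>\<^bsub>?R\<^esub> y \<otimes>\<^bsub>?R\<^esub> z) g = (\<Sum>a\<in>?s x. \<Sum>b\<in>?s y. \<Sum>c\<in>?s z.
            if a \<otimes>\<^bsub>G\<^esub> b \<otimes>\<^bsub>G\<^esub> c = g then x a * y b * z c else 0)"
        proof -
          have "(x \<otimes>\<^bsub>?R\<^esub> y \<otimes>\<^bsub>?R\<^esub> z) g = (\<Sum>u\<in>P x y. \<Sum>c\<in>?s z.
              if u \<otimes>\<^bsub>G\<^esub> c = g then (x \<otimes>\<^bsub>?R\<^esub> y) u * z c else 0)"
            by (rule int_group_ring_mult_eq) (use fin sub in auto)
          also have "\<dots> = (\<Sum>u\<in>P x y. \<Sum>c\<in>?s z. \<Sum>a\<in>?s x. \<Sum>b\<in>?s y.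
              if a \<otimes>\<^bsub>G\<^esub> b = u then if u \<otimes>\<^bsub>G\<^esub> c = g then x a * y b * z c else 0 else 0)"
            by (intro sum.cong refl)
               (auto simp: int_group_ring_mult_eq[of "?s x" "?s y"] fin sum_distrib_right
                  intro!: sum.cong sum.neutral)
          also have "\<dots> = (\<Sum>a\<in>?s x. \<Sum>b\<in>?s y. \<Sum>c\<in>?s z. \<Sum>u\<in>P x y.
              if a \<otimes>\<^bsub>G\<^esub> b = u then if u \<otimes>\<^bsub>G\<^esub> c = g then x a * y b * z c else 0 else 0)"
            by (rule sum_swap4)
          also have "\<dots> = (\<Sum>a\<in>?s x. \<Sum>b\<in>?s y. \<Sum>c\<in>?s z.
              if a \<otimes>\<^bsub>G\<^esub> b \<otimes>\<^bsub>G\<^esub> c = g then x a * y b * z c else 0)"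
            by (intro sum.cong refl) (subst sum.delta', auto simp: fin P_def)
          finally show ?thesis .
        qed
        have R: "(x \<otimes>\<^bsub>?R\<^esub> (y \<otimes>\<^bsub>?R\<^esub> z)) g = (\<Sum>a\<in>?s x. \<Sum>b\<in>?s y. \<Sum>c\<in>?s z.
            if a \<otimes>\<^bsub>G\<^esub> (b \<otimes>\<^bsub>G\<^esub> c) = g then x a * y b * z c else 0)"
        proof -
          have "(x \<otimes>\<^bsub>?R\<^esub> (y \<otimes>\<^bsub>?R\<^esub> z)) g = (\<Sum>a\<in>?s x. \<Sum>u\<in>P y z.
              if a \<otimes>\<^bsub>G\<^esub> u = g then x a * (y \<otimes>\<^bsub>?R\<^esub> z) u else 0)"
            by (rule int_group_ring_mult_eq) (use fin sub in auto)
          also have "\<dots> = (\<Sum>a\<in>?s x. \<Sum>u\<in>P y z. \<Sum>b\<in>?s y. \<Sum>c\<in>?s z.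
              if b \<otimes>\<^bsub>G\<^esub> c = u then if a \<otimes>\<^bsub>G\<^esub> u = g then x a * y b * z c else 0 else 0)"
            by (intro sum.cong refl)
               (auto simp: int_group_ring_mult_eq[of "?s y" "?s z"] fin sum_distrib_left
                  mult.assoc intro!: sum.cong sum.neutral)
          also have "\<dots> = (\<Sum>a\<in>?s x. \<Sum>b\<in>?s y. \<Sum>c\<in>?s z. \<Sum>u\<in>P y z.
              if b \<otimes>\<^bsub>G\<^esub> c = u then if a \<otimes>\<^bsub>G\<^esub> u = g then x a * y b * z c else 0 else 0)"
            by (intro sum.cong refl sum_swap3)
          also have "\<dots> = (\<Sum>a\<in>?s x. \<Sum>b\<in>?s y. \<Sum>c\<in>?s z.
              if a \<otimes>\<^bsub>G\<^esub> (b \<otimes>\<^bsub>G\<^esub> c) = g then x a * y b * z c else 0)"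
            by (intro sum.cong refl) (subst sum.delta', auto simp: fin P_def)
          finally show ?thesis .
        qed
        show "(x \<otimes>\<^bsub>?R\<^esub> y \<otimes>\<^bsub>?R\<^esub> z) g = (x \<otimes>\<^bsub>?R\<^esub> (y \<otimes>\<^bsub>?R\<^esub> z)) g"
          unfolding L R
        proof (intro sum.cong refl)
          fix a b c assume "a \<in> ?s x" "b \<in> ?s y" "c \<in> ?s z"
          then have "a \<in> carrier G" "b \<in> carrier G" "c \<in> carrier G"
            using x y z unfolding carr by blast+
          then show "(if a \<otimes>\<^bsub>G\<^esub> b \<otimes>\<^bsub>G\<^esub> c = g then x a * y b * z c else 0) =
              (if a \<otimes>\<^bsub>G\<^esub> (b \<otimes>\<^bsub>G\<^esub> c) = g then x a * y b * z c else 0)"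
            by (simp add: G.m_assoc)
        qed
      qed
    next
      fix x assume x: "x \<in> carrier ?R"
      have one: "?s \<one>\<^bsub>?R\<^esub> \<subseteq> {\<one>\<^bsub>G\<^esub>}" "\<one>\<^bsub>?R\<^esub> \<one>\<^bsub>G\<^esub> = 1"
        by (auto simp: int_group_ring_def)
      have fin: "finite (?s x)" and sub: "?s x \<subseteq> carrier G" using x by (auto simp: carr)
      show "\<one>\<^bsub>?R\<^esub> \<otimes>\<^bsub>?R\<^esub> x = x"
      proof
        fix g
        have "(\<one>\<^bsub>?R\<^esub> \<otimes>\<^bsub>?R\<^esub> x) g = (\<Sum>k\<in>?s x. if \<one>\<^bsub>G\<^esub> \<otimes>\<^bsub>G\<^esub> k = g then x k else 0)"
          by (subst int_group_ring_mult_eq[of "{\<one>\<^bsub>G\<^esub>}" "?s x"])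
             (use one fin in \<open>auto cong: if_cong\<close>)
        also have "\<dots> = (\<Sum>k\<in>?s x. if k = g then x k else 0)"
          using sub by (intro sum.cong) (auto simp: subset_iff)
        also have "\<dots> = x g" using fin by (subst sum.delta) auto
        finally show "(\<one>\<^bsub>?R\<^esub> \<otimes>\<^bsub>?R\<^esub> x) g = x g" .
      qed
      show "x \<otimes>\<^bsub>?R\<^esub> \<one>\<^bsub>?R\<^esub> = x"
      proof
        fix g
        have "(x \<otimes>\<^bsub>?R\<^esub> \<one>\<^bsub>?R\<^esub>) g = (\<Sum>k\<in>?s x. if k \<otimes>\<^bsub>G\<^esub> \<one>\<^bsub>G\<^esub> = g then x k else 0)"
          by (subst int_group_ring_mult_eq[of "?s x" "{\<one>\<^bsub>G\<^esub>}"])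
             (use one fin in \<open>auto cong: if_cong\<close>)
        also have "\<dots> = (\<Sum>k\<in>?s x. if k = g then x k else 0)"
          using sub by (intro sum.cong) (auto simp: subset_iff)
        also have "\<dots> = x g" using fin by (subst sum.delta) auto
        finally show "(x \<otimes>\<^bsub>?R\<^esub> \<one>\<^bsub>?R\<^esub>) g = x g" .
      qed
    qed (simp_all add: mult_closed one_closed)
  qed (simp_all add: int_group_ring_l_distr int_group_ring_r_distr)
qed

end

theory Submission
  imports Defs "HOL-Computational_Algebra.Polynomial"
begin

text \<open>
  Write \<open>\<int>[S]\<close> for the free abelian group on a set \<open>S\<close>; if \<open>\<Gamma>\<close> acts on \<open>S\<close>, this is a
  permutation module.  For a module \<open>M\<close> take \<open>S\<close> to be \<open>M\<close> itself.  The counit \<open>\<int>[M] \<rightarrow> M\<close>, which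
  sends the basis element \<open>[m]\<close> to \<open>m\<close>, is onto even on the fixed points of every subgroup, because an
  invariant \<open>m\<close> gives an invariant \<open>[m]\<close>.  Let \<open>K\<close> be its kernel.

  Suppose that all Sylow subgroups are cyclic.  The main point is that the counit \<open>\<int>[K] \<rightarrow> K\<close> has a
  \<open>\<Gamma>\<close>-equivariant section, so that \<open>K\<close> is a direct summand of a permutation module.  Granting
  this, an Eilenberg swindle (\<open>swindle\<close>) turns the sequence \<open>0 \<rightarrow> K \<rightarrow> \<int>[M] \<rightarrow> M \<rightarrow> 0\<close> into
  one whose two left terms are the sum of countably many copies of \<open>\<int>[M] \<oplus> \<int>[K]\<close>.  By averaging over
  cosets it is enough to find a section that is equivariant for one Sylow \<open>p\<close>-subgroup \<open>C\<close> at a time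
  (\<open>splits_transfer\<close>, \<open>sylow_cyclic_splits\<close>).

  Let \<open>C\<close> be cyclic of order \<open>p^n\<close>.  Surjectivity on fixed points and the vanishing of cohomology in
  degree -1 for permutation modules give the same vanishing for \<open>K\<close> and all subgroups of \<open>C\<close>
  (\<open>K_coflasque\<close>).  A generator of \<open>C\<close> acts on the vector space \<open>K/pK\<close> over the field with \<open>p\<close>
  elements with Jordan blocks.  The vanishing forces the length of every block to be a power of \<open>p\<close>
  and the block to be generated by a vector that lifts to a vector of \<open>K\<close> fixed by the corresponding
  subgroup (\<open>jordan_block\<close>).  The lifts generate a permutation module \<open>F\<close> inside \<open>K\<close> such that
  \<open>K/F\<close> is uniquely \<open>p\<close>-divisible.  Over \<open>F\<close> the counit splits by \<open>y \<mapsto> [y]\<close>.  The obstruction to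
  extending this section to \<open>K\<close> comes from a uniquely \<open>p\<close>-divisible group, but it is killed by \<open>p^n\<close>
  because \<open>K\<close> is free as an abelian group; so it vanishes.  The lemma \<open>equivariant_section\<close> writes
  down the resulting formula.

  Conversely, let \<open>M\<close> be the augmentation ideal of \<open>\<int>\<Gamma>\<close> and let \<open>P\<close> be a Sylow \<open>p\<close>-subgroup.
  The crossed homomorphism \<open>g \<mapsto> g - 1\<close> has order exactly \<open>|P|\<close> in the first cohomology of \<open>P\<close> with
  values in \<open>M\<close>.  The first cohomology of a permutation module vanishes, so a presentation
  \<open>0 \<rightarrow> F \<rightarrow> F \<rightarrow> M \<rightarrow> 0\<close> embeds that of \<open>M\<close> into the second cohomology of \<open>F\<close>, which is a sum of groups \<open>Hom(S, \<rat>/\<int>)\<close> over stabilizers \<open>S\<close> of basis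
  elements.  If \<open>P\<close> is not cyclic, then no element of \<open>P\<close> has order \<open>|P|\<close> and all these groups are
  killed by \<open>|P|/p\<close>, a contradiction (\<open>augmentation_obstruction\<close>).
\<close>

section \<open>Polynomials modulo a prime\<close>

lemma dvd_diff_power_same:
  fixes d x y :: "'a::comm_ring_1"
  assumes "d dvd x - y"
  shows "d dvd x ^ k - y ^ k"
proof (induction k)
  case (Suc k)
  have "x ^ Suc k - y ^ Suc k = x * (x ^ k - y ^ k) + (x - y) * y ^ k"
    by (simp add: algebra_simps)
  then show ?case
    using Suc assms by (simp only:) (intro dvd_add dvd_mult dvd_mult2)
qed simp

text \<open>
  The inner binomial coefficients of a prime exponent are divisible by the prime.
\<close>

lemma prime_dvd_one_add_power:
  fixes u :: "'a::comm_ring_1"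
  assumes p: "Factorial_Ring.prime (p::nat)"
  shows "of_nat p dvd (1 + u) ^ p - (1 + u ^ p)"
proof -
  have p2: "p \<ge> 2" using prime_ge_2_nat[OF p] .
  have "(1 + u) ^ p = (\<Sum>k\<le>p. of_nat (p choose k) * u ^ k)"
    using binomial_ring[of u 1 p] by (simp add: add.commute)
  also have "{..p} = insert 0 (insert p {1..<p})"
    using p2 by auto
  finally have "(1 + u) ^ p - (1 + u ^ p) = (\<Sum>k\<in>{1..<p}. of_nat (p choose k) * u ^ k)"
    using p2 by simp
  moreover have "of_nat p dvd (of_nat (p choose k) * u ^ k :: 'a)" if "k \<in> {1..<p}" for k
  proof -
    have "p dvd (p choose k)"
      using that p by (intro dvd_choose_prime) auto
    then obtain c where "p choose k = p * c" by (rule dvdE)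
    then show ?thesis by (simp add: mult.assoc)
  qed
  ultimately show ?thesis
    by (metis (no_types, lifting) dvd_sum)
qed

lemma prime_dvd_one_add_prime_power:
  fixes u :: "'a::comm_ring_1"
  assumes p: "Factorial_Ring.prime (p::nat)"
  shows "of_nat p dvd (1 + u) ^ (p ^ i) - (1 + u ^ (p ^ i))"
proof (induction i)
  case (Suc i)
  have 1: "of_nat p dvd ((1 + u) ^ (p ^ i)) ^ p - (1 + u ^ (p ^ i)) ^ p"
    by (rule dvd_diff_power_same[OF Suc])
  have 2: "of_nat p dvd (1 + u ^ (p ^ i)) ^ p - (1 + (u ^ (p ^ i)) ^ p)"
    by (rule prime_dvd_one_add_power[OF p])
  have "of_nat p dvd ((1 + u) ^ (p ^ i)) ^ p - (1 + (u ^ (p ^ i)) ^ p)"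
    using dvd_add[OF 1 2] by (simp only: diff_add_eq_diff_diff_swap diff_add_cancel add_diff_eq)
  then show ?case
    by (simp only: power_mult[symmetric] power_Suc mult.commute[of p])
qed simp

text \<open>
  Modules over a cyclic group are treated as modules over \<open>\<int>[\<gamma>]\<close>, where \<open>\<gamma>\<close> acts as a chosen generator.
  Modulo \<open>p\<close> the operator \<open>\<tau> = \<gamma> - 1\<close> is nilpotent, and its Jordan blocks are the objects of
  interest.
\<close>

definition \<gamma> :: "int poly" where "\<gamma> = [:0, 1:]"

definition \<tau> :: "int poly" where "\<tau> = [:-1, 1:]"

lemma gamma_minus_1: "\<gamma> - 1 = \<tau>"
  by (simp add: one_pCons \<gamma>_def \<tau>_def)

lemma one_plus_tau: "1 + \<tau> = \<gamma>"
  by (simp add: one_pCons \<gamma>_def \<tau>_def)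

lemma tau_power_prime_power:
  assumes "Factorial_Ring.prime (p::nat)"
  shows "of_nat p dvd (\<gamma> ^ (p ^ i) - 1) - \<tau> ^ (p ^ i)"
  using prime_dvd_one_add_prime_power[OF assms, of \<tau> i] unfolding one_plus_tau
  by (simp add: algebra_simps)

text \<open>
  The norm element of the group of order \<open>m\<close> generated by the image of \<open>\<gamma>^q\<close>, when \<open>\<gamma>\<close> has order
  \<open>q m\<close>.
\<close>

definition geo :: "nat \<Rightarrow> nat \<Rightarrow> int poly" where
  "geo q m = (\<Sum>j<m. \<gamma> ^ (q * j))"

lemma geo_mult: "(\<gamma> ^ q - 1) * geo q m = \<gamma> ^ (q * m) - 1"
  using power_diff_1_eq[of "\<gamma> ^ q" m] by (simp add: geo_def power_mult)

lemma geo_1_mult: "\<tau> * geo 1 m = \<gamma> ^ m - 1"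
  using geo_mult[of 1 m] by (simp add: gamma_minus_1)

lemma gamma_power_nonzero: "q > 0 \<Longrightarrow> \<gamma> ^ q - 1 \<noteq> 0"
proof
  assume "q > 0" "\<gamma> ^ q - 1 = 0"
  then have "poly (\<gamma> ^ q - 1) 0 = 0" by simp
  then show False using \<open>q > 0\<close> by (simp add: zero_power \<gamma>_def)
qed

text \<open>
  Transitivity of norms in a chain of subgroups.
\<close>

lemma geo_geo:
  assumes "q > 0" shows "geo q m * geo (q * m) k = geo q (m * k)"
proof -
  have "(\<gamma> ^ q - 1) * (geo q m * geo (q * m) k) = (\<gamma> ^ q - 1) * geo q (m * k)"
    by (simp add: mult.assoc[symmetric] geo_mult)
  then show ?thesis
    using gamma_power_nonzero[OF assms] by (metis mult_cancel_left)
qed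

text \<open>
  Both sides become congruent to \<open>\<gamma>^(p^i) - 1\<close> after multiplication by \<open>\<tau>\<close>.  The factor \<open>\<tau>\<close> may be
  cancelled modulo \<open>p\<close>, since a multiple of \<open>p\<close> that vanishes at 1 is \<open>p\<close> times a multiple of \<open>\<tau>\<close>.
  So the norm picks out the socle of a Jordan block of length \<open>p^i\<close>.
\<close>

lemma geo_eq_tau_power:
  assumes p: "Factorial_Ring.prime (p::nat)"
  shows "of_nat p dvd geo 1 (p ^ i) - \<tau> ^ (p ^ i - 1)"
proof -
  have pos: "p ^ i > 0" using prime_gt_0_nat[OF p] by simp
  have "\<tau> * (geo 1 (p ^ i) - \<tau> ^ (p ^ i - 1)) = (\<gamma> ^ (p ^ i) - 1) - \<tau> ^ (p ^ i)"
  proof -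
    have "\<tau> ^ (p ^ i) = \<tau> * \<tau> ^ (p ^ i - 1)"
      using pos by (metis Suc_diff_1 power_Suc)
    then show ?thesis
      by (simp only: right_diff_distrib geo_1_mult)
  qed
  then obtain r where r: "\<tau> * (geo 1 (p ^ i) - \<tau> ^ (p ^ i - 1)) = of_nat p * r"
    using tau_power_prime_power[OF p, of i] by (metis dvdE)
  have "poly (of_nat p * r) 1 = 0"
    unfolding r[symmetric] by (simp add: \<tau>_def)
  then have "poly r 1 = 0"
    using prime_gt_0_nat[OF p] by (simp add: of_nat_poly)
  then obtain r' where "r = \<tau> * r'"
    unfolding \<tau>_def by (metis poly_eq_0_iff_dvd dvdE)
  then have "\<tau> * (geo 1 (p ^ i) - \<tau> ^ (p ^ i - 1)) = \<tau> * (of_nat p * r')"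
    using r by (simp add: mult_ac)
  then have "geo 1 (p ^ i) - \<tau> ^ (p ^ i - 1) = of_nat p * r'"
    by (simp add: \<tau>_def del: mult_pCons_left)
  then show ?thesis by simp
qed

section \<open>Lattices over a cyclic group of prime power order\<close>

text \<open>
  The last assumption is the vanishing of cohomology in degree -1, for \<open>K\<close> and every subgroup
  of the cyclic group of order \<open>p^n\<close>: an element of norm zero is of the form \<open>(g - 1) z\<close>, where \<open>g\<close>
  generates the subgroup.  For cyclic groups this is the same as the vanishing of the first
  cohomology.
\<close>

locale cyclic_p_lattice = Modules.module scale
  for scale :: "int poly \<Rightarrow> 'b::ab_group_add \<Rightarrow> 'b" (infixr "*s" 75) +
  fixes p n :: nat and K :: "'b set"
  assumes prime_p: "Factorial_Ring.prime p"
    and subspace_K: "subspace K"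
    and torsion_free: "of_nat p *s x = 0 \<Longrightarrow> x = 0"
    and period: "x \<in> K \<Longrightarrow> (\<gamma> ^ (p ^ n) - 1) *s x = 0"
    and coflasque: "\<lbrakk>i \<le> n; x \<in> K; geo (p ^ i) (p ^ (n - i)) *s x = 0\<rbrakk> \<Longrightarrow>
      \<exists>z\<in>K. x = (\<gamma> ^ (p ^ i) - 1) *s z"
begin

definition pK :: "'b set" where "pK = (\<lambda>x. of_nat p *s x) ` K"

text \<open>
  The fixed points of the subgroup of index \<open>p^i\<close>.
\<close>

definition fixed :: "nat \<Rightarrow> 'b set" where
  "fixed i = {y \<in> K. (\<gamma> ^ (p ^ i) - 1) *s y = 0}"

abbreviation nrm :: "nat \<Rightarrow> int poly" where "nrm i \<equiv> geo 1 (p ^ i)"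

lemma p_pos: "p > 0" and p_pow_pos: "p ^ i > 0"
  using prime_gt_0_nat[OF prime_p] by auto

lemma K_add: "x \<in> K \<Longrightarrow> y \<in> K \<Longrightarrow> x + y \<in> K"
  and K_diff: "x \<in> K \<Longrightarrow> y \<in> K \<Longrightarrow> x - y \<in> K"
  and K_scale: "x \<in> K \<Longrightarrow> f *s x \<in> K"
  and K_sum: "(\<And>x. x \<in> B \<Longrightarrow> g x \<in> K) \<Longrightarrow> sum g B \<in> K"
  and K_0: "0 \<in> K"
  using subspace_K by (auto intro: subspace_add subspace_diff subspace_scale subspace_sum subspace_0)

lemma subspace_pK: "subspace pK"
  unfolding pK_def
proof (rule subspaceI)
  show "0 \<in> (\<lambda>x. of_nat p *s x) ` K" using K_0 by force
next
  fix x y assume "x \<in> (\<lambda>x. of_nat p *s x) ` K" "y \<in> (\<lambda>x. of_nat p *s x) ` K"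
  then show "x + y \<in> (\<lambda>x. of_nat p *s x) ` K"
    using K_add by (auto simp: scale_right_distrib[symmetric])
next
  fix c x assume "x \<in> (\<lambda>x. of_nat p *s x) ` K"
  then obtain k where k: "k \<in> K" "x = of_nat p *s k" by blast
  then have "c *s x = of_nat p *s (c *s k)" by (simp add: mult.commute)
  then show "c *s x \<in> (\<lambda>x. of_nat p *s x) ` K"
    using K_scale[OF k(1)] by blast
qed

lemma pK_add: "x \<in> pK \<Longrightarrow> y \<in> pK \<Longrightarrow> x + y \<in> pK"
  and pK_diff: "x \<in> pK \<Longrightarrow> y \<in> pK \<Longrightarrow> x - y \<in> pK"
  and pK_minus: "x \<in> pK \<Longrightarrow> - x \<in> pK"
  and pK_scale: "x \<in> pK \<Longrightarrow> f *s x \<in> pK"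
  and pK_sum: "(\<And>x. x \<in> B \<Longrightarrow> g x \<in> pK) \<Longrightarrow> sum g B \<in> pK"
  and pK_0: "0 \<in> pK"
  using subspace_pK by (auto intro: subspace_add subspace_diff subspace_scale subspace_sum subspace_0 subspace_neg)

lemma dvd_scale_pK: "of_nat p dvd f \<Longrightarrow> x \<in> K \<Longrightarrow> f *s x \<in> pK"
  unfolding pK_def dvd_def using K_scale by (auto simp flip: scale_scale)

lemma dvd_diff_scale_pK: "of_nat p dvd f - g \<Longrightarrow> x \<in> K \<Longrightarrow> f *s x - g *s x \<in> pK"
  using dvd_scale_pK[of "f - g" x] by (simp add: scale_left_diff_distrib)

lemma pK_trans: "x - y \<in> pK \<Longrightarrow> y - z \<in> pK \<Longrightarrow> x - z \<in> pK"
  using pK_add by fastforce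

lemma pK_sym: "x - y \<in> pK \<Longrightarrow> y - x \<in> pK"
  using pK_minus by fastforce

lemma torsion_free_power: "of_nat (p ^ i) *s x = 0 \<Longrightarrow> x = 0"
proof (induction i arbitrary: x)
  case (Suc i)
  then have "of_nat p *s (of_nat (p ^ i) *s x) = 0"
    by simp
  then show ?case using torsion_free Suc.IH by blast
qed simp

lemma fixed_K: "y \<in> fixed i \<Longrightarrow> y \<in> K"
  by (simp add: fixed_def)

lemma fixed_scale: "y \<in> fixed i \<Longrightarrow> f *s y \<in> fixed i"
  by (auto simp: fixed_def K_scale scale_left_commute[of _ f] simp del: scale_scale)

lemma fixed_diff: "x \<in> fixed i \<Longrightarrow> y \<in> fixed i \<Longrightarrow> x - y \<in> fixed i"
  by (auto simp: fixed_def K_diff scale_right_diff_distrib)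

lemma fixed_D: "y \<in> fixed i \<Longrightarrow> (\<gamma> ^ (p ^ i) - 1) *s y = 0"
  by (simp add: fixed_def)

lemma fixed_mono:
  assumes "i \<le> j" "y \<in> fixed i" shows "y \<in> fixed j"
proof -
  have "p ^ j = p ^ i * p ^ (j - i)" using assms(1) by (simp flip: power_add)
  then have "\<gamma> ^ (p ^ j) - 1 = geo (p ^ i) (p ^ (j - i)) * (\<gamma> ^ (p ^ i) - 1)"
    by (simp add: geo_mult mult.commute)
  then show ?thesis
    using assms(2) by (auto simp: fixed_def simp flip: scale_scale)
qed

lemma fixed_n: "K = fixed n"
  using period by (auto simp: fixed_def)

lemma fixed_power:
  assumes "y \<in> fixed i" shows "\<gamma> ^ (p ^ i * j) *s y = y"
proof (induction j)
  case (Suc j)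
  have "\<gamma> ^ (p ^ i) *s y = y" using fixed_D[OF assms] by (simp add: scale_left_diff_distrib)
  then show ?case using Suc by (simp add: power_add mult.commute flip: scale_scale)
qed simp

lemma geo_fixed:
  assumes "y \<in> fixed i" shows "geo (p ^ i) m *s y = of_nat m *s y"
  by (simp add: geo_def scale_sum_left fixed_power[OF assms] sum_constant_scale)

lemma tau_power_kills:
  assumes "y \<in> fixed i" "m \<ge> p ^ i" shows "\<tau> ^ m *s y \<in> pK"
proof -
  have "(\<gamma> ^ (p ^ i) - 1) *s y - \<tau> ^ (p ^ i) *s y \<in> pK"
    by (intro dvd_diff_scale_pK tau_power_prime_power prime_p fixed_K[OF assms(1)])
  then have "\<tau> ^ (p ^ i) *s y \<in> pK"
    using fixed_D[OF assms(1)] pK_minus by fastforce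
  then have "\<tau> ^ (m - p ^ i) *s (\<tau> ^ (p ^ i) *s y) \<in> pK" by (rule pK_scale)
  then show ?thesis using assms(2) by (simp flip: power_add)
qed

lemma nrm_tau: "y \<in> K \<Longrightarrow> nrm i *s y - \<tau> ^ (p ^ i - 1) *s y \<in> pK"
  by (intro dvd_diff_scale_pK geo_eq_tau_power prime_p)

text \<open>
  This is the vanishing of the first cohomology of the subgroup, seen through the exact sequence
  \<open>0 \<rightarrow> K \<rightarrow> K \<rightarrow> K/pK \<rightarrow> 0\<close> of multiplication by \<open>p\<close>.
\<close>

lemma fixed_lift:
  assumes "i \<le> n" "x \<in> K" "(\<gamma> ^ (p ^ i) - 1) *s x \<in> pK"
  shows "\<exists>k\<in>fixed i. x - k \<in> pK"
proof -
  obtain y where y: "y \<in> K" "(\<gamma> ^ (p ^ i) - 1) *s x = of_nat p *s y"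
    using assms(3) by (auto simp: pK_def)
  have "p ^ i * p ^ (n - i) = p ^ n" using assms(1) by (simp flip: power_add)
  then have "geo (p ^ i) (p ^ (n - i)) *s ((\<gamma> ^ (p ^ i) - 1) *s x) = 0"
    using period[OF assms(2)] by (simp add: geo_mult mult.commute[of "geo _ _"])
  then have "of_nat p *s (geo (p ^ i) (p ^ (n - i)) *s y) = 0"
    unfolding y by (simp add: mult.commute)
  then have "geo (p ^ i) (p ^ (n - i)) *s y = 0"
    by (rule torsion_free)
  with coflasque[OF assms(1) y(1)] obtain z where z: "z \<in> K" "y = (\<gamma> ^ (p ^ i) - 1) *s z"
    by blast
  have "(\<gamma> ^ (p ^ i) - 1) *s (x - of_nat p *s z) = 0"
    by (simp add: scale_right_diff_distrib y(2)) (simp add: z(2) mult.commute)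
  then have "x - of_nat p *s z \<in> fixed i"
    by (simp add: fixed_def K_diff K_scale assms z)
  then show ?thesis
    using z(1) by (intro bexI[of _ "x - of_nat p *s z"]) (auto simp: pK_def)
qed

text \<open>
  Let \<open>\<tau>^m\<close> kill a vector \<open>v\<close> of \<open>K/pK\<close>, where \<open>m\<close> is more than \<open>p^i\<close> and at most \<open>p^(i+1)\<close>.
  Then \<open>\<tau>^(m-1) v\<close> is the norm of a vector that lifts to a fixed vector \<open>y\<close> of \<open>K\<close>.  If it is not zero,
  it is therefore the socle of a Jordan block of length exactly \<open>p^(i+1)\<close>, so that only powers of \<open>p\<close>
  occur as lengths.

  The vector \<open>\<tau>^(m-1) v\<close> lifts to an invariant \<open>w'\<close> with \<open>w' = (\<gamma>^(p^i) - 1) k' + p x\<close>, where \<open>k'\<close> and \<open>x\<close> are fixed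
  by \<open>\<gamma>^(p^(i+1))\<close>.  The relative norm \<open>N\<close> from \<open>p^(i+1)\<close> down to \<open>p^i\<close> kills
  the first term and multiplies \<open>w'\<close> by \<open>p\<close>, so \<open>w' = N x\<close>.
  Now \<open>N\<close> kills \<open>(\<gamma> - 1) x\<close>, which is therefore \<open>(\<gamma>^(p^i) - 1) y\<close>; this makes
  \<open>x - (1 + \<gamma> + \<dots> + \<gamma>^(p^i - 1)) y\<close> invariant, so \<open>N\<close> multiplies it by \<open>p\<close>, and \<open>w'\<close> is the full
  norm of \<open>y\<close> modulo \<open>p\<close>.
\<close>

lemma jordan_block:
  assumes i: "i < n" and m: "p ^ i < m" "m \<le> p ^ Suc i" and v: "v \<in> K" "\<tau> ^ m *s v \<in> pK"
  shows "\<exists>y\<in>fixed (Suc i). \<tau> ^ (m - 1) *s v - nrm (Suc i) *s y \<in> pK"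
proof -
  let ?q = "p ^ i" and ?q' = "p ^ Suc i"
  let ?d = "\<gamma> ^ ?q - 1"
  have q_pos: "?q > 0" by (rule p_pow_pos)
  have "\<tau> ^ ?q' *s v \<in> pK"
    using pK_scale[OF v(2), of "\<tau> ^ (?q' - m)"] m(2) by (simp flip: power_add)
  moreover have "(\<gamma> ^ ?q' - 1) *s v - \<tau> ^ ?q' *s v \<in> pK"
    by (intro dvd_diff_scale_pK tau_power_prime_power prime_p v)
  ultimately have "(\<gamma> ^ ?q' - 1) *s v \<in> pK"
    using pK_add by fastforce
  then obtain k where k: "k \<in> fixed (Suc i)" "v - k \<in> pK"
    using fixed_lift[of "Suc i" v] i v by auto
  define w where "w = \<tau> ^ (m - 1) *s k"
  have vw: "\<tau> ^ (m - 1) *s v - w \<in> pK"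
    using pK_scale[OF k(2), of "\<tau> ^ (m - 1)"] by (simp add: w_def scale_right_diff_distrib)
  have wK: "w \<in> K" by (simp add: w_def K_scale fixed_K[OF k(1)])
  have "\<tau> *s w - \<tau> ^ m *s v \<in> pK"
  proof -
    have "\<tau> * \<tau> ^ (m - 1) = \<tau> ^ m"
      using m(1) by (metis Suc_diff_1 gr_implies_not0 neq0_conv power_Suc)
    then have "\<tau> *s w = \<tau> ^ m *s k" by (simp add: w_def)
    then show ?thesis
      using pK_scale[OF k(2), of "\<tau> ^ m"] by (simp add: scale_right_diff_distrib pK_sym)
  qed
  then have "\<tau> *s w \<in> pK" using v(2) pK_add by fastforce
  then have "(\<gamma> ^ (p ^ 0) - 1) *s w \<in> pK" by (simp add: gamma_minus_1)
  then obtain w' where w': "w' \<in> fixed 0" "w - w' \<in> pK"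
    using fixed_lift[of 0 w] wK by auto
  \<comment> \<open>\<open>m > p^i\<close> leaves enough powers of \<open>\<tau>\<close> to form \<open>\<gamma>^(p^i) - 1\<close>\<close>
  define k' where "k' = \<tau> ^ (m - 1 - ?q) *s k"
  have k': "k' \<in> fixed (Suc i)" by (simp add: k'_def fixed_scale k)
  have "\<tau> ^ ?q *s k' = w"
    unfolding k'_def w_def using m(1) by (simp flip: power_add)
  moreover have "?d *s k' - \<tau> ^ ?q *s k' \<in> pK"
    by (intro dvd_diff_scale_pK tau_power_prime_power prime_p fixed_K[OF k'])
  ultimately have "?d *s k' - w \<in> pK" by simp
  then have "w' - ?d *s k' \<in> pK" using pK_trans pK_sym w'(2) by blast
  then obtain x where x: "x \<in> K" "w' - ?d *s k' = of_nat p *s x"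
    by (auto simp: pK_def)
  have w'S: "w' \<in> fixed (Suc i)" using w'(1) fixed_mono by blast
  have "of_nat p *s x \<in> fixed (Suc i)"
    unfolding x(2)[symmetric] by (intro fixed_diff fixed_scale k' w'S)
  then have "of_nat p *s ((\<gamma> ^ ?q' - 1) *s x) = 0"
    by (auto simp: fixed_def mult.commute)
  then have xS: "x \<in> fixed (Suc i)"
    using torsion_free x(1) by (auto simp: fixed_def)
  let ?N = "geo ?q p"
  have dN: "?N * ?d = \<gamma> ^ ?q' - 1"
    by (metis geo_mult mult.commute power_Suc)
  have "?N *s w' = of_nat p *s w'"
    by (rule geo_fixed[OF fixed_mono[OF _ w'(1)]]) simp
  moreover have "?N *s (?d *s k') = 0"
    using fixed_D[OF k'] by (simp add: dN)
  ultimately have "of_nat p *s w' = ?N *s (w' - ?d *s k')"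
    by (simp add: scale_right_diff_distrib)
  also have "\<dots> = of_nat p *s (?N *s x)"
    unfolding x(2) by (simp add: mult.commute)
  finally have "of_nat p *s (w' - ?N *s x) = 0"
    by (simp add: scale_right_diff_distrib)
  then have w'x: "w' = ?N *s x"
    using torsion_free by fastforce
  have tw': "\<tau> *s w' = 0"
    using fixed_D[OF w'(1)] by (simp add: gamma_minus_1)
  have full: "geo ?q (p ^ (n - i)) = geo ?q' (p ^ (n - Suc i)) * ?N"
    using geo_geo[OF q_pos, of p "p ^ (n - Suc i)"] i
    by (simp add: mult.commute Suc_diff_Suc flip: power_Suc)
  have "?N *s (\<tau> *s x) = 0"
    using tw' by (simp add: w'x mult.commute)
  then have "geo ?q (p ^ (n - i)) *s (\<tau> *s x) = 0"
    unfolding full by (simp flip: scale_scale)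
  then obtain y where y: "y \<in> K" "\<tau> *s x = ?d *s y"
    using coflasque[of i "\<tau> *s x"] i x(1) K_scale by auto
  \<comment> \<open>the defect \<open>u\<close> of \<open>y\<close> is fixed by \<open>\<gamma>^(p^(i+1))\<close> and has norm zero, so a multiple of it is zero\<close>
  have yS: "y \<in> fixed (Suc i)"
  proof -
    define u where "u = (\<gamma> ^ ?q' - 1) *s y"
    have "?d *s u = \<tau> *s ((\<gamma> ^ ?q' - 1) *s x)"
      by (simp add: u_def mult.commute y(2)[symmetric] flip: scale_scale)
         (metis mult.commute scale_scale y(2))
    also have "\<dots> = 0" using fixed_D[OF xS] by simp
    finally have "u \<in> fixed i" using y(1) by (simp add: fixed_def u_def K_scale)
    then have "u \<in> fixed (Suc i)" by (rule fixed_mono[rotated]) simp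
    then have "geo ?q' (p ^ (n - Suc i)) *s u = of_nat (p ^ (n - Suc i)) *s u"
      by (rule geo_fixed)
    moreover have "geo ?q' (p ^ (n - Suc i)) * (\<gamma> ^ ?q' - 1) = \<gamma> ^ (p ^ n) - 1"
      using i by (simp add: mult.commute geo_mult flip: power_Suc power_add)
    then have "geo ?q' (p ^ (n - Suc i)) *s u = 0"
      using period[OF y(1)] by (simp add: u_def)
    ultimately have "u = 0" using torsion_free_power by metis
    then show ?thesis using y(1) by (simp add: fixed_def u_def)
  qed
  define z where "z = x - nrm i *s y"
  have "\<tau> *s z = 0"
    by (simp add: z_def scale_right_diff_distrib y(2) geo_1_mult[unfolded One_nat_def])
  then have "z \<in> fixed 0"
    using x(1) y(1) by (simp add: fixed_def z_def K_diff K_scale gamma_minus_1)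
  then have "?N *s z = of_nat p *s z"
    by (intro geo_fixed) (rule fixed_mono[rotated], auto)
  moreover have "?N *s z = w' - nrm (Suc i) *s y"
    using geo_geo[of 1 ?q p] by (simp add: z_def scale_right_diff_distrib w'x mult.commute)
  moreover have "of_nat p *s z \<in> pK"
    using x(1) y(1) by (auto simp: pK_def z_def K_diff K_scale)
  ultimately have "w' - nrm (Suc i) *s y \<in> pK" by simp
  then have "\<tau> ^ (m - 1) *s v - nrm (Suc i) *s y \<in> pK"
    using pK_trans vw w'(2) by blast
  then show ?thesis using yS by blast
qed

text \<open>
  Linear independence and span of a family in the vector space \<open>K/pK\<close> over the field with \<open>p\<close>
  elements, expressed with integer coefficients since \<open>p\<close> is a variable.
\<close>

definition p_independent :: "('i \<Rightarrow> 'b) \<Rightarrow> 'i set \<Rightarrow> bool" where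
  "p_independent w S \<longleftrightarrow> (\<forall>A c. finite A \<longrightarrow> A \<subseteq> S \<longrightarrow>
     (\<Sum>s\<in>A. of_int (c s) *s w s) \<in> pK \<longrightarrow> (\<forall>s\<in>A. int p dvd c s))"

definition p_span :: "('i \<Rightarrow> 'b) \<Rightarrow> 'i set \<Rightarrow> 'b set" where
  "p_span w S = {x. \<exists>A c. finite A \<and> A \<subseteq> S \<and> x - (\<Sum>s\<in>A. of_int (c s) *s w s) \<in> pK}"

lemma p_independentD:
  "p_independent w S \<Longrightarrow> finite A \<Longrightarrow> A \<subseteq> S \<Longrightarrow> (\<Sum>s\<in>A. of_int (c s) *s w s) \<in> pK \<Longrightarrow> s \<in> A
    \<Longrightarrow> int p dvd c s"
  unfolding p_independent_def by blast

lemma p_span_mono: "S \<subseteq> S' \<Longrightarrow> p_span w S \<subseteq> p_span w S'"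
  unfolding p_span_def by blast

lemma p_span_base: "s \<in> S \<Longrightarrow> w s \<in> p_span w S"
  unfolding p_span_def by (rule CollectI, rule exI[of _ "{s}"], rule exI[of _ "\<lambda>_. 1"]) (simp add: pK_0)

lemma p_independent_chain_Union:
  assumes "subset.chain {S. p_independent w S} C"
  shows "p_independent w (\<Union>C)"
  unfolding p_independent_def
proof (intro allI impI)
  fix A c assume A: "finite A" "A \<subseteq> \<Union>C" and s: "(\<Sum>s\<in>A. of_int (c s) *s w s) \<in> pK"
  show "\<forall>s\<in>A. int p dvd c s"
  proof (cases "C = {}")
    case True then show ?thesis using A by auto
  next
    case False
    then obtain S where "S \<in> C" "A \<subseteq> S"
      using finite_subset_Union_chain[OF A False assms] by blast
    then show ?thesis
      using p_independentD[of w S A c] A(1) s assms by (auto simp: subset.chain_def)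
  qed
qed

lemma p_independent_extend:
  assumes S0: "p_independent w S0" "S0 \<subseteq> I" and wK: "\<And>s. s \<in> I \<Longrightarrow> w s \<in> K"
  shows "\<exists>S. S0 \<subseteq> S \<and> S \<subseteq> I \<and> p_independent w S \<and> w ` I \<subseteq> p_span w S"
proof -
  let ?F = "{S. S0 \<subseteq> S \<and> S \<subseteq> I \<and> p_independent w S}"
  have "\<exists>S\<in>?F. \<forall>S'\<in>?F. S \<subseteq> S' \<longrightarrow> S' = S"
  proof (rule subset_Zorn_nonempty)
    show "?F \<noteq> {}" using S0 by blast
  next
    fix C assume C: "C \<noteq> {}" "subset.chain ?F C"
    then have "subset.chain {S. p_independent w S} C"
      by (auto simp: subset.chain_def)
    then have "p_independent w (\<Union>C)" by (rule p_independent_chain_Union)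
    then show "\<Union>C \<in> ?F" using C by (auto simp: subset.chain_def)
  qed
  then obtain S where S: "S0 \<subseteq> S" "S \<subseteq> I" "p_independent w S"
    and max: "\<And>S'. S \<subseteq> S' \<Longrightarrow> S' \<subseteq> I \<Longrightarrow> p_independent w S' \<Longrightarrow> S' = S"
    by (smt (verit) mem_Collect_eq order_trans)
  have "w i \<in> p_span w S" if i: "i \<in> I" for i
  proof (cases "i \<in> S")
    case True then show ?thesis by (rule p_span_base)
  next
    case False
    then have "\<not> p_independent w (insert i S)" using max[of "insert i S"] S i by blast
    then obtain A c where A: "finite A" "A \<subseteq> insert i S"
      and s: "(\<Sum>s\<in>A. of_int (c s) *s w s) \<in> pK" and nd: "\<exists>s\<in>A. \<not> int p dvd c s"
      unfolding p_independent_def by blast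
    define R where "R = (\<Sum>s\<in>A - {i}. of_int (c s) *s w s)"
    have AS: "finite (A - {i})" "A - {i} \<subseteq> S" using A by auto
    have "i \<in> A"
      using nd p_independentD[OF S(3) A(1) _ s] A(2) by blast
    then have sum: "of_int (c i) *s w i + R \<in> pK"
      using s A(1) by (simp add: R_def sum.remove)
    have "\<not> int p dvd c i"
    proof
      assume d: "int p dvd c i"
      then have "of_nat p dvd (of_int (c i) :: int poly)"
        by (metis dvd_def of_int_mult of_int_of_nat_eq)
      then have "of_int (c i) *s w i \<in> pK" using wK[OF i] by (rule dvd_scale_pK)
      then have "R \<in> pK" using sum pK_diff by fastforce
      then have "\<forall>s\<in>A - {i}. int p dvd c s"
        using p_independentD[OF S(3) AS] unfolding R_def by blast
      then show False using nd d by blast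
    qed
    then have "coprime (int p) (c i)"
      using prime_p by (intro prime_imp_coprime) auto
    then obtain a b where ab: "a * int p + b * c i = 1"
      by (metis coprime_iff_gcd_eq_1 bezout_int)
    have "w i = (of_int a * of_nat p + of_int b * of_int (c i)) *s w i"
      using arg_cong[OF ab, of "of_int :: int \<Rightarrow> int poly"] by simp
    also have "\<dots> = (of_int a * of_nat p) *s w i + of_int b *s (of_int (c i) *s w i + R) - of_int b *s R"
      by (simp add: scale_left_distrib scale_right_distrib)
    finally have "w i + of_int b *s R = (of_int a * of_nat p) *s w i + of_int b *s (of_int (c i) *s w i + R)"
      by (simp add: algebra_simps)
    also have "\<dots> \<in> pK"
      by (rule pK_add[OF dvd_scale_pK[OF _ wK[OF i]] pK_scale[OF sum]]) simp
    finally have "w i - (\<Sum>s\<in>A - {i}. of_int (- b * c s) *s w s) \<in> pK"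
      by (simp add: R_def scale_sum_right sum_negf)
    then show ?thesis
      unfolding p_span_def
      by (intro CollectI exI[of _ "A - {i}"] exI[of _ "\<lambda>s. - b * c s"] conjI AS)
  qed
  then show ?thesis using S by blast
qed

text \<open>
  An index \<open>(j, y)\<close> stands for a prospective Jordan block of length \<open>p^j\<close> with generator \<open>y\<close>.
\<close>

definition idx :: "nat \<Rightarrow> (nat \<times> 'b) set" where
  "idx i = {(j, y). i \<le> j \<and> j \<le> n \<and> y \<in> fixed j}"

text \<open>
  The socle of the block, by \<open>geo_eq_tau_power\<close>.
\<close>

definition top_vec :: "nat \<times> 'b \<Rightarrow> 'b" where "top_vec s = nrm (fst s) *s snd s"

lemma top_vec_K: "s \<in> idx i \<Longrightarrow> top_vec s \<in> K"
  by (auto simp: idx_def top_vec_def K_scale fixed_K)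

lemma idx_mono: "i \<le> j \<Longrightarrow> idx j \<subseteq> idx i"
  by (auto simp: idx_def)

text \<open>
  The socles of the blocks of length at least \<open>p^j\<close> span a decreasing sequence of subspaces.
  Bases of all of them at once are chosen by starting with the longest blocks.
\<close>

lemma exists_layered_basis:
  "\<exists>S. S \<subseteq> idx 0 \<and> p_independent top_vec S \<and> (\<forall>j\<le>n. top_vec ` idx j \<subseteq> p_span top_vec (S \<inter> idx j))"
proof -
  have "\<exists>S. S \<subseteq> idx i \<and> p_independent top_vec S \<and>
      (\<forall>j. i \<le> j \<and> j \<le> n \<longrightarrow> top_vec ` idx j \<subseteq> p_span top_vec (S \<inter> idx j))" if "i \<le> Suc n" for i
    using that
  proof (induction rule: inc_induct)
    case base
    show ?case by (rule exI[of _ "{}"]) (auto simp: p_independent_def)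
  next
    case (step i)
    then obtain S where S: "S \<subseteq> idx (Suc i)" "p_independent top_vec S"
      "\<And>j. Suc i \<le> j \<Longrightarrow> j \<le> n \<Longrightarrow> top_vec ` idx j \<subseteq> p_span top_vec (S \<inter> idx j)" by blast
    have "S \<subseteq> idx i" using S(1) idx_mono[of i "Suc i"] by auto
    then have "\<exists>S'. S \<subseteq> S' \<and> S' \<subseteq> idx i \<and> p_independent top_vec S' \<and> top_vec ` idx i \<subseteq> p_span top_vec S'"
      by (rule p_independent_extend[OF S(2)]) (rule top_vec_K)
    then obtain S' where S': "S \<subseteq> S'" "S' \<subseteq> idx i" "p_independent top_vec S'" "top_vec ` idx i \<subseteq> p_span top_vec S'"
      by (elim exE conjE)
    have "top_vec ` idx j \<subseteq> p_span top_vec (S' \<inter> idx j)" if "i \<le> j" "j \<le> n" for j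
    proof (cases "j = i")
      case True
      then show ?thesis using S' by (simp add: Int_absorb2)
    next
      case False
      then show ?thesis
        using S(3)[of j] that p_span_mono[of "S \<inter> idx j" "S' \<inter> idx j" top_vec] S'(1) by fastforce
    qed
    then show ?case using S' by blast
  qed
  from this[of 0] show ?thesis by auto
qed

text \<open>
  A vector \<open>v\<close> killed by \<open>\<tau>^m\<close> modulo \<open>p\<close> has \<open>\<tau>^(m-1) v\<close> in the socle.  By \<open>jordan_block\<close> this is a
  combination of socles of blocks of length at least \<open>m\<close>, in which one can divide by \<open>\<tau>^(m-1)\<close>.
  Subtracting the quotient from \<open>v\<close> lowers \<open>m\<close>.
\<close>

lemma layered_basis_spans:
  assumes S: "S \<subseteq> idx 0" and sp: "\<And>j. j \<le> n \<Longrightarrow> top_vec ` idx j \<subseteq> p_span top_vec (S \<inter> idx j)"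
    and v: "v \<in> K" "\<tau> ^ m *s v \<in> pK" and m: "m \<le> p ^ n"
  shows "\<exists>u\<in>span (snd ` S). v - u \<in> pK"
  using v m
proof (induction m arbitrary: v)
  case 0
  then show ?case using span_zero by (intro bexI[of _ 0]) auto
next
  case (Suc m)
  have "\<exists>j y. j \<le> n \<and> y \<in> fixed j \<and> Suc m \<le> p ^ j \<and> \<tau> ^ m *s v - nrm j *s y \<in> pK"
  proof (cases "m = 0")
    case True
    then have "(\<gamma> ^ (p ^ 0) - 1) *s v \<in> pK" using Suc.prems by (simp add: gamma_minus_1)
    then obtain y where "y \<in> fixed 0" "v - y \<in> pK"
      using fixed_lift[of 0 v] Suc.prems by auto
    then show ?thesis using True by (intro exI[of _ 0] exI[of _ y]) (simp add: geo_def)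
  next
    case False
    define i where "i = (LEAST i. Suc m \<le> p ^ i)"
    have i: "Suc m \<le> p ^ i" unfolding i_def by (rule LeastI[of _ n]) (rule Suc.prems)
    have "i \<le> n" unfolding i_def by (rule Least_le) (rule Suc.prems)
    have "i \<noteq> 0" using i False by (intro notI) simp
    then obtain i' where i': "i = Suc i'" by (cases i) auto
    have "\<not> Suc m \<le> p ^ i'"
      using not_less_Least[of i' "\<lambda>i. Suc m \<le> p ^ i"] i' by (auto simp: i_def)
    then have "\<exists>y\<in>fixed (Suc i'). \<tau> ^ (Suc m - 1) *s v - nrm (Suc i') *s y \<in> pK"
      using i i' \<open>i \<le> n\<close> Suc.prems by (intro jordan_block) auto
    then obtain y where "y \<in> fixed i" "\<tau> ^ m *s v - nrm i *s y \<in> pK"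
      unfolding i' diff_Suc_1 by blast
    then show ?thesis using i \<open>i \<le> n\<close> by blast
  qed
  then obtain j y where j: "j \<le> n" "y \<in> fixed j" "Suc m \<le> p ^ j" "\<tau> ^ m *s v - nrm j *s y \<in> pK"
    by blast
  have "top_vec (j, y) \<in> p_span top_vec (S \<inter> idx j)"
    using sp[OF j(1)] j(1,2) by (auto simp: idx_def)
  then obtain A c where A: "finite A" "A \<subseteq> S \<inter> idx j"
    and sum: "nrm j *s y - (\<Sum>s\<in>A. of_int (c s) *s top_vec s) \<in> pK"
    unfolding p_span_def by (auto simp: top_vec_def)
  define u where "u = (\<Sum>s\<in>A. (of_int (c s) * \<tau> ^ (p ^ fst s - Suc m)) *s snd s)"
  have "snd s \<in> K" if "s \<in> A" for s using that A(2) by (auto simp: idx_def fixed_K)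
  note AK = this
  have uK: "u \<in> K" unfolding u_def by (intro K_sum K_scale AK)
  have uspan: "u \<in> span (snd ` S)"
    unfolding u_def using A(2) by (intro span_sum span_scale span_base) auto
  have "(\<Sum>s\<in>A. of_int (c s) *s top_vec s) - \<tau> ^ m *s u
      = (\<Sum>s\<in>A. of_int (c s) *s (nrm (fst s) *s snd s - \<tau> ^ (p ^ fst s - 1) *s snd s))"
  proof -
    have "\<tau> ^ m *s ((of_int (c s) * \<tau> ^ (p ^ fst s - Suc m)) *s snd s)
        = of_int (c s) *s \<tau> ^ (p ^ fst s - 1) *s snd s" if "s \<in> A" for s
    proof -
      have "j \<le> fst s" using that A(2) by (auto simp: idx_def)
      then have "p ^ j \<le> p ^ fst s" using p_pos by (intro power_increasing) auto
      then have "p ^ fst s - 1 = m + (p ^ fst s - Suc m)" using j(3) by linarith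
      then show ?thesis by (simp add: power_add mult_ac)
    qed
    then show ?thesis
      unfolding u_def scale_sum_right sum_subtractf[symmetric] top_vec_def
      by (intro sum.cong refl) (simp only: scale_right_diff_distrib)
  qed
  also have "\<dots> \<in> pK"
    by (intro pK_sum pK_scale nrm_tau AK)
  finally have "nrm j *s y - \<tau> ^ m *s u \<in> pK" using sum pK_trans by blast
  then have "\<tau> ^ m *s v - \<tau> ^ m *s u \<in> pK" using j(4) pK_trans by blast
  then have "\<tau> ^ m *s (v - u) \<in> pK" by (simp add: scale_right_diff_distrib)
  then obtain u' where "u' \<in> span (snd ` S)" "v - u - u' \<in> pK"
    using Suc.IH[of "v - u"] Suc.prems uK K_diff by auto
  then show ?case using uspan by (intro bexI[of _ "u + u'"] span_add) (auto simp: algebra_simps)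
qed

lemma layered_basis_spans_K:
  assumes S: "S \<subseteq> idx 0" and sp: "\<And>j. j \<le> n \<Longrightarrow> top_vec ` idx j \<subseteq> p_span top_vec (S \<inter> idx j)"
    and v: "v \<in> K"
  shows "\<exists>u\<in>span (snd ` S). v - u \<in> pK"
  using layered_basis_spans[OF S sp v, of "p ^ n"] tau_power_kills[of v n "p ^ n"] v fixed_n
  by auto

lemma dvd_decomp_at_1:
  "\<exists>h. (g :: int poly) = of_int (poly g 1) + \<tau> * h"
proof -
  have "poly (g - of_int (poly g 1)) 1 = 0" by (simp add: of_int_poly)
  then have "\<tau> dvd g - of_int (poly g 1)" unfolding \<tau>_def by (simp only: poly_eq_0_iff_dvd)
  then show ?thesis by (auto simp: dvd_def algebra_simps)
qed

text \<open>
  In a relation modulo \<open>p\<close> between the blocks, the \<open>\<tau>\<close>-adic order of every coefficient is at least the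
  length of its block.  If all coefficients generate submodules of length at most \<open>r + 1\<close>, then
  \<open>\<tau>^r\<close> maps the relation to one between socles; the independence of these shows that the lengths
  are at most \<open>r\<close>.
\<close>

lemma layered_basis_independent:
  assumes S: "S \<subseteq> idx 0" "p_independent top_vec S"
    and A: "finite A" "A \<subseteq> S" and sum: "(\<Sum>s\<in>A. f s *s snd s) \<in> pK" and s: "s \<in> A"
  shows "\<exists>g h. f s = of_nat p * g + (\<gamma> ^ (p ^ fst s) - 1) * h"
proof -
  have AK: "snd s \<in> K" and Afix: "snd s \<in> fixed (fst s)" if "s \<in> A" for s
    using that A(2) S(1) by (auto simp: idx_def fixed_K)
  \<comment> \<open>truncated subtraction: blocks of length at most \<open>r\<close> impose no condition\<close>
  define good where "good r \<longleftrightarrow> (\<forall>s\<in>A. \<exists>g. of_nat p dvd f s - \<tau> ^ (p ^ fst s - r) * g)" for r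
  have "p ^ fst s \<le> p ^ n" if "s \<in> A" for s
    using that A(2) S(1) p_pos by (intro power_increasing) (auto simp: idx_def)
  then have start: "good (p ^ n)" unfolding good_def by (metis cancel_comm_monoid_add_class.diff_cancel diff_is_0_eq dvd_0_right mult_1 power_0)
  have step: "good r" if good_Suc: "good (Suc r)" for r
  proof -
    obtain g where g: "\<And>s. s \<in> A \<Longrightarrow> of_nat p dvd f s - \<tau> ^ (p ^ fst s - Suc r) * g s"
      using bchoice[OF good_Suc[unfolded good_def]] by blast
    obtain h where h: "\<And>s. g s = of_int (poly (g s) 1) + \<tau> * h s"
      using choice[of "\<lambda>s h. g s = of_int (poly (g s) 1) + \<tau> * h"] dvd_decomp_at_1 by blast
    let ?c = "\<lambda>s. if r < p ^ fst s then poly (g s) 1 else 0"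
    have "\<tau> ^ r *s (f s *s snd s) - of_int (?c s) *s top_vec s \<in> pK" if sA: "s \<in> A" for s
    proof (cases "r < p ^ fst s")
      case True
      then have e: "r + (p ^ fst s - Suc r) = p ^ fst s - 1" by simp
      have "of_nat p dvd \<tau> ^ r * (f s - \<tau> ^ (p ^ fst s - Suc r) * g s)"
        by (rule dvd_mult[OF g[OF sA]])
      also have "\<tau> ^ r * (f s - \<tau> ^ (p ^ fst s - Suc r) * g s) = \<tau> ^ r * f s - \<tau> ^ (p ^ fst s - 1) * g s"
        unfolding e[symmetric] power_add by (simp add: algebra_simps)
      finally have 1: "(\<tau> ^ r * f s) *s snd s - (\<tau> ^ (p ^ fst s - 1) * g s) *s snd s \<in> pK"
        by (rule dvd_diff_scale_pK[OF _ AK[OF sA]])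
      have "\<tau> ^ (p ^ fst s - 1) * g s = of_int (poly (g s) 1) * \<tau> ^ (p ^ fst s - 1) + h s * \<tau> ^ Suc (p ^ fst s - 1)"
        by (subst h) (simp add: algebra_simps)
      also have "Suc (p ^ fst s - 1) = p ^ fst s" using True by simp
      finally have 2: "(\<tau> ^ (p ^ fst s - 1) * g s) *s snd s
          = of_int (poly (g s) 1) *s \<tau> ^ (p ^ fst s - 1) *s snd s + h s *s \<tau> ^ (p ^ fst s) *s snd s"
        by (simp add: scale_left_distrib)
      have "h s *s \<tau> ^ (p ^ fst s) *s snd s \<in> pK"
        by (intro pK_scale tau_power_kills[OF Afix[OF sA]]) simp
      then have 3: "(\<tau> ^ (p ^ fst s - 1) * g s) *s snd s - of_int (poly (g s) 1) *s \<tau> ^ (p ^ fst s - 1) *s snd s \<in> pK"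
        unfolding 2 by simp
      have "of_int (poly (g s) 1) *s (nrm (fst s) *s snd s - \<tau> ^ (p ^ fst s - 1) *s snd s) \<in> pK"
        by (intro pK_scale nrm_tau AK sA)
      then have 4: "of_int (poly (g s) 1) *s \<tau> ^ (p ^ fst s - 1) *s snd s - of_int (poly (g s) 1) *s top_vec s \<in> pK"
        unfolding top_vec_def scale_right_diff_distrib by (rule pK_sym)
      from pK_trans[OF pK_trans[OF 1 3] 4] show ?thesis using True by simp
    next
      case False
      then have "f s *s \<tau> ^ r *s snd s \<in> pK"
        by (intro pK_scale tau_power_kills[OF Afix[OF sA]]) simp
      then show ?thesis using False by (simp add: mult.commute)
    qed
    then have "(\<Sum>s\<in>A. \<tau> ^ r *s (f s *s snd s) - of_int (?c s) *s top_vec s) \<in> pK"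
      by (rule pK_sum)
    then have "\<tau> ^ r *s (\<Sum>s\<in>A. f s *s snd s) - (\<Sum>s\<in>A. of_int (?c s) *s top_vec s) \<in> pK"
      by (simp only: sum_subtractf scale_sum_right)
    from pK_diff[OF pK_scale[OF sum, of "\<tau> ^ r"] this]
    have "(\<Sum>s\<in>A. of_int (?c s) *s top_vec s) \<in> pK"
      by (simp only: diff_diff_eq2 add_diff_cancel_left')
    then have c: "int p dvd ?c s" if "s \<in> A" for s
      using p_independentD[OF S(2) A, of ?c s] that by blast
    show ?thesis unfolding good_def
    proof (intro ballI)
      fix s assume sA: "s \<in> A"
      show "\<exists>g. of_nat p dvd f s - \<tau> ^ (p ^ fst s - r) * g"
      proof (cases "r < p ^ fst s")
        case True
        then have "int p dvd poly (g s) 1" using c[OF sA] by simp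
        then have "of_nat p dvd (of_int (poly (g s) 1) :: int poly)"
          by (metis dvd_def of_int_mult of_int_of_nat_eq)
        then have "of_nat p dvd (f s - \<tau> ^ (p ^ fst s - Suc r) * g s) + \<tau> ^ (p ^ fst s - Suc r) * of_int (poly (g s) 1)"
          by (intro dvd_add g sA dvd_mult)
        also have "(f s - \<tau> ^ (p ^ fst s - Suc r) * g s) + \<tau> ^ (p ^ fst s - Suc r) * of_int (poly (g s) 1)
           = f s - \<tau> ^ Suc (p ^ fst s - Suc r) * h s"
          by (subst (1) h) (simp add: algebra_simps)
        also have "Suc (p ^ fst s - Suc r) = p ^ fst s - r" using True by simp
        finally show ?thesis by blast
      next
        case False
        then show ?thesis by (intro exI[of _ "f s"]) simp
      qed
    qed
  qed
  have "good r \<Longrightarrow> good 0" for r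
    by (induction r) (auto intro: step)
  then have "good 0" using start by blast
  then obtain g where "of_nat p dvd f s - \<tau> ^ (p ^ fst s) * g"
    using s unfolding good_def by auto
  moreover have "of_nat p dvd ((\<gamma> ^ (p ^ fst s) - 1) - \<tau> ^ (p ^ fst s)) * g"
    by (intro dvd_mult2 tau_power_prime_power prime_p)
  ultimately have "of_nat p dvd (f s - \<tau> ^ (p ^ fst s) * g) - ((\<gamma> ^ (p ^ fst s) - 1) - \<tau> ^ (p ^ fst s)) * g"
    by (rule dvd_diff)
  also have "(f s - \<tau> ^ (p ^ fst s) * g) - ((\<gamma> ^ (p ^ fst s) - 1) - \<tau> ^ (p ^ fst s)) * g
     = f s - (\<gamma> ^ (p ^ fst s) - 1) * g" by (simp add: algebra_simps)
  finally show ?thesis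
    by (auto simp: dvd_def diff_eq_eq)
qed

end

section \<open>Splitting over a cyclic group of prime power order\<close>

text \<open>
  The situation of the counit \<open>\<pi> : \<int>[K] \<rightarrow> K\<close> with \<open>e y\<close> the basis element of \<open>y\<close>.  The last assumption
  says that \<open>K\<close> is projective as an abelian group: a subgroup \<open>R\<close> of \<open>K \<times> Q\<close> that projects onto \<open>K\<close>
  contains the graph of a homomorphism.
\<close>

locale cyclic_p_cover = cyclic_p_lattice scale p n K + Q: Modules.module scaleQ
  for scale :: "int poly \<Rightarrow> 'b::ab_group_add \<Rightarrow> 'b" (infixr "*s" 75)
    and scaleQ :: "int poly \<Rightarrow> 'c::ab_group_add \<Rightarrow> 'c" (infixr "*q" 75)
    and p n :: nat and K :: "'b set" +
  fixes Q :: "'c set" and \<pi> :: "'c \<Rightarrow> 'b" and e :: "'b \<Rightarrow> 'c"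
  assumes subspace_Q: "Q.subspace Q"
    and pi_add: "\<pi> (x + x') = \<pi> x + \<pi> x'"
    and pi_scale: "\<pi> (f *q x) = f *s \<pi> x"
    and pi_Q: "x \<in> Q \<Longrightarrow> \<pi> x \<in> K"
    and e_Q: "y \<in> K \<Longrightarrow> e y \<in> Q"
    and pi_e: "y \<in> K \<Longrightarrow> \<pi> (e y) = y"
    and e_fixed: "y \<in> K \<Longrightarrow> (\<gamma> ^ (p ^ i) - 1) *s y = 0 \<Longrightarrow> (\<gamma> ^ (p ^ i) - 1) *q e y = 0"
    and period_Q: "x \<in> Q \<Longrightarrow> (\<gamma> ^ (p ^ n) - 1) *q x = 0"
    and separated: "(\<And>k. \<exists>z. x = of_nat (p ^ k) *q z) \<Longrightarrow> x = 0"
    and projective: "\<And>R. \<lbrakk>\<And>k. k \<in> K \<Longrightarrow> \<exists>a\<in>Q. R k a;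
      \<And>k k' a a'. R k a \<Longrightarrow> R k' a' \<Longrightarrow> R (k - k') (a - a')\<rbrakk> \<Longrightarrow>
      \<exists>\<sigma>. (\<forall>k\<in>K. \<sigma> k \<in> Q \<and> R k (\<sigma> k)) \<and> (\<forall>k\<in>K. \<forall>k'\<in>K. \<sigma> (k + k') = \<sigma> k + \<sigma> k')"
begin

sublocale pi: Modules.additive \<pi>
  by standard (rule pi_add)

lemma pi_span: "u \<in> span B \<Longrightarrow> B \<subseteq> K \<Longrightarrow> \<exists>x\<in>Q.span (e ` B). \<pi> x = u"
proof (induction rule: span_induct_alt)
  case base
  then show ?case by (intro bexI[of _ 0]) (auto simp: pi.zero Q.span_zero)
next
  case (step c x y)
  then obtain z where z: "z \<in> Q.span (e ` B)" "\<pi> z = y" by blast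
  have "x \<in> K" "e x \<in> e ` B" using step by auto
  then have "\<pi> (c *q e x + z) = c *s x + y" "c *q e x + z \<in> Q.span (e ` B)"
    using z(2) Q.span_add[OF Q.span_scale[OF Q.span_base] z(1)] by (simp_all add: pi_add pi_scale pi_e)
  then show ?case by blast
qed

text \<open>
  Let \<open>F\<close> be the submodule generated by the layered basis.  It is the isomorphic image of the
  submodule \<open>FQ\<close> of \<open>Q\<close> generated by the images of the basis under \<open>e\<close>, and \<open>K/F\<close> is uniquely
  \<open>p\<close>-divisible.  Choose an additive \<open>\<sigma> : K \<rightarrow> Q\<close> such that \<open>\<pi> \<sigma>\<close> is division by \<open>p^n\<close> modulo \<open>F\<close>.  The
  average \<open>\<theta>\<close> of its conjugates is equivariant, and summing over the \<open>p^n\<close> group elements makes \<open>\<pi> \<theta>\<close>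
  the identity modulo \<open>F\<close>.  The error lies in \<open>F\<close>, where the inverse \<open>\<rho>\<close> of \<open>\<pi>\<close> corrects it.
\<close>

theorem equivariant_section:
  "\<exists>\<sigma>. (\<forall>k\<in>K. \<sigma> k \<in> Q \<and> \<pi> (\<sigma> k) = k \<and> \<sigma> (\<gamma> *s k) = \<gamma> *q \<sigma> k) \<and>
       (\<forall>k\<in>K. \<forall>k'\<in>K. \<sigma> (k + k') = \<sigma> k + \<sigma> k')"
proof -
  obtain S where S: "S \<subseteq> idx 0" "p_independent top_vec S"
    and sp: "\<And>j. j \<le> n \<Longrightarrow> top_vec ` idx j \<subseteq> p_span top_vec (S \<inter> idx j)"
    using exists_layered_basis by blast
  have SK: "snd s \<in> K" and Sfix: "snd s \<in> fixed (fst s)" if "s \<in> S" for s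
    using that S(1) by (auto simp: idx_def fixed_K)
  define B where "B = snd ` S"
  have BK: "B \<subseteq> K" using SK by (auto simp: B_def)
  define F where "F = span B"
  define FQ where "FQ = Q.span (e ` B)"
  have FQ_Q: "FQ \<subseteq> Q"
    unfolding FQ_def using BK e_Q by (intro Q.span_minimal subspace_Q) auto
  have F_pi: "\<exists>x\<in>FQ. \<pi> x = u" if "u \<in> F" for u
    using pi_span[of u B] that BK by (auto simp: F_def FQ_def)
  have pi_F: "\<pi> x \<in> F" if "x \<in> FQ" for x
    using that unfolding FQ_def
  proof (induction rule: Q.span_induct_alt)
    case base
    then show ?case by (simp add: pi.zero F_def span_zero)
  next
    case (step c x y)
    then obtain b where b: "b \<in> B" "x = e b" by blast
    then have "\<pi> (c *q x + y) = c *s b + \<pi> y"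
      using BK by (auto simp: pi_add pi_scale pi_e)
    also have "\<dots> \<in> F"
      using step(2) span_add[OF span_scale[OF span_base[OF b(1)]]] unfolding F_def by blast
    finally show ?case .
  qed
  have divide: "\<exists>x'\<in>FQ. x = of_nat p *q x'" if x: "x \<in> FQ" "\<pi> x \<in> pK" for x
  proof -
    from x(1) obtain t r where t: "finite t" "t \<subseteq> (\<lambda>s. e (snd s)) ` S" and xr: "x = (\<Sum>a\<in>t. r a *q a)"
      unfolding FQ_def B_def Q.span_explicit image_image by blast
    obtain A where A': "A \<subseteq> S" "inj_on (\<lambda>s. e (snd s)) A" "t = (\<lambda>s. e (snd s)) ` A"
      using t(2) unfolding subset_image_inj by blast
    note A = A'(1) finite_imageD[OF t(1)[unfolded A'(3)] A'(2)] A'(2,3)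
    define f where "f s = r (e (snd s))" for s :: "nat \<times> 'b"
    have xf: "x = (\<Sum>s\<in>A. f s *q e (snd s))"
      unfolding xr A(4) f_def by (simp add: sum.reindex[OF A(3)])
    have "\<pi> x = (\<Sum>s\<in>A. f s *s snd s)"
      unfolding xf pi.sum using A(1) SK by (intro sum.cong) (auto simp: pi_scale pi_e)
    with x(2) have "\<exists>g h. f s = of_nat p * g + (\<gamma> ^ (p ^ fst s) - 1) * h" if "s \<in> A" for s
      using layered_basis_independent[OF S A(2,1) _ that, of f] by simp
    then obtain g h where gh: "\<And>s. s \<in> A \<Longrightarrow> f s = of_nat p * g s + (\<gamma> ^ (p ^ fst s) - 1) * h s"
      by metis
    have "f s *q e (snd s) = of_nat p *q (g s *q e (snd s))" if "s \<in> A" for s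
    proof -
      have "(\<gamma> ^ (p ^ fst s) - 1) *q e (snd s) = 0"
        by (intro e_fixed fixed_D SK Sfix subsetD[OF A(1) that])
      then have "h s *q ((\<gamma> ^ (p ^ fst s) - 1) *q e (snd s)) = 0" by (simp only: Q.scale_zero_right)
      then show ?thesis
        unfolding gh[OF that] by (simp add: Q.scale_left_distrib mult.commute)
    qed
    then have "x = of_nat p *q (\<Sum>s\<in>A. g s *q e (snd s))"
      unfolding xf Q.scale_sum_right by (intro sum.cong) auto
    moreover have "(\<Sum>s\<in>A. g s *q e (snd s)) \<in> FQ"
      unfolding FQ_def B_def using A(1) by (intro Q.span_sum Q.span_scale Q.span_base) auto
    ultimately show ?thesis by blast
  qed
  \<comment> \<open>by \<open>divide\<close>, an element of the kernel can be divided by \<open>p\<close> within the kernel indefinitely\<close>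
  have inj: "x = 0" if x: "x \<in> FQ" "\<pi> x = 0" for x
  proof (rule separated)
    have "\<exists>z\<in>FQ. x = of_nat (p ^ k) *q z \<and> \<pi> z = 0" for k
    proof (induction k)
      case 0
      then show ?case using x by auto
    next
      case (Suc k)
      then obtain z where z: "z \<in> FQ" "x = of_nat (p ^ k) *q z" "\<pi> z = 0" by blast
      then obtain z' where z': "z' \<in> FQ" "z = of_nat p *q z'" using divide[of z] pK_0 by auto
      then have "\<pi> z' = 0" using z(3) torsion_free by (simp add: pi_scale)
      then show ?case using z z' by (intro bexI[of _ z']) (auto simp: mult.commute)
    qed
    then show "\<exists>z. x = of_nat (p ^ k) *q z" for k by blast
  qed
  have inj': "x = y" if "x \<in> FQ" "y \<in> FQ" "\<pi> x = \<pi> y" for x y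
    using inj[of "x - y"] that by (auto simp: FQ_def Q.span_diff pi.diff)
  \<comment> \<open>\<open>K/F\<close> has no \<open>p\<close>-torsion\<close>
  have pure1: "k \<in> F" if k: "k \<in> K" "of_nat p *s k \<in> F" for k
  proof -
    obtain x where x: "x \<in> FQ" "\<pi> x = of_nat p *s k" using F_pi k(2) by blast
    then obtain x' where x': "x' \<in> FQ" "x = of_nat p *q x'"
      using divide[of x] k(1) by (auto simp: pK_def)
    then have "of_nat p *s (\<pi> x' - k) = 0" using x by (simp add: pi_scale scale_right_diff_distrib)
    then have "k = \<pi> x'" using torsion_free by fastforce
    then show ?thesis using pi_F x' by simp
  qed
  have pure: "of_nat (p ^ i) *s k \<in> F \<Longrightarrow> k \<in> K \<Longrightarrow> k \<in> F" for k i
  proof (induction i)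
    case (Suc i)
    then have "of_nat p *s (of_nat (p ^ i) *s k) \<in> F" by simp
    then have "of_nat (p ^ i) *s k \<in> F" by (rule pure1[OF K_scale[OF Suc.prems(2)]])
    then show ?case using Suc by blast
  qed simp
  \<comment> \<open>\<open>K/F\<close> is \<open>p\<close>-divisible\<close>
  have gen: "\<exists>k'\<in>K. k - of_nat (p ^ i) *s k' \<in> F" if "k \<in> K" for k i
    using that
  proof (induction i arbitrary: k)
    case 0
    then show ?case by (intro bexI[of _ k]) (auto simp: F_def span_zero)
  next
    case (Suc i)
    then obtain k' where k': "k' \<in> K" "k - of_nat (p ^ i) *s k' \<in> F" by blast
    obtain u where u: "u \<in> F" "k' - u \<in> pK"
      using layered_basis_spans_K[OF S(1) sp k'(1)] by (auto simp: F_def B_def)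
    then obtain k'' where k'': "k'' \<in> K" "k' - u = of_nat p *s k''" by (auto simp: pK_def)
    have "k - of_nat (p ^ Suc i) *s k'' = (k - of_nat (p ^ i) *s k') + of_nat (p ^ i) *s (k' - of_nat p *s k'')"
      by (simp add: scale_right_diff_distrib mult.commute)
    also have "k' - of_nat p *s k'' = u" using k''(2) by (simp add: algebra_simps)
    also have "(k - of_nat (p ^ i) *s k') + of_nat (p ^ i) *s u \<in> F"
      using k'(2) u(1) unfolding F_def by (intro span_add span_scale)
    finally show ?case using k''(1) by blast
  qed
  let ?N = "p ^ n"
  define R where "R k a \<longleftrightarrow> k \<in> K \<and> a \<in> Q \<and> of_nat ?N *s \<pi> a - k \<in> F" for k a
  have "\<exists>\<sigma>. (\<forall>k\<in>K. \<sigma> k \<in> Q \<and> R k (\<sigma> k)) \<and> (\<forall>k\<in>K. \<forall>k'\<in>K. \<sigma> (k + k') = \<sigma> k + \<sigma> k')"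
  proof (rule projective)
    fix k assume k: "k \<in> K"
    then obtain k' where k': "k' \<in> K" "k - of_nat ?N *s k' \<in> F" using gen by blast
    then have "- (k - of_nat ?N *s k') \<in> F" unfolding F_def by (intro span_neg)
    then show "\<exists>a\<in>Q. R k a"
      using k k'(1) by (intro bexI[of _ "e k'"]) (auto simp: R_def e_Q pi_e)
  next
    fix k k' a a' assume R: "R k a" "R k' a'"
    have "of_nat ?N *s \<pi> (a - a') - (k - k') = (of_nat ?N *s \<pi> a - k) - (of_nat ?N *s \<pi> a' - k')"
      by (simp add: pi.diff scale_right_diff_distrib)
    also have "\<dots> \<in> F" unfolding F_def by (rule span_diff) (use R in \<open>auto simp: R_def F_def\<close>)
    finally show "R (k - k') (a - a')"
      using R Q.subspace_diff[OF subspace_Q] by (auto simp: R_def K_diff)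
  qed
  then obtain \<sigma> where \<sigma>: "\<And>k. k \<in> K \<Longrightarrow> R k (\<sigma> k)"
    and \<sigma>_add: "\<And>k k'. k \<in> K \<Longrightarrow> k' \<in> K \<Longrightarrow> \<sigma> (k + k') = \<sigma> k + \<sigma> k'" by blast
  have \<sigma>_Q: "k \<in> K \<Longrightarrow> \<sigma> k \<in> Q" for k using \<sigma> by (simp add: R_def)
  have NK: "\<gamma> ^ ?N *s k = k" if "k \<in> K" for k using period[OF that] by (simp add: scale_left_diff_distrib)
  have NQ: "\<gamma> ^ ?N *q x = x" if "x \<in> Q" for x using period_Q[OF that] by (simp add: Q.scale_left_diff_distrib)
  define \<theta> where "\<theta> k = (\<Sum>i<?N. \<gamma> ^ i *q \<sigma> (\<gamma> ^ (?N - i) *s k))" for k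
  have \<theta>_Q: "\<theta> k \<in> Q" if "k \<in> K" for k
    unfolding \<theta>_def using that
    by (intro Q.subspace_sum[OF subspace_Q] Q.subspace_scale[OF subspace_Q] \<sigma>_Q K_scale)
  have \<theta>_add: "\<theta> (k + k') = \<theta> k + \<theta> k'" if "k \<in> K" "k' \<in> K" for k k'
    unfolding \<theta>_def by (simp add: scale_right_distrib \<sigma>_add K_scale that Q.scale_right_distrib sum.distrib)
  have \<theta>_gamma: "\<theta> (\<gamma> *s k) = \<gamma> *q \<theta> k" if k: "k \<in> K" for k
  proof -
    define a where "a i = \<gamma> ^ i *q \<sigma> (\<gamma> ^ (Suc ?N - i) *s k)" for i
    have "\<theta> (\<gamma> *s k) = (\<Sum>i<?N. a i)"
      unfolding \<theta>_def a_def by (intro sum.cong refl) (simp add: Suc_diff_le mult.commute)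
    also have "\<dots> = (\<Sum>i<Suc ?N. a i) - a ?N" by simp
    also have "\<dots> = (\<Sum>i<?N. a (Suc i)) + (a 0 - a ?N)"
      by (subst sum.lessThan_Suc_shift) (simp add: algebra_simps)
    also have "a 0 = a ?N"
      using NK[OF K_scale[OF k, of \<gamma>]] NQ[OF \<sigma>_Q[OF K_scale[OF k, of \<gamma>]]]
      by (simp add: a_def mult.commute)
    also have "(\<Sum>i<?N. a (Suc i)) + (a ?N - a ?N) = \<gamma> *q \<theta> k"
      unfolding \<theta>_def a_def by (simp add: Q.scale_sum_right)
    finally show ?thesis .
  qed
  have \<theta>_F: "k - \<pi> (\<theta> k) \<in> F" if k: "k \<in> K" for k
  proof -
    have "of_nat ?N *s (\<pi> (\<theta> k) - k) = (\<Sum>i<?N. \<gamma> ^ i *s (of_nat ?N *s \<pi> (\<sigma> (\<gamma> ^ (?N - i) *s k)) - \<gamma> ^ (?N - i) *s k))"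
    proof -
      have "(\<Sum>i<?N. \<gamma> ^ i *s \<gamma> ^ (?N - i) *s k) = (\<Sum>i<?N. k)"
        using NK[OF k] by (intro sum.cong refl) (simp flip: power_add)
      then show ?thesis
        by (simp only: scale_right_diff_distrib sum_subtractf sum_constant_scale card_lessThan)
           (simp add: \<theta>_def pi.sum pi_scale scale_sum_right mult.commute)
    qed
    also have "\<dots> \<in> F"
      using \<sigma>[OF K_scale[OF k]] unfolding R_def F_def by (intro span_sum span_scale) blast
    finally have "\<pi> (\<theta> k) - k \<in> F"
      by (rule pure) (intro K_diff pi_Q \<theta>_Q k)
    then have "- (\<pi> (\<theta> k) - k) \<in> F" unfolding F_def by (rule span_neg)
    then show ?thesis by simp
  qed
  have "\<exists>\<rho>. \<forall>u\<in>F. \<rho> u \<in> FQ \<and> \<pi> (\<rho> u) = u" using F_pi by (intro bchoice) blast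
  then obtain \<rho> where \<rho>: "\<And>u. u \<in> F \<Longrightarrow> \<rho> u \<in> FQ" "\<And>u. u \<in> F \<Longrightarrow> \<pi> (\<rho> u) = u" by blast
  have F_add: "u + u' \<in> F" if "u \<in> F" "u' \<in> F" for u u' using that by (simp add: F_def span_add)
  have F_scale: "f *s u \<in> F" if "u \<in> F" for f u using that by (simp add: F_def span_scale)
  have \<rho>_add: "\<rho> (u + u') = \<rho> u + \<rho> u'" if "u \<in> F" "u' \<in> F" for u u'
    using that \<rho> F_add by (intro inj') (auto simp: pi_add FQ_def Q.span_add)
  have \<rho>_gamma: "\<rho> (\<gamma> *s u) = \<gamma> *q \<rho> u" if "u \<in> F" for u
    using that \<rho> F_scale by (intro inj') (auto simp: pi_scale FQ_def Q.span_scale)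
  define s where "s k = \<theta> k + \<rho> (k - \<pi> (\<theta> k))" for k
  show ?thesis
  proof (intro exI[of _ s] conjI ballI)
    fix k assume k: "k \<in> K"
    show "s k \<in> Q"
      unfolding s_def using \<theta>_Q[OF k] \<rho>(1)[OF \<theta>_F[OF k]] FQ_Q Q.subspace_add[OF subspace_Q] by blast
    show "\<pi> (s k) = k" unfolding s_def by (simp add: pi_add \<rho>(2)[OF \<theta>_F[OF k]])
    show "s (\<gamma> *s k) = \<gamma> *q s k"
    proof -
      have "\<gamma> *s k - \<pi> (\<theta> (\<gamma> *s k)) = \<gamma> *s (k - \<pi> (\<theta> k))"
        by (simp add: \<theta>_gamma[OF k] pi_scale scale_right_diff_distrib)
      then show ?thesis
        unfolding s_def by (simp add: \<theta>_gamma[OF k] \<rho>_gamma[OF \<theta>_F[OF k]] Q.scale_right_distrib)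
    qed
    fix k' assume k': "k' \<in> K"
    have eq: "k + k' - \<pi> (\<theta> (k + k')) = (k - \<pi> (\<theta> k)) + (k' - \<pi> (\<theta> k'))"
      by (simp add: \<theta>_add k k' pi_add)
    have "s (k + k') = \<theta> (k + k') + \<rho> ((k - \<pi> (\<theta> k)) + (k' - \<pi> (\<theta> k')))"
      by (simp only: s_def eq)
    also have "\<dots> = (\<theta> k + \<theta> k') + (\<rho> (k - \<pi> (\<theta> k)) + \<rho> (k' - \<pi> (\<theta> k')))"
      by (simp only: \<rho>_add[OF \<theta>_F[OF k] \<theta>_F[OF k']] \<theta>_add[OF k k'])
    also have "\<dots> = s k + s k'" unfolding s_def by (simp only: ac_simps)
    finally show "s (k + k') = s k + s k'" .
  qed
qed

end

section \<open>Free abelian groups\<close>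

abbreviation keys where "keys \<equiv> Poly_Mapping.keys"
abbreviation lookup where "lookup \<equiv> Poly_Mapping.lookup"

text \<open>
  The elements of \<open>\<int>[\<Omega>]\<close> inside the type of all formal sums.
\<close>

definition frags :: "'a set \<Rightarrow> ('a \<Rightarrow>\<^sub>0 int) set" where
  "frags \<Omega> = {x. keys x \<subseteq> \<Omega>}"

lemma frags_0 [simp]: "0 \<in> frags \<Omega>" by (simp add: frags_def)

lemma frags_diff: "x \<in> frags \<Omega> \<Longrightarrow> y \<in> frags \<Omega> \<Longrightarrow> x - y \<in> frags \<Omega>"
  using keys_diff[of x y] by (auto simp: frags_def)

lemma frags_add: "x \<in> frags \<Omega> \<Longrightarrow> y \<in> frags \<Omega> \<Longrightarrow> x + y \<in> frags \<Omega>"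
  using Poly_Mapping.keys_add[of x y] by (auto simp: frags_def)

lemma frags_cmul: "x \<in> frags \<Omega> \<Longrightarrow> frag_cmul k x \<in> frags \<Omega>"
  using keys_cmul[of k x] by (auto simp: frags_def)

lemma frags_of [simp]: "frag_of a \<in> frags \<Omega> \<longleftrightarrow> a \<in> \<Omega>"
  by (simp add: frags_def)

lemma frags_sum: "(\<And>i. i \<in> I \<Longrightarrow> f i \<in> frags \<Omega>) \<Longrightarrow> sum f I \<in> frags \<Omega>"
  by (induction I rule: infinite_finite_induct) (auto simp: frags_add)

lemma frags_induct [consumes 1, case_names zero one diff]:
  assumes "x \<in> frags \<Omega>" "P 0" "\<And>a. a \<in> \<Omega> \<Longrightarrow> P (frag_of a)"
    "\<And>x y. x \<in> frags \<Omega> \<Longrightarrow> y \<in> frags \<Omega> \<Longrightarrow> P x \<Longrightarrow> P y \<Longrightarrow> P (x - y)"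
  shows "P x"
  using assms free_Abelian_group_induct[of x \<Omega> P] by (auto simp: frags_def)

lemma frags_extend: "x \<in> frags \<Omega> \<Longrightarrow> (\<And>a. a \<in> \<Omega> \<Longrightarrow> f a \<in> frags \<Omega>') \<Longrightarrow> frag_extend f x \<in> frags \<Omega>'"
  unfolding frag_extend_def by (intro frags_sum frags_cmul) (auto simp: frags_def)

definition push :: "('a \<Rightarrow> 'b) \<Rightarrow> ('a \<Rightarrow>\<^sub>0 int) \<Rightarrow> ('b \<Rightarrow>\<^sub>0 int)" where
  "push f = frag_extend (frag_of \<circ> f)"

lemma push_simps [simp]: "push f 0 = 0" "push f (frag_of a) = frag_of (f a)"
  by (simp_all add: push_def)

lemma push_add: "push f (x + y) = push f x + push f y"
  and push_diff: "push f (x - y) = push f x - push f y"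
  and push_cmul: "push f (frag_cmul k x) = frag_cmul k (push f x)"
  by (simp_all add: push_def frag_extend_add frag_extend_diff frag_extend_cmul)

lemma push_sum: "push f (\<Sum>i\<in>I. g i) = (\<Sum>i\<in>I. push f (g i))"
  by (induction I rule: infinite_finite_induct) (auto simp: push_add)

lemma push_push: "push f (push g x) = push (f \<circ> g) x"
  unfolding push_def by (subst frag_extend_compose) (simp add: comp_assoc)

lemma push_cong: "x \<in> frags \<Omega> \<Longrightarrow> (\<And>a. a \<in> \<Omega> \<Longrightarrow> f a = g a) \<Longrightarrow> push f x = push g x"
  unfolding push_def by (intro frag_extend_eq) (auto simp: frags_def)

lemma push_id: "x \<in> frags \<Omega> \<Longrightarrow> (\<And>a. a \<in> \<Omega> \<Longrightarrow> f a = a) \<Longrightarrow> push f x = x"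
  using push_cong[of x \<Omega> f id] frag_expansion[of x] by (simp add: push_def)

lemma push_frags: "x \<in> frags \<Omega> \<Longrightarrow> (\<And>a. a \<in> \<Omega> \<Longrightarrow> f a \<in> \<Omega>') \<Longrightarrow> push f x \<in> frags \<Omega>'"
  unfolding push_def by (erule frags_extend) auto

lemma push_funpow: "(push (f :: 'a \<Rightarrow> 'a) ^^ k) x = push (f ^^ k) x"
  by (induction k) (simp_all add: push_push push_id[of _ UNIV] frags_def comp_def)

lemma lookup_push_inj:
  assumes "inj_on f \<Omega>" "x \<in> frags \<Omega>" "a \<in> \<Omega>"
  shows "lookup (push f x) (f a) = lookup x a"
  using assms(2)
proof (induction rule: frags_induct)
  case (one b)
  then show ?case using assms by (auto simp: inj_on_eq_iff)
qed (auto simp: push_diff lookup_minus)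

lemma lookup_frag_extend:
  "lookup (frag_extend b x) a = (\<Sum>i\<in>keys x. lookup x i * lookup (b i) a)"
  unfolding frag_extend_def by (simp add: Poly_Mapping.lookup_sum)

lemma frag_cmul_diff_distrib2: "frag_cmul k (x - y) = frag_cmul k x - frag_cmul k y"
  using frag_cmul_distrib2[of k "x - y" y] by simp

lemma frag_cmul_sum_left: "frag_cmul (\<Sum>i\<in>I. f i) x = (\<Sum>i\<in>I. frag_cmul (f i) x)"
  by (induction I rule: infinite_finite_induct) (auto simp: frag_cmul_distrib)

lemma int_subgroup_principal:
  fixes I :: "int set"
  assumes "0 \<in> I" and diff: "\<And>a b. a \<in> I \<Longrightarrow> b \<in> I \<Longrightarrow> a - b \<in> I"
  shows "\<exists>d\<in>I. \<forall>a\<in>I. d dvd a"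
proof -
  have minus: "- a \<in> I" if "a \<in> I" for a using diff[OF assms(1) that] by simp
  have add: "a + b \<in> I" if "a \<in> I" "b \<in> I" for a b using diff[OF that(1) minus[OF that(2)]] by simp
  have mult: "q * a \<in> I" if "a \<in> I" for q a
    by (induction q rule: int_induct[where k = 0]) (simp_all add: assms(1) algebra_simps add diff that)
  show ?thesis
  proof (cases "\<exists>n::nat. n > 0 \<and> int n \<in> I")
    case True
    define d where "d = (LEAST n::nat. n > 0 \<and> int n \<in> I)"
    have d: "d > 0" "int d \<in> I" using LeastI_ex[OF True] by (simp_all add: d_def)
    have "int d dvd a" if a: "a \<in> I" for a
    proof (rule ccontr)
      assume "\<not> int d dvd a"
      then have "a mod int d \<noteq> 0" by (simp add: dvd_eq_mod_eq_0)
      moreover have "0 \<le> a mod int d" "a mod int d < int d" using d(1) by auto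
      moreover have "a mod int d \<in> I"
        using diff[OF a mult[OF d(2), of "a div int d"]] by (simp add: minus_div_mult_eq_mod)
      ultimately have "nat (a mod int d) > 0 \<and> int (nat (a mod int d)) \<in> I" "nat (a mod int d) < d"
        by auto
      then show False unfolding d_def using not_less_Least by blast
    qed
    then show ?thesis using d(2) by blast
  next
    case False
    have "a = 0" if "a \<in> I" for a
    proof (rule ccontr)
      assume "a \<noteq> 0"
      then have "nat \<bar>a\<bar> > 0 \<and> int (nat \<bar>a\<bar>) \<in> I" using that minus[OF that] by (cases "a > 0") auto
      then show False using False by blast
    qed
    then show ?thesis using assms(1) by auto
  qed
qed

lemma additive_frag_cmul:
  fixes h :: "('a \<Rightarrow>\<^sub>0 int) \<Rightarrow> ('b \<Rightarrow>\<^sub>0 int)"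
  assumes h: "\<And>x y. x \<in> frags B \<Longrightarrow> y \<in> frags B \<Longrightarrow> h (x + y) = h x + h y" and x: "x \<in> frags B"
  shows "h (frag_cmul k x) = frag_cmul k (h x)"
proof -
  have h0: "h 0 = 0" using h[of 0 0] by simp
  have pos: "h (frag_cmul (int n) x) = frag_cmul (int n) (h x)" for n
    by (induction n) (simp_all add: h0 frag_cmul_distrib h x frags_cmul)
  show ?thesis
  proof (cases k)
    case (neg n)
    have "h (frag_cmul k x + frag_cmul (int (Suc n)) x) = 0"
      unfolding neg frag_cmul_distrib[symmetric] by (simp add: h0)
    then have "h (frag_cmul k x) = - frag_cmul (int (Suc n)) (h x)"
      unfolding h[OF frags_cmul[OF x] frags_cmul[OF x]] pos by (rule eq_neg_iff_add_eq_0[THEN iffD2])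
    then show ?thesis by (simp only: minus_frag_cmul neg)
  qed (use pos in simp)
qed

text \<open>
  A subgroup \<open>K\<close> of a free abelian group is free, hence projective.  Well-order the basis.  For every
  position \<open>x\<close> let \<open>e x\<close> be an element of \<open>K\<close>, supported up to \<open>x\<close>, whose coefficient at \<open>x\<close>
  generates the ideal of all coefficients at \<open>x\<close> of such elements.  Those \<open>e x\<close> for which this
  coefficient is not zero form a basis of \<open>K\<close>: leading terms do not cancel, and dividing by them
  reduces any element of \<open>K\<close> to zero.  It remains to choose the images \<open>a x\<close> of the \<open>e x\<close>.
\<close>

lemma frag_subgroup_projective:
  fixes K :: "('x \<Rightarrow>\<^sub>0 int) set" and R :: "('x \<Rightarrow>\<^sub>0 int) \<Rightarrow> ('y \<Rightarrow>\<^sub>0 int) \<Rightarrow> bool"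
  assumes K0: "0 \<in> K" and Kdiff: "\<And>k k'. k \<in> K \<Longrightarrow> k' \<in> K \<Longrightarrow> k - k' \<in> K"
    and ex: "\<And>k. k \<in> K \<Longrightarrow> \<exists>a. R k a"
    and Rdiff: "\<And>k k' a a'. R k a \<Longrightarrow> R k' a' \<Longrightarrow> R (k - k') (a - a')"
  shows "\<exists>\<sigma>. (\<forall>k\<in>K. R k (\<sigma> k)) \<and> (\<forall>k\<in>K. \<forall>k'\<in>K. \<sigma> (k + k') = \<sigma> k + \<sigma> k')"
proof -
  obtain r :: "'x rel" where r: "Well_order r" "Field r = UNIV"
    using well_ordering by (elim exE conjE)
  then have ord: "refl_on UNIV r" "trans r" "antisym r" "total_on UNIV r" and wf: "wf (r - Id)"
    by (simp_all only: order_on_defs)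
  have refl: "(x, x) \<in> r" for x using ord(1) by (simp add: refl_on_def)
  have total: "(x, y) \<in> r \<or> (y, x) \<in> r" for x y
    using ord(4) refl by (cases "x = y") (auto simp: total_on_def)
  have trans: "(x, y) \<in> r \<Longrightarrow> (y, z) \<in> r \<Longrightarrow> (x, z) \<in> r" for x y z by (rule transD[OF ord(2)])
  have antisym: "(x, y) \<in> r \<Longrightarrow> (y, x) \<in> r \<Longrightarrow> x = y" for x y by (rule antisymD[OF ord(3)])
  have top: "\<exists>x\<in>keys k. \<forall>y\<in>keys k. (y, x) \<in> r" if k: "k \<noteq> 0" for k :: "'x \<Rightarrow>\<^sub>0 int"
  proof -
    have "\<exists>x\<in>A. \<forall>y\<in>A. (y, x) \<in> r" if "finite A" "A \<noteq> {}" for A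
      using that
    proof (induction rule: finite_ne_induct)
      case (insert a A)
      then obtain x where "x \<in> A" "\<forall>y\<in>A. (y, x) \<in> r" by blast
      then show ?case using total[of a x] refl[of a] trans[of _ x a] by blast
    qed (use refl in blast)
    then show ?thesis using k by simp
  qed
  define L where "L x = {k \<in> K. \<forall>y\<in>keys k. (y, x) \<in> r}" for x
  have L_diff: "k - k' \<in> L x" if "k \<in> L x" "k' \<in> L x" for k k' x
    using that Kdiff keys_diff[of k k'] by (auto simp: L_def)
  have L_0: "0 \<in> L x" for x using K0 by (simp add: L_def)
  have "\<exists>e\<in>L x. \<forall>k\<in>L x. lookup e x dvd lookup k x" for x
  proof -
    have "\<exists>d\<in>(\<lambda>k. lookup k x) ` L x. \<forall>a\<in>(\<lambda>k. lookup k x) ` L x. d dvd a"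
    proof (rule int_subgroup_principal)
      show "0 \<in> (\<lambda>k. lookup k x) ` L x" by (rule image_eqI[OF _ L_0]) simp
    next
      fix a b assume "a \<in> (\<lambda>k. lookup k x) ` L x" "b \<in> (\<lambda>k. lookup k x) ` L x"
      then obtain k k' where "k \<in> L x" "k' \<in> L x" "a = lookup k x" "b = lookup k' x" by blast
      then show "a - b \<in> (\<lambda>k. lookup k x) ` L x"
        by (intro image_eqI[OF _ L_diff[of k x k']]) (simp_all add: lookup_minus)
    qed
    then show ?thesis by blast
  qed
  then obtain e where e: "\<And>x. e x \<in> L x" "\<And>x k. k \<in> L x \<Longrightarrow> lookup (e x) x dvd lookup k x" by metis
  have eK: "e x \<in> K" for x using e(1)[of x] by (simp add: L_def)
  obtain a where a: "\<And>x. R (e x) (a x)" using ex[OF eK] by metis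
  define B where "B = {x. lookup (e x) x \<noteq> 0}"
  let ?e = "frag_extend e" and ?a = "frag_extend a"
  have inj: "c = 0" if c: "c \<in> frags B" "?e c = 0" for c
  proof (rule ccontr)
    assume "c \<noteq> 0"
    then obtain x where x: "x \<in> keys c" "\<forall>y\<in>keys c. (y, x) \<in> r" using top by blast
    have "lookup (e y) x = 0" if "y \<in> keys c" "y \<noteq> x" for y
    proof -
      have "(x, y) \<notin> r" using x(2) that antisym by blast
      then have "x \<notin> keys (e y)" using e(1)[of y] by (auto simp: L_def)
      then show ?thesis by (simp add: in_keys_iff)
    qed
    then have "lookup (?e c) x = (\<Sum>y\<in>keys c. if y = x then lookup c x * lookup (e x) x else 0)"
      unfolding lookup_frag_extend by (intro sum.cong) auto
    also have "\<dots> = lookup c x * lookup (e x) x" using x(1) by simp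
    finally show False using x(1) c by (auto simp: B_def frags_def in_keys_iff)
  qed
  have surj: "\<exists>c\<in>frags B. ?e c = k" if "k \<in> L x" for k x
    using that
  proof (induction x arbitrary: k rule: wf_induct_rule[OF wf])
    case (1 x)
    define q where "q = lookup k x div lookup (e x) x"
    define k' where "k' = k - frag_cmul q (e x)"
    have k': "k' \<in> L x"
      unfolding k'_def using 1(2) e(1)
      by (intro L_diff frag_closure_minus_cmul[of "\<lambda>k. k \<in> L x"]) (auto intro: L_0 L_diff)
    have k'x: "lookup k' x = 0"
      using e(2)[OF 1(2)] by (simp add: k'_def q_def lookup_minus)
    have "\<exists>c\<in>frags B. ?e c = k'"
    proof (cases "k' = 0")
      case True
      then show ?thesis by (intro bexI[of _ 0]) auto
    next
      case False
      then obtain y where y: "y \<in> keys k'" "\<forall>z\<in>keys k'. (z, y) \<in> r" using top by blast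
      then have "(y, x) \<in> r - Id" "k' \<in> L y" using k' k'x by (auto simp: L_def in_keys_iff)
      then show ?thesis using 1(1) by blast
    qed
    then obtain c where c: "c \<in> frags B" "?e c = k'" by blast
    have "frag_cmul q (frag_of x) \<in> frags B"
      by (cases "q = 0") (auto intro!: frags_cmul simp: B_def q_def)
    then have "c + frag_cmul q (frag_of x) \<in> frags B" using c(1) frags_add by blast
    moreover have "?e (c + frag_cmul q (frag_of x)) = k"
      by (simp add: frag_extend_add frag_extend_cmul c(2) k'_def)
    ultimately show ?case by blast
  qed
  have R_e: "R (?e c) (?a c)" for c
  proof -
    have R0: "R 0 0" using ex[OF K0] Rdiff by (metis diff_self)
    have "c \<in> frags UNIV" by (simp add: frags_def)
    then show ?thesis
      by (induction rule: frags_induct) (auto simp: frag_extend_diff R0 a Rdiff)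
  qed
  have "\<exists>c\<in>frags B. ?e c = k" if k: "k \<in> K" for k
  proof (cases "k = 0")
    case True
    then show ?thesis by (intro bexI[of _ 0]) auto
  next
    case False
    then obtain x where "\<forall>y\<in>keys k. (y, x) \<in> r" using top by blast
    then show ?thesis using k by (intro surj[of k x]) (simp add: L_def)
  qed
  then obtain c where c: "\<And>k. k \<in> K \<Longrightarrow> c k \<in> frags B" "\<And>k. k \<in> K \<Longrightarrow> ?e (c k) = k" by metis
  have c_add: "c (k + k') = c k + c k'" if k: "k \<in> K" "k' \<in> K" for k k'
  proof -
    have kk: "k + k' \<in> K" using Kdiff[OF k(1) Kdiff[OF K0 k(2)]] by simp
    have "c (k + k') - (c k + c k') = 0"
    proof (rule inj)
      show "c (k + k') - (c k + c k') \<in> frags B" by (intro frags_diff frags_add c kk k)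
      show "?e (c (k + k') - (c k + c k')) = 0"
        by (simp add: frag_extend_diff frag_extend_add c kk k)
    qed
    then show ?thesis by simp
  qed
  show ?thesis
  proof (intro exI[of _ "\<lambda>k. ?a (c k)"] conjI ballI)
    show "R k (?a (c k))" if "k \<in> K" for k using R_e[of "c k"] c(2)[OF that] by simp
    show "?a (c (k + k')) = ?a (c k) + ?a (c k')" if "k \<in> K" "k' \<in> K" for k k'
      using c_add[OF that] by (simp add: frag_extend_add)
  qed
qed

section \<open>Cyclic groups acting on free abelian groups\<close>

text \<open>
  The action of \<open>\<int>[\<gamma>]\<close> in which \<open>\<gamma>\<close> acts as the additive map \<open>c\<close>, by Horner's scheme.
\<close>

definition poly_act :: "(('a \<Rightarrow>\<^sub>0 int) \<Rightarrow> ('a \<Rightarrow>\<^sub>0 int)) \<Rightarrow> int poly \<Rightarrow> ('a \<Rightarrow>\<^sub>0 int) \<Rightarrow> ('a \<Rightarrow>\<^sub>0 int)" where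
  "poly_act c f x = fold_coeffs (\<lambda>a y. frag_cmul a x + c y) f 0"

lemma poly_act_0 [simp]: "poly_act c 0 x = 0"
  by (simp add: poly_act_def)

context
  fixes c :: "('a \<Rightarrow>\<^sub>0 int) \<Rightarrow> ('a \<Rightarrow>\<^sub>0 int)"
  assumes c_add: "c (x + y) = c x + c y"
begin

interpretation c: Modules.additive c
  by standard (rule c_add)

lemma poly_act_generator_cmul: "c (frag_cmul k x) = frag_cmul k (c x)"
  by (rule additive_frag_cmul[of UNIV]) (simp_all add: c_add frags_def)

lemma poly_act_pCons: "poly_act c (pCons a f) x = frag_cmul a x + c (poly_act c f x)"
  by (cases "f = 0 \<and> a = 0") (auto simp: poly_act_def fold_coeffs_pCons_not_0_0_eq c.zero)

lemma poly_act_add_left: "poly_act c (f + g) x = poly_act c f x + poly_act c g x"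
  by (induction f g rule: poly_induct2)
     (simp_all add: poly_act_pCons c_add frag_cmul_distrib algebra_simps c.zero)

lemma poly_act_add_right: "poly_act c f (x + y) = poly_act c f x + poly_act c f y"
  by (induction f) (simp_all add: poly_act_pCons c_add frag_cmul_distrib2 algebra_simps)

lemma poly_act_smult: "poly_act c (smult a f) x = frag_cmul a (poly_act c f x)"
  by (induction f) (simp_all add: poly_act_pCons frag_cmul_distrib2 poly_act_generator_cmul)

lemma poly_act_mult: "poly_act c f (poly_act c g x) = poly_act c (f * g) x"
  by (induction f)
     (simp_all add: poly_act_pCons poly_act_add_left poly_act_smult)

lemma module_poly_act: "Modules.module (poly_act c)"
  by standard (simp_all add: poly_act_add_left poly_act_add_right poly_act_mult poly_act_pCons one_pCons c.zero)

lemma poly_act_gamma: "poly_act c \<gamma> x = c x"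
  by (simp add: \<gamma>_def poly_act_pCons c.zero)

lemma poly_act_gamma_power: "poly_act c (\<gamma> ^ k) x = (c ^^ k) x"
proof (induction k)
  case 0
  then show ?case by (simp add: one_pCons poly_act_pCons c.zero)
next
  case (Suc k)
  then show ?case by (simp add: poly_act_mult[symmetric] poly_act_gamma)
qed

lemma poly_act_of_nat: "poly_act c (of_nat k) x = frag_cmul (int k) x"
  by (simp add: of_nat_poly poly_act_pCons c.zero)

lemma poly_act_diff_left: "poly_act c (f - g) x = poly_act c f x - poly_act c g x"
  using poly_act_add_left[of "f - g" g x] by (simp add: algebra_simps)

lemma poly_act_gamma_power_minus_1: "poly_act c (\<gamma> ^ k - 1) x = (c ^^ k) x - x"
  by (simp add: poly_act_diff_left poly_act_gamma_power one_pCons poly_act_pCons c.zero)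

lemma poly_act_geo: "poly_act c (geo q m) x = (\<Sum>j<m. (c ^^ (q * j)) x)"
  by (simp add: geo_def Modules.module.scale_sum_left[OF module_poly_act] poly_act_gamma_power)

lemma poly_act_closed:
  assumes "x \<in> K" "0 \<in> K" "\<And>x y. x \<in> K \<Longrightarrow> y \<in> K \<Longrightarrow> x - y \<in> K" "\<And>x. x \<in> K \<Longrightarrow> c x \<in> K"
  shows "poly_act c f x \<in> K"
proof (induction f)
  case (pCons a f)
  have "frag_cmul a x \<in> K" by (rule frag_closure_minus_cmul[of "\<lambda>x. x \<in> K"]) (use assms in auto)
  moreover have "0 - c (poly_act c f x) \<in> K" using pCons assms by blast
  ultimately have "frag_cmul a x - (0 - c (poly_act c f x)) \<in> K" using assms by blast
  then show ?case by (simp add: poly_act_pCons)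
qed (use assms in simp)

end

lemma poly_act_intertwine:
  assumes "\<And>x y. h (x + y) = h x + h y" "\<And>x. h (c x) = c' (h x)"
    and c: "\<And>x y. c (x + y) = c x + c y" and c': "\<And>x y. c' (x + y) = c' x + c' y"
  shows "h (poly_act c f x) = poly_act c' f (h x)"
proof -
  interpret h: Modules.additive h by standard (rule assms)
  have cm: "h (frag_cmul k x) = frag_cmul k (h x)" for k x
    by (rule additive_frag_cmul[of UNIV]) (simp_all add: assms(1) frags_def)
  show ?thesis
    by (induction f) (simp_all add: poly_act_pCons[OF c] poly_act_pCons[OF c'] assms(1,2) cm h.zero)
qed

text \<open>
  The vanishing of cohomology in degree -1 of a cyclic group with values in a permutation module.
  Modulo the elements \<open>c z - z\<close>, every formal sum can be moved to a set of orbit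
  representatives.  Moving does not change the norm, and the norm of a sum over representatives is
  zero only if the sum is.
\<close>

lemma frags_norm_zero:
  fixes c :: "'a \<Rightarrow> 'a"
  assumes N: "N > 0" and per: "\<And>a. a \<in> \<Omega> \<Longrightarrow> (c ^^ N) a = a" and cl: "\<And>a. a \<in> \<Omega> \<Longrightarrow> c a \<in> \<Omega>"
    and x: "x \<in> frags \<Omega>" "(\<Sum>j<N. (push c ^^ j) x) = 0"
  shows "\<exists>z\<in>frags \<Omega>. x = push c z - z"
proof -
  have clk: "(c ^^ k) a \<in> \<Omega>" if "a \<in> \<Omega>" for k a using that by (induction k) (auto intro: cl)
  define orb where "orb a = {(c ^^ k) a | k. True}" for a
  define r where "r a = (SOME b. b \<in> orb a)" for a
  have orb_c: "orb (c a) = orb a" if a: "a \<in> \<Omega>" for a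
  proof -
    have "(c ^^ k) (c a) \<in> orb a" for k
      unfolding orb_def by (auto intro!: exI[of _ "Suc k"] simp: funpow_swap1)
    moreover have "(c ^^ k) a \<in> orb (c a)" for k
    proof -
      have "(c ^^ (k + (N - 1))) (c a) = (c ^^ k) ((c ^^ N) a)"
        using N by (cases N) (simp_all add: funpow_add funpow_swap1)
      then have "(c ^^ k) a = (c ^^ (k + (N - 1))) (c a)" using per[OF a] by simp
      then show ?thesis unfolding orb_def by blast
    qed
    ultimately show ?thesis unfolding orb_def by blast
  qed
  have orb_k: "orb ((c ^^ k) a) = orb a" if "a \<in> \<Omega>" for a k
    by (induction k) (auto simp: orb_c clk that)
  have "r a \<in> orb a" for a
    unfolding r_def by (rule someI[of _ a]) (auto simp: orb_def intro: exI[of _ 0])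
  then obtain h where h: "\<And>a. r a = (c ^^ h a) a" unfolding orb_def by (simp) metis
  have r_k: "r ((c ^^ k) a) = r a" if "a \<in> \<Omega>" for a k
    using orb_k[OF that] by (simp add: r_def)
  define B where "B = {push c z - z | z. z \<in> frags \<Omega>}"
  have B_diff: "x - y \<in> B" if xy: "x \<in> B" "y \<in> B" for x y
  proof -
    obtain z z' where "x = push c z - z" "z \<in> frags \<Omega>" "y = push c z' - z'" "z' \<in> frags \<Omega>"
      using xy unfolding B_def by blast
    then have "x - y = push c (z - z') - (z - z')" "z - z' \<in> frags \<Omega>"
      by (auto simp: push_diff frags_diff)
    then show ?thesis unfolding B_def by blast
  qed
  have B_0: "0 \<in> B" unfolding B_def by (auto intro!: exI[of _ 0])
  have of_B: "frag_of ((c ^^ k) a) - frag_of a \<in> B" if a: "a \<in> \<Omega>" for a k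
  proof (induction k)
    case (Suc k)
    have "frag_of ((c ^^ Suc k) a) - frag_of ((c ^^ k) a) \<in> B"
      unfolding B_def by (auto intro!: exI[of _ "frag_of ((c ^^ k) a)"] clk a)
    moreover have "0 - (frag_of ((c ^^ k) a) - frag_of a) \<in> B" using B_diff[OF B_0 Suc] .
    ultimately have "(frag_of ((c ^^ Suc k) a) - frag_of ((c ^^ k) a)) - (0 - (frag_of ((c ^^ k) a) - frag_of a)) \<in> B"
      by (rule B_diff)
    then show ?case by simp
  qed (simp add: B_0)
  have red: "push r y - y \<in> B" if "y \<in> frags \<Omega>" for y
    using that
  proof (induction rule: frags_induct)
    case (diff x y)
    then have "(push r x - x) - (push r y - y) \<in> B" by (blast intro: B_diff)
    then show ?case by (simp add: push_diff algebra_simps)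
  qed (use B_0 of_B h in auto)
  \<comment> \<open>the sum \<open>x\<close> moved to the orbit representatives\<close>
  define y where "y = push r x"
  have nrmB: "(\<Sum>j<N. (push c ^^ j) b) = 0" if bB: "b \<in> B" for b
  proof -
    obtain z where z: "b = push c z - z" "z \<in> frags \<Omega>" using bB by (auto simp: B_def)
    have "(push c ^^ j) b = (push c ^^ Suc j) z - (push c ^^ j) z" for j
      unfolding z(1) by (simp only: push_funpow push_diff push_push) (simp add: comp_def funpow_swap1)
    then have "(\<Sum>j<N. (push c ^^ j) b) = (push c ^^ N) z - (push c ^^ 0) z"
      using sum_lessThan_telescope[of "\<lambda>j. (push c ^^ j) z" N] by simp
    also have "\<dots> = 0" using push_id[OF z(2), of "c ^^ N"] per by (simp add: push_funpow)
    finally show ?thesis .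
  qed
  have nrm_y: "(\<Sum>j<N. (push c ^^ j) y) = 0"
  proof -
    have "(\<Sum>j<N. (push c ^^ j) y) = (\<Sum>j<N. (push c ^^ j) (y - x)) + (\<Sum>j<N. (push c ^^ j) x)"
      unfolding sum.distrib[symmetric] by (simp add: push_funpow push_diff)
    also have "\<dots> = 0" using nrmB[OF red[OF x(1)]] x(2) by (simp add: y_def)
    finally show ?thesis .
  qed
  have ky: "r a = a \<and> a \<in> \<Omega>" if "a \<in> keys y" for a
  proof -
    have "a \<in> r ` keys x"
      using that keys_frag_extend[of "frag_of \<circ> r" x] unfolding y_def push_def by auto
    then obtain b where b: "b \<in> \<Omega>" "a = r b" using x(1) by (auto simp: frags_def)
    then show ?thesis using r_k[OF b(1), of "h b"] h clk by metis
  qed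
  have "y = 0"
  proof (rule ccontr)
    assume "y \<noteq> 0"
    then obtain a where a: "a \<in> keys y" by (metis all_not_in_conv keys_eq_empty)
    have coord: "lookup ((push c ^^ j) y) a = (if (c ^^ j) a = a then lookup y a else 0)" for j
    proof -
      have "lookup ((push c ^^ j) y) a = (\<Sum>i\<in>keys y. lookup y i * (if a = (c ^^ j) i then 1 else 0))"
        unfolding push_funpow by (simp add: push_def lookup_frag_extend)
      also have "\<dots> = (\<Sum>i\<in>keys y. if i = a then (if (c ^^ j) a = a then lookup y a else 0) else 0)"
      proof (intro sum.cong refl)
        fix i assume i: "i \<in> keys y"
        have "i = a" if "a = (c ^^ j) i"
          using ky[OF i] ky[OF a] r_k[of i j] that by simp
        then show "lookup y i * (if a = (c ^^ j) i then 1 else 0) = (if i = a then (if (c ^^ j) a = a then lookup y a else 0) else 0)"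
          by auto
      qed
      also have "\<dots> = (if (c ^^ j) a = a then lookup y a else 0)" using a by simp
      finally show ?thesis .
    qed
    have "0 = (\<Sum>j<N. lookup ((push c ^^ j) y) a)"
      using arg_cong[OF nrm_y, of "\<lambda>y. lookup y a"] by (simp add: Poly_Mapping.lookup_sum)
    also have "\<dots> = (\<Sum>j<N. if (c ^^ j) a = a then lookup y a else 0)" by (simp only: coord)
    also have "\<dots> = int (card {j\<in>{..<N}. (c ^^ j) a = a}) * lookup y a"
      by (simp add: sum.If_cases Int_def)
    finally have c0: "card {j\<in>{..<N}. (c ^^ j) a = a} = 0" using a by (simp add: in_keys_iff)
    have "finite {j\<in>{..<N}. (c ^^ j) a = a}" by simp
    from iffD1[OF card_0_eq[OF this] c0] have "{j\<in>{..<N}. (c ^^ j) a = a} = {}" .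
    moreover have "0 \<in> {j\<in>{..<N}. (c ^^ j) a = a}" using N by simp
    ultimately show False by (simp only: empty_iff)
  qed
  then have "0 - x \<in> B" using red[OF x(1)] by (simp add: y_def)
  then have "x \<in> B" using B_diff[OF B_0, of "0 - x"] by simp
  then show ?thesis by (auto simp: B_def)
qed

section \<open>Splitting the counit\<close>

lemma (in group) cyclic_subgroup_iff_powers:
  assumes "finite (carrier G)" "subgroup P G"
  shows "cyclic_group (G\<lparr>carrier := P\<rparr>) \<longleftrightarrow> (\<exists>x\<in>P. P = range (\<lambda>k::nat. x [^] k))"
proof -
  have PG: "P \<subseteq> carrier G" using assms(2) by (rule subgroup.subset)
  have gen: "generate (G\<lparr>carrier := P\<rparr>) (P \<inter> {x}) = range (\<lambda>k::nat. x [^] k)" if "x \<in> P" for x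
  proof -
    have "generate (G\<lparr>carrier := P\<rparr>) {x} = generate G {x}"
      using generate_consistent[of "{x}" P] assms(2) that by simp
    also have "\<dots> = range (\<lambda>k::nat. x [^] k)"
      using generate_pow_on_finite_carrier[OF assms(1), of x] that PG by auto
    finally show ?thesis using that by (simp add: Int_absorb1)
  qed
  have "subgroup_generated (G\<lparr>carrier := P\<rparr>) {x} = G\<lparr>carrier := P\<rparr> \<longleftrightarrow> P = range (\<lambda>k::nat. x [^] k)"
    if "x \<in> P" for x
  proof -
    have e: "subgroup_generated (G\<lparr>carrier := P\<rparr>) {x} = G\<lparr>carrier := range (\<lambda>k::nat. x [^] k)\<rparr>"
      using gen[OF that] by (simp add: subgroup_generated_def)
    show ?thesis unfolding e
    proof
      assume "G\<lparr>carrier := range (\<lambda>k::nat. x [^] k)\<rparr> = G\<lparr>carrier := P\<rparr>"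
      from arg_cong[OF this, of carrier] show "P = range (\<lambda>k::nat. x [^] k)" by simp
    qed simp
  qed
  then show ?thesis by (auto simp: cyclic_group_def)
qed

text \<open>
  A \<open>\<Gamma>\<close>-module given by the action \<open>am\<close> of the group elements, without the group ring.
\<close>

locale G_module = group G + M: abelian_group M
  for G :: "('g, 'x) monoid_scheme" (structure) and M :: "('m, 'y) ring_scheme" +
  fixes am :: "'g \<Rightarrow> 'm \<Rightarrow> 'm"
  assumes finite_G: "finite (carrier G)"
    and am_closed: "\<lbrakk>g \<in> carrier G; m \<in> carrier M\<rbrakk> \<Longrightarrow> am g m \<in> carrier M"
    and am_one: "m \<in> carrier M \<Longrightarrow> am \<one> m = m"
    and am_mult: "\<lbrakk>g \<in> carrier G; h \<in> carrier G; m \<in> carrier M\<rbrakk> \<Longrightarrow> am (g \<otimes> h) m = am g (am h m)"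
    and am_add: "\<lbrakk>g \<in> carrier G; m \<in> carrier M; m' \<in> carrier M\<rbrakk> \<Longrightarrow>
      am g (m \<oplus>\<^bsub>M\<^esub> m') = am g m \<oplus>\<^bsub>M\<^esub> am g m'"
begin

definition counit :: "('m \<Rightarrow>\<^sub>0 int) \<Rightarrow> 'm" where
  "counit = (SOME h. h \<in> hom (free_Abelian_group (carrier M)) (add_monoid M) \<and>
    (\<forall>m\<in>carrier M. h (frag_of m) = m))"

lemma counit: "counit \<in> hom (free_Abelian_group (carrier M)) (add_monoid M)"
  "m \<in> carrier M \<Longrightarrow> counit (frag_of m) = m"
proof -
  have "\<exists>h. h \<in> hom (free_Abelian_group (carrier M)) (add_monoid M) \<and> (\<forall>m\<in>carrier M. h (frag_of m) = m)"
    by (rule comm_group.free_Abelian_group_universal[OF M.a_comm_group, of id "carrier M"]) auto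
  from someI_ex[OF this] show "counit \<in> hom (free_Abelian_group (carrier M)) (add_monoid M)"
    "m \<in> carrier M \<Longrightarrow> counit (frag_of m) = m"
    unfolding counit_def by blast+
qed

abbreviation \<Omega> where "\<Omega> \<equiv> frags (carrier M)"

lemma counit_closed: "x \<in> \<Omega> \<Longrightarrow> counit x \<in> carrier M"
  using counit(1) by (auto simp: hom_def frags_def)

lemma counit_add: "x \<in> \<Omega> \<Longrightarrow> y \<in> \<Omega> \<Longrightarrow> counit (x + y) = counit x \<oplus>\<^bsub>M\<^esub> counit y"
  using counit(1) by (auto simp: hom_def frags_def)

lemma counit_0: "counit 0 = \<zero>\<^bsub>M\<^esub>"
  using counit_add[of 0 0] counit_closed[of 0] by (simp add: M.add.r_cancel_one')

lemma counit_diff: "x \<in> \<Omega> \<Longrightarrow> y \<in> \<Omega> \<Longrightarrow> counit (x - y) = counit x \<ominus>\<^bsub>M\<^esub> counit y"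
  using counit_add[of "x - y" y] counit_closed[of "x - y"] counit_closed[of y] counit_closed[of x]
  by (simp add: frags_diff M.minus_eq M.a_assoc M.r_neg)

lemma am_zero: "g \<in> carrier G \<Longrightarrow> am g \<zero>\<^bsub>M\<^esub> = \<zero>\<^bsub>M\<^esub>"
  using am_add[of g "\<zero>\<^bsub>M\<^esub>" "\<zero>\<^bsub>M\<^esub>"] am_closed[of g "\<zero>\<^bsub>M\<^esub>"] by (simp add: M.add.r_cancel_one')

lemma am_diff:
  assumes g: "g \<in> carrier G" and m: "m \<in> carrier M" "m' \<in> carrier M"
  shows "am g (m \<ominus>\<^bsub>M\<^esub> m') = am g m \<ominus>\<^bsub>M\<^esub> am g m'"
proof -
  have "am g ((m \<ominus>\<^bsub>M\<^esub> m') \<oplus>\<^bsub>M\<^esub> m') = am g (m \<ominus>\<^bsub>M\<^esub> m') \<oplus>\<^bsub>M\<^esub> am g m'"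
    using assms by (intro am_add) auto
  moreover have "(m \<ominus>\<^bsub>M\<^esub> m') \<oplus>\<^bsub>M\<^esub> m' = m" using m by (simp add: M.minus_eq M.a_assoc M.l_neg)
  ultimately show ?thesis
    using assms am_closed M.minus_closed by (simp add: M.minus_eq M.a_assoc M.r_neg)
qed

lemma push_am: "g \<in> carrier G \<Longrightarrow> x \<in> \<Omega> \<Longrightarrow> push (am g) x \<in> \<Omega>"
  by (erule push_frags) (rule am_closed)

lemma counit_push:
  assumes g: "g \<in> carrier G" and x: "x \<in> \<Omega>"
  shows "counit (push (am g) x) = am g (counit x)"
  using x
proof (induction rule: frags_induct)
  case (diff x y)
  then show ?case using g
    by (simp add: push_diff counit_diff push_am am_diff counit_closed)
qed (use g in \<open>simp_all add: counit_0 am_zero counit(2) am_closed\<close>)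

definition K :: "('m \<Rightarrow>\<^sub>0 int) set" where "K = {x \<in> \<Omega>. counit x = \<zero>\<^bsub>M\<^esub>}"

lemma K_\<Omega>: "x \<in> K \<Longrightarrow> x \<in> \<Omega>" by (simp add: K_def)

lemma K_0: "0 \<in> K" by (simp add: K_def counit_0)

lemma K_diff: "x \<in> K \<Longrightarrow> y \<in> K \<Longrightarrow> x - y \<in> K"
  by (simp add: K_def frags_diff counit_diff M.minus_eq)

lemma K_add: "x \<in> K \<Longrightarrow> y \<in> K \<Longrightarrow> x + y \<in> K"
  by (simp add: K_def frags_add counit_add)

lemma K_push: "g \<in> carrier G \<Longrightarrow> x \<in> K \<Longrightarrow> push (am g) x \<in> K"
  by (simp add: K_def push_am counit_push am_zero)

lemma push_am_mult: "g \<in> carrier G \<Longrightarrow> h \<in> carrier G \<Longrightarrow> x \<in> \<Omega> \<Longrightarrow>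
    push (am g) (push (am h) x) = push (am (g \<otimes> h)) x"
  unfolding push_push by (erule push_cong) (simp add: am_mult)

lemma push_am_one: "x \<in> \<Omega> \<Longrightarrow> push (am \<one>) x = x"
  by (erule push_id) (rule am_one)

lemma push_push_am_mult: "g \<in> carrier G \<Longrightarrow> h \<in> carrier G \<Longrightarrow> x \<in> frags K \<Longrightarrow>
    push (push (am g)) (push (push (am h)) x) = push (push (am (g \<otimes> h))) x"
  by (subst push_push, erule push_cong) (simp add: push_am_mult K_\<Omega>)

lemma push_push_am_one: "x \<in> frags K \<Longrightarrow> push (push (am \<one>)) x = x"
  by (erule push_id) (simp add: push_am_one K_\<Omega>)

lemma push_push_K: "g \<in> carrier G \<Longrightarrow> x \<in> frags K \<Longrightarrow> push (push (am g)) x \<in> frags K"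
  by (erule push_frags) (rule K_push)

lemma am_funpow: "g \<in> carrier G \<Longrightarrow> m \<in> carrier M \<Longrightarrow> (am g ^^ k) m = am (g [^] k) m"
proof (induction k)
  case (Suc k)
  then have "(am g ^^ Suc k) m = am (g \<otimes> g [^] k) m" by (simp add: am_mult)
  also have "g \<otimes> g [^] k = g [^] Suc k" by (rule nat_pow_Suc2[symmetric, OF Suc.prems(1)])
  finally show ?case .
qed (simp add: am_one)

lemma push_am_funpow: "g \<in> carrier G \<Longrightarrow> x \<in> \<Omega> \<Longrightarrow> (push (am g) ^^ k) x = push (am (g [^] k)) x"
  unfolding push_funpow by (erule push_cong) (rule am_funpow)

lemma push_push_am_funpow:
  assumes "g \<in> carrier G" "x \<in> frags K"
  shows "(push (push (am g)) ^^ k) x = push (push (am (g [^] k))) x"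
  unfolding push_funpow[where f = "push (am g)"] using assms(2)
  by (rule push_cong) (simp add: push_am_funpow assms(1) K_\<Omega> flip: push_funpow)

text \<open>
  Solve the equation in \<open>\<int>[M]\<close> first.  The image \<open>m\<close> of the solution \<open>z\<close> in \<open>M\<close> is then fixed
  by \<open>g\<close>, hence so is the basis element of \<open>m\<close>, and subtracting that element moves \<open>z\<close> into the
  kernel.
\<close>

lemma K_coflasque:
  assumes g: "g \<in> carrier G" and N: "N > 0" "g [^] N = \<one>"
    and x: "x \<in> K" "(\<Sum>j<N. (push (am g) ^^ j) x) = 0"
  shows "\<exists>z\<in>K. x = push (am g) z - z"
proof -
  obtain z where z: "z \<in> \<Omega>" "x = push (am g) z - z"
    using frags_norm_zero[OF N(1), of "carrier M" "am g" x] g N x K_\<Omega>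
    by (auto simp: am_funpow am_one am_closed)
  let ?m = "counit z"
  have m: "?m \<in> carrier M" by (rule counit_closed[OF z(1)])
  have "\<zero>\<^bsub>M\<^esub> = counit (push (am g) z - z)" using x(1) z(2) by (simp add: K_def)
  also have "\<dots> = am g ?m \<ominus>\<^bsub>M\<^esub> ?m" by (simp add: counit_diff push_am g z counit_push)
  finally have "am g ?m \<ominus>\<^bsub>M\<^esub> ?m = \<zero>\<^bsub>M\<^esub>" ..
  then have "am g ?m = ?m"
    using am_closed[OF g m] m M.add.inv_comm M.minus_equality[of "am g ?m" "\<ominus>\<^bsub>M\<^esub> ?m"]
    by (simp add: M.minus_eq)
  then have "x = push (am g) (z - frag_of ?m) - (z - frag_of ?m)"
    by (simp add: z(2) push_diff)
  moreover have "z - frag_of ?m \<in> K"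
    using z(1) m by (simp add: K_def frags_diff counit_diff counit(2) M.minus_eq M.r_neg)
  ultimately show ?thesis by blast
qed

abbreviation \<pi> :: "(('m \<Rightarrow>\<^sub>0 int) \<Rightarrow>\<^sub>0 int) \<Rightarrow> ('m \<Rightarrow>\<^sub>0 int)" where "\<pi> \<equiv> frag_extend (\<lambda>k. k)"

lemma pi_push: "\<pi> (push (push f) x) = push f (\<pi> x)"
proof -
  have "x \<in> frags UNIV" by (simp add: frags_def)
  then show ?thesis
    by (induction rule: frags_induct) (simp_all add: push_diff frag_extend_diff)
qed

lemma pi_K: "x \<in> frags K \<Longrightarrow> \<pi> x \<in> K"
  by (induction rule: frags_induct) (auto simp: frag_extend_diff K_0 K_diff)

text \<open>
  Equivariant sections of the counit up to a factor \<open>d\<close>: those for the various Sylow subgroups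
  combine to one with factor 1.
\<close>

definition splits :: "'g set \<Rightarrow> int \<Rightarrow> (('m \<Rightarrow>\<^sub>0 int) \<Rightarrow> (('m \<Rightarrow>\<^sub>0 int) \<Rightarrow>\<^sub>0 int)) \<Rightarrow> bool" where
  "splits H d s \<longleftrightarrow> (\<forall>k\<in>K. s k \<in> frags K \<and> \<pi> (s k) = frag_cmul d k) \<and>
     (\<forall>k\<in>K. \<forall>k'\<in>K. s (k + k') = s k + s k') \<and>
     (\<forall>g\<in>H. \<forall>k\<in>K. s (push (am g) k) = push (push (am g)) (s k))"

lemma cyclic_splits:
  fixes p n :: nat
  assumes p: "Factorial_Ring.prime p" and g: "g \<in> carrier G" and N: "g [^] (p ^ n) = \<one>"
  shows "\<exists>s. splits (range (\<lambda>k::nat. g [^] k)) 1 s"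
proof -
  let ?c = "push (am g)"
  have c_add: "?c (x + y) = ?c x + ?c y" for x y by (rule push_add)
  have cc_add: "push ?c (x + y) = push ?c x + push ?c y" for x y by (rule push_add)
  have p_pos: "p > 0" using p by (rule prime_gt_0_nat)
  interpret L: cyclic_p_lattice "poly_act ?c" p n K
  proof (intro cyclic_p_lattice.intro cyclic_p_lattice_axioms.intro)
    show md: "Modules.module (poly_act ?c)" by (rule module_poly_act[OF c_add])
    show "Factorial_Ring.prime p" by (rule p)
    show "Modules.module.subspace (poly_act ?c) K"
      unfolding Modules.module.subspace_def[OF md]
      by (intro conjI ballI allI K_0 K_add poly_act_closed[OF c_add] K_diff K_push g)
    show "x = 0" if "poly_act ?c (of_nat p) x = 0" for x
      using that p_pos by (simp add: poly_act_of_nat[OF c_add])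
    show "poly_act ?c (\<gamma> ^ p ^ n - 1) x = 0" if "x \<in> K" for x
      using that by (simp add: poly_act_gamma_power_minus_1[OF c_add] push_am_funpow g K_\<Omega> N push_am_one)
    show "\<exists>z\<in>K. x = poly_act ?c (\<gamma> ^ p ^ i - 1) z"
      if i: "i \<le> n" and x: "x \<in> K" "poly_act ?c (geo (p ^ i) (p ^ (n - i))) x = 0" for i x
    proof -
      let ?h = "g [^] (p ^ i)"
      have h: "?h \<in> carrier G" using g by simp
      have hN: "?h [^] (p ^ (n - i)) = \<one>"
        using g N i by (simp add: nat_pow_pow flip: power_add)
      have "(\<Sum>j<p ^ (n - i). (push (am ?h) ^^ j) x) = (\<Sum>j<p ^ (n - i). (?c ^^ (p ^ i * j)) x)"
        using g x by (intro sum.cong refl) (simp add: push_am_funpow K_\<Omega> nat_pow_pow)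
      also have "\<dots> = 0" using x(2) by (simp add: poly_act_geo[OF c_add])
      finally obtain z where z: "z \<in> K" "x = push (am ?h) z - z"
        using K_coflasque[OF h _ hN x(1)] p_pos by auto
      then show ?thesis
        by (intro bexI[of _ z]) (simp_all add: poly_act_gamma_power_minus_1[OF c_add] push_am_funpow g K_\<Omega>)
    qed
  qed
  interpret C: cyclic_p_cover "poly_act ?c" "poly_act (push ?c)" p n K "frags K" \<pi> frag_of
  proof (intro cyclic_p_cover.intro cyclic_p_cover_axioms.intro)
    show "cyclic_p_lattice (poly_act ?c) p n K" by (rule L.cyclic_p_lattice_axioms)
    show md: "Modules.module (poly_act (push ?c))" by (rule module_poly_act[OF cc_add])
    show "Modules.module.subspace (poly_act (push ?c)) (frags K)"
      unfolding Modules.module.subspace_def[OF md]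
      by (intro conjI ballI allI frags_0 frags_add poly_act_closed[OF cc_add] frags_diff push_push_K g)
    show "\<pi> (x + x') = \<pi> x + \<pi> x'" for x x' by (rule frag_extend_add)
    show "\<pi> (poly_act (push ?c) f x) = poly_act ?c f (\<pi> x)" for f x
      by (rule poly_act_intertwine) (rule frag_extend_add pi_push c_add cc_add)+
    show "\<pi> x \<in> K" if "x \<in> frags K" for x using that by (rule pi_K)
    show "frag_of y \<in> frags K" if "y \<in> K" for y using that by simp
    show "\<pi> (frag_of y) = y" for y by simp
    show "poly_act (push ?c) (\<gamma> ^ p ^ i - 1) (frag_of y) = 0" if "poly_act ?c (\<gamma> ^ p ^ i - 1) y = 0" for i y
      using that by (simp add: poly_act_gamma_power_minus_1[OF c_add] poly_act_gamma_power_minus_1[OF cc_add])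
        (simp add: push_funpow[where f = ?c])
    show "poly_act (push ?c) (\<gamma> ^ p ^ n - 1) x = 0" if "x \<in> frags K" for x
      using that by (simp add: poly_act_gamma_power_minus_1[OF cc_add] push_push_am_funpow g N push_push_am_one)
    show "x = 0" if sep: "\<And>k. \<exists>z. x = poly_act (push ?c) (of_nat (p ^ k)) z" for x
    proof (rule poly_mapping_eqI)
      fix a
      have d: "int (p ^ k) dvd lookup x a" for k
        using sep[of k] unfolding poly_act_of_nat[OF cc_add] by auto
      show "lookup x a = lookup 0 a"
      proof (rule ccontr)
        assume "lookup x a \<noteq> lookup 0 a"
        then have nz: "lookup x a \<noteq> 0" by simp
        let ?k = "nat \<bar>lookup x a\<bar>"
        have "int (p ^ ?k) \<le> \<bar>lookup x a\<bar>" using zdvd_imp_le[of "int (p ^ ?k)" "\<bar>lookup x a\<bar>"] d[of ?k] nz by simp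
        moreover have "?k < p ^ ?k" using prime_ge_2_nat[OF p] by (intro power_gt_expt) auto
        ultimately show False by linarith
      qed
    qed
    fix R :: "('m \<Rightarrow>\<^sub>0 int) \<Rightarrow> (('m \<Rightarrow>\<^sub>0 int) \<Rightarrow>\<^sub>0 int) \<Rightarrow> bool"
    assume R: "\<And>k. k \<in> K \<Longrightarrow> \<exists>a\<in>frags K. R k a"
      "\<And>k k' a a'. R k a \<Longrightarrow> R k' a' \<Longrightarrow> R (k - k') (a - a')"
    show "\<exists>\<sigma>. (\<forall>k\<in>K. \<sigma> k \<in> frags K \<and> R k (\<sigma> k)) \<and> (\<forall>k\<in>K. \<forall>k'\<in>K. \<sigma> (k + k') = \<sigma> k + \<sigma> k')"
      by (rule frag_subgroup_projective[of K "\<lambda>k a. a \<in> frags K \<and> R k a"])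
         (use R K_0 K_diff frags_diff in blast)+
  qed
  obtain s where s: "\<And>k. k \<in> K \<Longrightarrow> s k \<in> frags K \<and> \<pi> (s k) = k \<and> s (poly_act ?c \<gamma> k) = poly_act (push ?c) \<gamma> (s k)"
    and s_add: "\<And>k k'. k \<in> K \<Longrightarrow> k' \<in> K \<Longrightarrow> s (k + k') = s k + s k'"
    using C.equivariant_section by blast
  have s1: "s (?c k) = push ?c (s k)" if "k \<in> K" for k
    using s[OF that] by (simp add: poly_act_gamma[OF c_add] poly_act_gamma[OF cc_add])
  have "s (push (am (g [^] (i::nat))) k) = push (push (am (g [^] i))) (s k)" if k: "k \<in> K" for i k
  proof (induction i)
    case 0
    then show ?case using k s by (simp add: push_am_one push_push_am_one K_\<Omega>)
  next
    case (Suc i)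
    have "s (push (am (g [^] Suc i)) k) = s (?c (push (am (g [^] i)) k))"
      unfolding nat_pow_Suc2[OF g] using k g by (simp add: push_am_mult K_\<Omega>)
    also have "\<dots> = push ?c (push (push (am (g [^] i))) (s k))"
      using Suc k g by (simp add: s1 K_push)
    also have "\<dots> = push (push (am (g [^] Suc i))) (s k)"
      unfolding nat_pow_Suc2[OF g] using k g s by (simp add: push_push_am_mult)
    finally show ?case .
  qed
  then show ?thesis using s s_add by (intro exI[of _ s]) (auto simp: splits_def)
qed

lemma splits_diff:
  assumes "splits H d s" "splits H d' s'"
  shows "splits H (d - d') (\<lambda>k. s k - s' k)"
  using assms unfolding splits_def
  by (simp add: frags_diff frag_extend_diff frag_cmul_diff_distrib push_diff)

lemma splits_cmul:
  assumes "splits H d s"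
  shows "splits H (q * d) (\<lambda>k. frag_cmul q (s k))"
  using assms unfolding splits_def
  by (simp add: frags_cmul frag_extend_cmul frag_cmul_distrib2 push_cmul)

text \<open>
  The conjugates of a \<open>P\<close>-equivariant section depend only on a coset of \<open>P\<close>; their sum over all cosets
  is equivariant for the whole group.
\<close>

lemma splits_transfer:
  assumes P: "subgroup P G" and s: "splits P 1 s"
  shows "\<exists>S. splits (carrier G) (int (card (rcosets P))) S"
proof -
  interpret P: subgroup P G by fact
  have PG: "P \<subseteq> carrier G" by (rule P.subset)
  have s_K: "s k \<in> frags K" "\<pi> (s k) = k" and s_P: "g \<in> P \<Longrightarrow> s (push (am g) k) = push (push (am g)) (s k)"
    if "k \<in> K" for k g using s that by (auto simp: splits_def)
  have s_add: "k \<in> K \<Longrightarrow> k' \<in> K \<Longrightarrow> s (k + k') = s k + s k'" for k k' using s by (auto simp: splits_def)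
  define tw where "tw a k = push (push (am (inv a))) (s (push (am a) k))" for a k
  have tw_K: "tw a k \<in> frags K" if "a \<in> carrier G" "k \<in> K" for a k
    using that by (simp add: tw_def push_push_K s_K K_push)
  have tw_P: "tw (h \<otimes> a) k = tw a k" if "a \<in> carrier G" "h \<in> P" "k \<in> K" for a h k
  proof -
    have h: "h \<in> carrier G" using that(2) PG by blast
    have "s (push (am (h \<otimes> a)) k) = push (push (am h)) (s (push (am a) k))"
      using that h by (simp add: s_P K_push K_\<Omega> flip: push_am_mult)
    then show ?thesis unfolding tw_def
      using that h by (simp add: push_push_am_mult s_K K_push inv_mult_group m_assoc)
  qed
  define rep where "rep A = (SOME a. a \<in> A)" for A :: "'g set"
  have rep: "rep A \<in> A" if "A \<in> rcosets P" for A
    unfolding rep_def some_in_eq by (rule P.rcosets_non_empty[OF that])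
  have AG: "A \<subseteq> carrier G" if "A \<in> rcosets P" for A using rcosets_part_G[OF P] that by blast
  have tw_rep: "tw a k = tw (rep A) k" if A: "A \<in> rcosets P" "a \<in> A" "k \<in> K" for a A k
  proof -
    obtain b where b: "b \<in> carrier G" "A = P #> b" using A(1) by (auto simp: RCOSETS_def)
    have "tw x k = tw b k" if x: "x \<in> A" for x
    proof -
      obtain h where "h \<in> P" "x = h \<otimes> b" using x b(2) by (auto simp: r_coset_def)
      then show ?thesis using tw_P[OF b(1) _ \<open>k \<in> K\<close>] by simp
    qed
    then show ?thesis using A rep[OF A(1)] by simp
  qed
  define S where "S k = (\<Sum>A\<in>rcosets P. tw (rep A) k)" for k
  have repG: "rep A \<in> carrier G" if "A \<in> rcosets P" for A using rep[OF that] AG[OF that] by blast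
  have "splits (carrier G) (int (card (rcosets P))) S"
    unfolding splits_def
  proof (intro conjI ballI)
    fix k assume k: "k \<in> K"
    show "S k \<in> frags K" unfolding S_def by (intro frags_sum tw_K repG k)
    have "\<pi> (tw (rep A) k) = k" if "A \<in> rcosets P" for A
      using repG[OF that] k by (simp add: tw_def pi_push s_K K_push push_am_mult K_\<Omega> push_am_one)
    moreover have "finite (rcosets P)"
      using rcosets_subset_PowG[OF P] finite_G by (meson finite_Pow_iff finite_subset)
    ultimately have "\<pi> (S k) = (\<Sum>A\<in>rcosets P. k)"
      unfolding S_def by (simp add: frag_extend_sum comp_def)
    then show "\<pi> (S k) = frag_cmul (int (card (rcosets P))) k"
      using frag_cmul_sum_left[of "\<lambda>_. 1" "rcosets P" k] by simp
  next
    fix k k' assume "k \<in> K" "k' \<in> K"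
    then show "S (k + k') = S k + S k'"
      unfolding S_def sum.distrib[symmetric]
      by (intro sum.cong refl) (simp add: tw_def push_add s_add K_push repG)
  next
    fix h k assume h: "h \<in> carrier G" and k: "k \<in> K"
    have 1: "tw a (push (am h) k) = push (push (am h)) (tw (a \<otimes> h) k)" if a: "a \<in> carrier G" for a
    proof -
      have "push (push (am h)) (tw (a \<otimes> h) k) = push (push (am (h \<otimes> inv (a \<otimes> h)))) (s (push (am (a \<otimes> h)) k))"
        unfolding tw_def using a h k by (intro push_push_am_mult) (auto simp: s_K K_push)
      also have "h \<otimes> inv (a \<otimes> h) = inv a" using a h by (simp add: inv_mult_group flip: m_assoc)
      also have "push (am (a \<otimes> h)) k = push (am a) (push (am h) k)" using a h k by (simp add: push_am_mult K_\<Omega>)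
      finally show ?thesis by (simp add: tw_def)
    qed
    have bij: "bij_betw (\<lambda>A. A #> h) (rcosets P) (rcosets P)"
    proof (rule bij_betwI[of _ _ _ "\<lambda>A. A #> inv h"])
      show "(\<lambda>A. A #> h) \<in> rcosets P \<rightarrow> rcosets P"
        using h PG by (auto simp: RCOSETS_def coset_mult_assoc)
      show "(\<lambda>A. A #> inv h) \<in> rcosets P \<rightarrow> rcosets P"
        using h PG by (auto simp: RCOSETS_def coset_mult_assoc) (metis inv_closed m_closed)
    qed (use h AG in \<open>auto simp: coset_mult_assoc coset_mult_one\<close>)
    have "S (push (am h) k) = (\<Sum>A\<in>rcosets P. push (push (am h)) (tw (rep A \<otimes> h) k))"
      unfolding S_def using repG by (intro sum.cong refl 1)
    also have "\<dots> = (\<Sum>A\<in>rcosets P. push (push (am h)) (tw (rep (A #> h)) k))"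
    proof (intro sum.cong refl)
      fix A assume A: "A \<in> rcosets P"
      have "rep A \<otimes> h \<in> A #> h" using rep[OF A] by (auto simp: r_coset_def)
      moreover have "A #> h \<in> rcosets P" using bij A by (auto simp: bij_betw_def)
      ultimately show "push (push (am h)) (tw (rep A \<otimes> h) k) = push (push (am h)) (tw (rep (A #> h)) k)"
        using tw_rep k by metis
    qed
    also have "\<dots> = push (push (am h)) (\<Sum>A\<in>rcosets P. tw (rep (A #> h)) k)"
      by (simp add: push_sum)
    also have "(\<Sum>A\<in>rcosets P. tw (rep (A #> h)) k) = S k"
      unfolding S_def using sum.reindex_bij_betw[OF bij, of "\<lambda>A. tw (rep A) k"] by simp
    finally show "S (push (am h) k) = push (push (am h)) (S k)" .
  qed
  then show ?thesis by blast
qed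

text \<open>
  The factors \<open>d\<close> for which there is a splitting form an ideal of the integers.  For every prime \<open>p\<close> it
  contains the index of a Sylow \<open>p\<close>-subgroup, so it is the unit ideal.
\<close>

lemma sylow_cyclic_splits:
  assumes cyc: "\<And>p P. sylow_subgroup p P G \<Longrightarrow> cyclic_group (G\<lparr>carrier := P\<rparr>)"
  shows "\<exists>s. splits (carrier G) 1 s"
proof -
  define D where "D = {d. \<exists>s. splits (carrier G) d s}"
  have D_diff: "d - d' \<in> D" if "d \<in> D" "d' \<in> D" for d d'
    using that splits_diff unfolding D_def by blast
  have D_mult: "q * d \<in> D" if "d \<in> D" for d q
    using that splits_cmul unfolding D_def by blast
  have D_prime: "\<exists>d\<in>D. \<not> int p dvd d" if p: "Factorial_Ring.prime p" for p :: nat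
  proof -
    let ?a = "multiplicity p (Coset.order G)"
    have og: "Coset.order G \<noteq> 0" using finite_G order_gt_0_iff_finite by simp
    obtain m where m: "Coset.order G = p ^ ?a * m" "\<not> p dvd m"
      using multiplicity_decompose'[OF og, of p] p by (metis not_prime_unit)
    obtain P where P: "subgroup P G" "card P = p ^ ?a"
      using sylow_thm[OF p is_group m(1) finite_G] by blast
    then have "sylow_subgroup p P G" using p by (simp add: sylow_subgroup_def)
    then have "cyclic_group (G\<lparr>carrier := P\<rparr>)" by (rule cyc)
    then obtain x where x: "x \<in> P" "P = range (\<lambda>k::nat. x [^] k)"
      using cyclic_subgroup_iff_powers[OF finite_G P(1)] by blast
    have xG: "x \<in> carrier G" using x(1) subgroup.subset[OF P(1)] by blast
    have "ord x dvd card P"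
    proof -
      interpret GP: group "G\<lparr>carrier := P\<rparr>" using P(1) by (rule subgroup_imp_group)
      have "x [^]\<^bsub>G\<lparr>carrier := P\<rparr>\<^esub> Coset.order (G\<lparr>carrier := P\<rparr>) = \<one>\<^bsub>G\<lparr>carrier := P\<rparr>\<^esub>"
        using x(1) by (intro GP.pow_order_eq_1) simp
      then have "x [^] card P = \<one>" by (simp add: Coset.order_def nat_pow_consistent[symmetric])
      then show ?thesis using pow_eq_id[OF xG] by simp
    qed
    then have "x [^] (p ^ ?a) = \<one>" using pow_eq_id[OF xG] P(2) by simp
    from cyclic_splits[OF p xG this] obtain s where "splits P 1 s" using x(2) by auto
    then have "int (card (rcosets P)) \<in> D" using splits_transfer[OF P(1)] unfolding D_def by blast
    moreover have "card (rcosets P) * p ^ ?a = Coset.order G" using lagrange[OF P(1)] P(2) by simp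
    then have "card (rcosets P) = m" using m(1) og by (metis mult.commute mult_cancel_left mult_zero_left)
    ultimately show ?thesis using m(2) by (metis int_dvd_int_iff)
  qed
  obtain d where d: "d \<in> D" "\<And>e. e \<in> D \<Longrightarrow> d dvd e"
  proof -
    obtain e where "e \<in> D" using D_prime[OF two_is_prime_nat] by blast
    then have "0 \<in> D" using D_diff[of e e] by simp
    from int_subgroup_principal[OF this D_diff] show ?thesis using that by blast
  qed
  have "nat \<bar>d\<bar> = 1"
  proof (rule ccontr)
    assume "nat \<bar>d\<bar> \<noteq> 1"
    then obtain p where p: "Factorial_Ring.prime p" "p dvd nat \<bar>d\<bar>" using prime_factor_nat by blast
    then have "int p dvd d" by (simp add: nat_dvd_iff int_dvd_int_iff dvd_nat_abs_iff)
    moreover obtain e where "e \<in> D" "\<not> int p dvd e" using D_prime[OF p(1)] by blast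
    ultimately show False using d(2) dvd_trans by blast
  qed
  then have "sgn d * d = 1" by (cases "d > 0") (auto simp: sgn_if)
  then have "1 \<in> D" using D_mult[OF d(1), of "sgn d"] by simp
  then show ?thesis by (simp add: D_def)
qed

end

section \<open>Modules over the integral group ring\<close>

lemma int_group_ring_induct [consumes 1, case_names zero elem diff]:
  assumes a: "a \<in> carrier (int_group_ring G)"
    and "P (\<lambda>_. 0)" "\<And>g. g \<in> carrier G \<Longrightarrow> P (group_ring_elem g)"
    and "\<And>a b. a \<in> carrier (int_group_ring G) \<Longrightarrow> b \<in> carrier (int_group_ring G) \<Longrightarrow> P a \<Longrightarrow> P b \<Longrightarrow> P (\<lambda>g. a g - b g)"
  shows "P a"
proof -
  have fin: "finite {g. a g \<noteq> 0}" using a by (simp add: int_group_ring_def)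
  have la: "lookup (Abs_poly_mapping a) = a" by (rule lookup_Abs_poly_mapping[OF fin])
  have lk: "lookup x \<in> carrier (int_group_ring G)" if "x \<in> frags (carrier G)" for x
    using that by (auto simp: int_group_ring_def frags_def in_keys_iff finite_lookup)
  have "Abs_poly_mapping a \<in> frags (carrier G)"
    using a by (auto simp: frags_def in_keys_iff la int_group_ring_def)
  then have "P (lookup (Abs_poly_mapping a))"
  proof (induction rule: frags_induct)
    case zero
    have "lookup 0 = (\<lambda>_. 0)" by (rule ext) simp
    then show ?case using assms(2) by simp
  next
    case (one g)
    have "lookup (frag_of g) = group_ring_elem g" by (rule ext) (simp add: group_ring_elem_def)
    then show ?case using assms(3)[OF one] by simp
  next
    case (diff x y)
    have "lookup (x - y) = (\<lambda>g. lookup x g - lookup y g)" by (rule ext) (simp add: lookup_minus)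
    then show ?case using assms(4)[OF lk lk] diff by simp
  qed
  then show ?thesis by (simp add: la)
qed

lemma group_ring_elem_closed [simp]: "g \<in> carrier G \<Longrightarrow> group_ring_elem g \<in> carrier (int_group_ring G)"
  by (simp add: int_group_ring_def group_ring_elem_def)

lemma group_ring_elem_mult:
  assumes "group G" "g \<in> carrier G" "h \<in> carrier G"
  shows "group_ring_elem g \<otimes>\<^bsub>int_group_ring G\<^esub> group_ring_elem h = group_ring_elem (g \<otimes>\<^bsub>G\<^esub> h)"
proof
  fix k
  show "(group_ring_elem g \<otimes>\<^bsub>int_group_ring G\<^esub> group_ring_elem h) k = group_ring_elem (g \<otimes>\<^bsub>G\<^esub> h) k"
    by (subst int_group_ring_mult_eq[of "{g}" "{h}"]) (auto simp: group_ring_elem_def)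
qed

lemma group_ring_elem_one: "\<one>\<^bsub>int_group_ring G\<^esub> = group_ring_elem \<one>\<^bsub>G\<^esub>"
  by (simp add: int_group_ring_def group_ring_elem_def)

lemma group_ring_zero: "\<zero>\<^bsub>int_group_ring G\<^esub> = (\<lambda>_. 0)"
  by (simp add: int_group_ring_def)

lemma (in left_module) smult_zero: "x \<in> carrier M \<Longrightarrow> \<zero> \<odot>\<^bsub>M\<^esub> x = \<zero>\<^bsub>M\<^esub>"
  using smult_l_distr[of \<zero> \<zero> x] smult_closed[of \<zero> x] by (simp add: M.add.r_cancel_one')

lemma left_module_group_ring_diff:
  assumes M: "left_module (int_group_ring G) M" and x: "x \<in> carrier M"
    and a: "a \<in> carrier (int_group_ring G)" and b: "b \<in> carrier (int_group_ring G)"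
  shows "(\<lambda>g. a g - b g) \<odot>\<^bsub>M\<^esub> x = a \<odot>\<^bsub>M\<^esub> x \<ominus>\<^bsub>M\<^esub> (b \<odot>\<^bsub>M\<^esub> x)"
proof -
  interpret left_module "int_group_ring G" M by fact
  have "{g. a g - b g \<noteq> 0} \<subseteq> {g. a g \<noteq> 0} \<union> {g. b g \<noteq> 0}" by auto
  then have d: "(\<lambda>g. a g - b g) \<in> carrier (int_group_ring G)"
    using a b unfolding int_group_ring_def
    by (simp, meson finite_UnI finite_subset le_sup_iff order_trans)
  have "(\<lambda>g. a g - b g) \<oplus>\<^bsub>int_group_ring G\<^esub> b = a" by (rule ext) (simp add: int_group_ring_add)
  then have "a \<odot>\<^bsub>M\<^esub> x = (\<lambda>g. a g - b g) \<odot>\<^bsub>M\<^esub> x \<oplus>\<^bsub>M\<^esub> b \<odot>\<^bsub>M\<^esub> x"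
    using smult_l_distr[OF d b x] by simp
  then show ?thesis
    using smult_closed[OF d x] smult_closed[OF b x] by (simp add: M.minus_eq M.a_assoc M.r_neg)
qed

text \<open>
  The group elements generate the group ring additively, so linearity may be tested on them.
\<close>

lemma left_module_homI:
  assumes M: "left_module (int_group_ring G) M" and N: "left_module (int_group_ring G) N"
    and f: "f \<in> hom (add_monoid M) (add_monoid N)"
    and eq: "\<And>g x. g \<in> carrier G \<Longrightarrow> x \<in> carrier M \<Longrightarrow>
      f (group_ring_elem g \<odot>\<^bsub>M\<^esub> x) = group_ring_elem g \<odot>\<^bsub>N\<^esub> f x"
  shows "f \<in> left_module_hom (int_group_ring G) M N"
proof -
  interpret M: left_module "int_group_ring G" M by fact
  interpret N: left_module "int_group_ring G" N by fact
  interpret f: group_hom "add_monoid M" "add_monoid N" f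
    using f M.M.a_group N.M.a_group by (simp add: group_hom_def group_hom_axioms_def)
  have fc: "f x \<in> carrier N" if "x \<in> carrier M" for x using f.hom_closed[of x] that by simp
  have f0: "f \<zero>\<^bsub>M\<^esub> = \<zero>\<^bsub>N\<^esub>" using f.hom_one by simp
  have fadd: "f (x \<oplus>\<^bsub>M\<^esub> y) = f x \<oplus>\<^bsub>N\<^esub> f y" if "x \<in> carrier M" "y \<in> carrier M" for x y
    using f.hom_mult[of x y] that by simp
  have fneg: "f (\<ominus>\<^bsub>M\<^esub> x) = \<ominus>\<^bsub>N\<^esub> f x" if "x \<in> carrier M" for x
    using f.hom_inv[of x] that by (simp add: a_inv_def)
  have "f (a \<odot>\<^bsub>M\<^esub> x) = a \<odot>\<^bsub>N\<^esub> f x" if a: "a \<in> carrier (int_group_ring G)" and x: "x \<in> carrier M" for a x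
    using a
  proof (induction rule: int_group_ring_induct)
    case zero
    show ?case using M.smult_zero[OF x] N.smult_zero[OF fc[OF x]] f0 by (simp add: group_ring_zero)
  next
    case (elem g)
    then show ?case using eq x by blast
  next
    case (diff a b)
    then show ?case
      using x fc M.smult_closed N.smult_closed
      by (simp add: left_module_group_ring_diff[OF M] left_module_group_ring_diff[OF N]
          M.M.minus_eq N.M.minus_eq fadd fneg)
  qed
  then show ?thesis using f by (simp add: left_module_hom_def)
qed

lemma hom_free_Abelian_group_sum:
  assumes F: "abelian_group F" and E: "E \<in> hom (free_Abelian_group B) (add_monoid F)"
    and A: "finite A" "A \<subseteq> B"
  shows "E (\<Sum>b\<in>A. frag_cmul (c b) (frag_of b)) = (\<Oplus>\<^bsub>F\<^esub>b\<in>A. add_pow F (c b) (E (frag_of b)))"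
proof -
  interpret F: abelian_group F by fact
  interpret E: group_hom "free_Abelian_group B" "add_monoid F" E
    using E F.a_group by (simp add: group_hom_def group_hom_axioms_def)
  show ?thesis using A
  proof (induction A rule: finite_induct)
    case empty
    show ?case using E.hom_one by simp
  next
    case (insert b A)
    have E_cmul: "E (frag_cmul (c b) (frag_of b)) = add_pow F (c b) (E (frag_of b))" if "b \<in> B" for b
      using E.hom_int_pow[of "frag_of b" "c b"] that by (simp add: add_pow_def)
    have "E (frag_of b) \<in> carrier F" if "b \<in> B" for b using E.hom_closed[of "frag_of b"] that by simp
    then have "add_pow F (c b) (E (frag_of b)) \<in> carrier F" if "b \<in> B" for b
      using that by (auto intro: F.add.int_pow_closed)
    then have "(\<Oplus>\<^bsub>F\<^esub>b\<in>insert b A. add_pow F (c b) (E (frag_of b)))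
        = add_pow F (c b) (E (frag_of b)) \<oplus>\<^bsub>F\<^esub> (\<Oplus>\<^bsub>F\<^esub>b\<in>A. add_pow F (c b) (E (frag_of b)))"
      using insert by (intro F.finsum_insert) auto
    moreover have "frag_cmul (c b) (frag_of b) \<in> frags B" "(\<Sum>b\<in>A. frag_cmul (c b) (frag_of b)) \<in> frags B"
      using insert.prems by (auto intro!: frags_cmul frags_sum)
    ultimately show ?case
      using insert E.hom_mult[of "frag_cmul (c b) (frag_of b)" "\<Sum>b\<in>A. frag_cmul (c b) (frag_of b)"]
      by (simp add: E_cmul frags_def)
  qed
qed

text \<open>
  The theorem asks for modules on prescribed types.  This transports a group \<open>U\<close> of formal sums,
  on which the group acts by permuting the basis, along an injection \<open>\<phi>\<close>.
\<close>

definition frag_module :: "('g, 'x) monoid_scheme \<Rightarrow> ('g \<Rightarrow> 'w \<Rightarrow> 'w) \<Rightarrow> ('w \<Rightarrow>\<^sub>0 int) set \<Rightarrow>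
    (('w \<Rightarrow>\<^sub>0 int) \<Rightarrow> 't) \<Rightarrow> ('g \<Rightarrow> int, 't) module" where
  "frag_module G act U \<phi> =
    \<lparr> carrier = \<phi> ` U,
      monoid.mult = (\<lambda>_ _. \<phi> 0),
      one = \<phi> 0,
      ring.zero = \<phi> 0,
      ring.add = (\<lambda>x y. \<phi> (inv_into U \<phi> x + inv_into U \<phi> y)),
      module.smult = (\<lambda>a x. \<phi> (\<Sum>g\<in>carrier G. frag_cmul (a g) (push (act g) (inv_into U \<phi> x)))) \<rparr>"

locale frag_rep = group G for G :: "('g, 'x) monoid_scheme" (structure) +
  fixes act :: "'g \<Rightarrow> 'w \<Rightarrow> 'w" and U :: "('w \<Rightarrow>\<^sub>0 int) set" and \<phi> :: "('w \<Rightarrow>\<^sub>0 int) \<Rightarrow> 't"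
  assumes finite_G: "finite (carrier G)"
    and U_0: "0 \<in> U" and U_diff: "\<And>x y. x \<in> U \<Longrightarrow> y \<in> U \<Longrightarrow> x - y \<in> U"
    and U_push: "\<And>g x. g \<in> carrier G \<Longrightarrow> x \<in> U \<Longrightarrow> push (act g) x \<in> U"
    and push_one: "\<And>x. x \<in> U \<Longrightarrow> push (act \<one>) x = x"
    and push_mult: "\<And>g h x. g \<in> carrier G \<Longrightarrow> h \<in> carrier G \<Longrightarrow> x \<in> U \<Longrightarrow>
       push (act (g \<otimes> h)) x = push (act g) (push (act h) x)"
    and inj: "inj_on \<phi> U"
begin

abbreviation "F \<equiv> frag_module G act U \<phi>"
abbreviation "\<psi> \<equiv> inv_into U \<phi>"

lemma psi_phi [simp]: "x \<in> U \<Longrightarrow> \<psi> (\<phi> x) = x"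
  by (rule inv_into_f_f[OF inj])

lemma psi_U: "y \<in> carrier F \<Longrightarrow> \<psi> y \<in> U"
  by (auto simp: frag_module_def)

lemma phi_psi: "y \<in> carrier F \<Longrightarrow> \<phi> (\<psi> y) = y"
  by (auto simp: frag_module_def)

lemma phi_F: "x \<in> U \<Longrightarrow> \<phi> x \<in> carrier F"
  by (simp add: frag_module_def)

lemma U_add: "x \<in> U \<Longrightarrow> y \<in> U \<Longrightarrow> x + y \<in> U"
  using U_diff[of x "0 - y"] U_diff[OF U_0, of y] by simp

lemma U_cmul: "x \<in> U \<Longrightarrow> frag_cmul k x \<in> U"
  by (rule frag_closure_minus_cmul[of "\<lambda>x. x \<in> U"]) (auto intro: U_0 U_diff)

lemma U_sum: "(\<And>i. i \<in> I \<Longrightarrow> f i \<in> U) \<Longrightarrow> sum f I \<in> U"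
  by (induction I rule: infinite_finite_induct) (auto simp: U_add U_0)

lemma F_add: "x \<in> U \<Longrightarrow> y \<in> U \<Longrightarrow> \<phi> x \<oplus>\<^bsub>F\<^esub> \<phi> y = \<phi> (x + y)"
  by (simp add: frag_module_def inv_into_f_f[OF inj])

lemma F_zero: "\<zero>\<^bsub>F\<^esub> = \<phi> 0"
  by (simp add: frag_module_def)

text \<open>
  The action of the group ring on formal sums that \<open>frag_module\<close> transports.
\<close>

definition ring_act :: "('g \<Rightarrow> int) \<Rightarrow> ('w \<Rightarrow>\<^sub>0 int) \<Rightarrow> ('w \<Rightarrow>\<^sub>0 int)" where
  "ring_act a x = (\<Sum>g\<in>carrier G. frag_cmul (a g) (push (act g) x))"

lemma ring_act_U: "x \<in> U \<Longrightarrow> ring_act a x \<in> U"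
  unfolding ring_act_def by (intro U_sum U_cmul U_push)

lemma F_smult: "x \<in> U \<Longrightarrow> a \<odot>\<^bsub>F\<^esub> \<phi> x = \<phi> (ring_act a x)"
  by (simp add: frag_module_def ring_act_def inv_into_f_f[OF inj])

lemma ring_act_elem: "g \<in> carrier G \<Longrightarrow> ring_act (group_ring_elem g) x = push (act g) x"
proof -
  assume g: "g \<in> carrier G"
  have "ring_act (group_ring_elem g) x = (\<Sum>h\<in>carrier G. if h = g then push (act h) x else 0)"
    unfolding ring_act_def by (intro sum.cong) (auto simp: group_ring_elem_def)
  then show ?thesis using g finite_G by simp
qed

lemma F_smult_elem: "g \<in> carrier G \<Longrightarrow> x \<in> U \<Longrightarrow> group_ring_elem g \<odot>\<^bsub>F\<^esub> \<phi> x = \<phi> (push (act g) x)"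
  by (simp add: F_smult ring_act_elem)

lemma ring_act_mult:
  assumes x: "x \<in> U" and a: "a \<in> carrier (int_group_ring G)" and b: "b \<in> carrier (int_group_ring G)"
  shows "ring_act (a \<otimes>\<^bsub>int_group_ring G\<^esub> b) x = ring_act a (ring_act b x)"
proof -
  have s: "{g. a g \<noteq> 0} \<subseteq> carrier G" "{g. b g \<noteq> 0} \<subseteq> carrier G"
    using a b by (simp_all add: int_group_ring_def)
  let ?C = "carrier G"
  have "ring_act (a \<otimes>\<^bsub>int_group_ring G\<^esub> b) x
      = (\<Sum>g\<in>?C. \<Sum>h\<in>?C. \<Sum>k\<in>?C. if h \<otimes> k = g then frag_cmul (a h * b k) (push (act g) x) else 0)"
    unfolding ring_act_def int_group_ring_mult_eq[OF finite_G finite_G s]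
    by (simp add: frag_cmul_sum_left if_distrib[of "\<lambda>c. frag_cmul c _"] cong: if_cong)
  also have "\<dots> = (\<Sum>h\<in>?C. \<Sum>k\<in>?C. \<Sum>g\<in>?C. if h \<otimes> k = g then frag_cmul (a h * b k) (push (act g) x) else 0)"
    by (rule sum_swap3)
  also have "\<dots> = (\<Sum>h\<in>?C. \<Sum>k\<in>?C. frag_cmul (a h * b k) (push (act (h \<otimes> k)) x))"
    using finite_G by (intro sum.cong refl) simp
  also have "\<dots> = (\<Sum>h\<in>?C. \<Sum>k\<in>?C. frag_cmul (a h) (push (act h) (frag_cmul (b k) (push (act k) x))))"
    using x by (intro sum.cong refl) (simp add: push_mult push_cmul)
  also have "\<dots> = ring_act a (ring_act b x)"
    unfolding ring_act_def by (simp add: push_sum frag_cmul_sum finite_G)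
  finally show ?thesis .
qed

lemma left_module: "left_module (int_group_ring G) F"
proof (intro left_module.intro left_module_axioms.intro)
  show "ring (int_group_ring G)" by (rule ring_int_group_ring) (rule is_group)
  have F_E: "\<exists>u\<in>U. x = \<phi> u" if "x \<in> carrier F" for x using that by (auto simp: frag_module_def)
  show "abelian_group F"
  proof (rule abelian_groupI)
    fix x y assume "x \<in> carrier F" "y \<in> carrier F"
    then obtain u v where "u \<in> U" "v \<in> U" "x = \<phi> u" "y = \<phi> v" using F_E by blast
    then show "x \<oplus>\<^bsub>F\<^esub> y \<in> carrier F" "x \<oplus>\<^bsub>F\<^esub> y = y \<oplus>\<^bsub>F\<^esub> x"
      by (simp_all add: F_add phi_F U_add add.commute)
  next
    show "\<zero>\<^bsub>F\<^esub> \<in> carrier F" by (simp add: F_zero phi_F U_0)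
  next
    fix x y z assume "x \<in> carrier F" "y \<in> carrier F" "z \<in> carrier F"
    then obtain u v w where "u \<in> U" "v \<in> U" "w \<in> U" "x = \<phi> u" "y = \<phi> v" "z = \<phi> w" using F_E by meson
    then show "x \<oplus>\<^bsub>F\<^esub> y \<oplus>\<^bsub>F\<^esub> z = x \<oplus>\<^bsub>F\<^esub> (y \<oplus>\<^bsub>F\<^esub> z)"
      by (simp add: F_add U_add add.assoc)
  next
    fix x assume "x \<in> carrier F"
    then obtain u where u: "u \<in> U" "x = \<phi> u" using F_E by blast
    show "\<zero>\<^bsub>F\<^esub> \<oplus>\<^bsub>F\<^esub> x = x" using u by (simp add: F_zero F_add U_0)
    have "- u \<in> U" using U_diff[OF U_0 u(1)] by simp
    then show "\<exists>y\<in>carrier F. y \<oplus>\<^bsub>F\<^esub> x = \<zero>\<^bsub>F\<^esub>"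
      using u by (intro bexI[of _ "\<phi> (- u)"]) (simp_all add: F_add F_zero phi_F)
  qed
  fix x assume "x \<in> carrier F"
  then obtain u where u: "u \<in> U" "x = \<phi> u" using F_E by blast
  show "\<one>\<^bsub>int_group_ring G\<^esub> \<odot>\<^bsub>F\<^esub> x = x"
    using u by (simp add: group_ring_elem_one F_smult_elem push_one)
  fix a assume a: "a \<in> carrier (int_group_ring G)"
  show "a \<odot>\<^bsub>F\<^esub> x \<in> carrier F" using u by (simp add: F_smult phi_F ring_act_U)
  {
    fix y assume "y \<in> carrier F"
    then obtain v where v: "v \<in> U" "y = \<phi> v" using F_E by blast
    have "ring_act a (u + v) = ring_act a u + ring_act a v"
      by (simp add: ring_act_def push_add frag_cmul_distrib2 sum.distrib)
    then show "a \<odot>\<^bsub>F\<^esub> (x \<oplus>\<^bsub>F\<^esub> y) = a \<odot>\<^bsub>F\<^esub> x \<oplus>\<^bsub>F\<^esub> a \<odot>\<^bsub>F\<^esub> y"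
      using u v by (simp add: F_add F_smult U_add ring_act_U)
  }
  fix b assume b: "b \<in> carrier (int_group_ring G)"
  have "ring_act (a \<oplus>\<^bsub>int_group_ring G\<^esub> b) u = ring_act a u + ring_act b u"
    by (simp add: ring_act_def int_group_ring_add frag_cmul_distrib sum.distrib)
  then show "(a \<oplus>\<^bsub>int_group_ring G\<^esub> b) \<odot>\<^bsub>F\<^esub> x = a \<odot>\<^bsub>F\<^esub> x \<oplus>\<^bsub>F\<^esub> b \<odot>\<^bsub>F\<^esub> x"
    using u by (simp add: F_add F_smult ring_act_U)
  show "(a \<otimes>\<^bsub>int_group_ring G\<^esub> b) \<odot>\<^bsub>F\<^esub> x = a \<odot>\<^bsub>F\<^esub> (b \<odot>\<^bsub>F\<^esub> x)"
    using u a b by (simp add: F_smult ring_act_U ring_act_mult)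
qed

sublocale F: left_module "int_group_ring G" F by (rule left_module)

lemma permutation_module:
  assumes U: "U = frags \<Omega>" and act: "\<And>g. g \<in> carrier G \<Longrightarrow> bij_betw (act g) \<Omega> \<Omega>"
  shows "permutation_module G F"
  unfolding permutation_module_def
proof (intro conjI exI ballI)
  let ?\<beta> = "\<lambda>\<omega>. \<phi> (frag_of \<omega>)"
  have ofU: "frag_of \<omega> \<in> U" if "\<omega> \<in> \<Omega>" for \<omega> using that U by simp
  have \<beta>: "inj_on ?\<beta> \<Omega>"
  proof (rule inj_onI)
    fix a b assume "a \<in> \<Omega>" "b \<in> \<Omega>" "\<phi> (frag_of a) = \<phi> (frag_of b)"
    then have "frag_of a = frag_of b" using inj_onD[OF inj] U by simp
    then show "a = b" by (simp add: frag_of_eq)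
  qed
  show "left_module (int_group_ring G) F" by (rule left_module)
  \<comment> \<open>a coefficient function represents \<open>x\<close> exactly if it agrees with the coefficients of the formal
    sum \<open>\<psi> x\<close>; existence and uniqueness of coordinates follow\<close>
  have coord: "x = (\<Oplus>\<^bsub>F\<^esub>b\<in>{b. c b \<noteq> 0}. add_pow F (c b) b) \<longleftrightarrow> (\<forall>\<omega>\<in>\<Omega>. c (?\<beta> \<omega>) = lookup (\<psi> x) \<omega>)"
    if x: "x \<in> carrier F" and c: "finite {b. c b \<noteq> 0}" "{b. c b \<noteq> 0} \<subseteq> ?\<beta> ` \<Omega>" for x and c :: "'t \<Rightarrow> int"
  proof -
    obtain S where S: "S \<subseteq> \<Omega>" "inj_on ?\<beta> S" "{b. c b \<noteq> 0} = ?\<beta> ` S"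
      using c(2) unfolding subset_image_inj by blast
    have finS: "finite S" using c(1) S by (metis finite_imageD)
    have "\<phi> \<in> hom (free_Abelian_group \<Omega>) (add_monoid F)"
      using F_add phi_F U by (auto simp: hom_def frags_def)
    from hom_free_Abelian_group_sum[OF F.M.abelian_group_axioms this finS S(1)]
    have "\<phi> (\<Sum>\<omega>\<in>S. frag_cmul (c (?\<beta> \<omega>)) (frag_of \<omega>)) = (\<Oplus>\<^bsub>F\<^esub>\<omega>\<in>S. add_pow F (c (?\<beta> \<omega>)) (?\<beta> \<omega>))" .
    also have "\<dots> = (\<Oplus>\<^bsub>F\<^esub>b\<in>{b. c b \<noteq> 0}. add_pow F (c b) b)"
      unfolding S(3) using S(1) ofU
      by (intro F.M.finsum_reindex[symmetric] S(2)) (auto intro!: F.M.add.int_pow_closed phi_F)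
    finally have e: "(\<Oplus>\<^bsub>F\<^esub>b\<in>{b. c b \<noteq> 0}. add_pow F (c b) b) = \<phi> (\<Sum>\<omega>\<in>S. frag_cmul (c (?\<beta> \<omega>)) (frag_of \<omega>))" ..
    let ?y = "\<Sum>\<omega>\<in>S. frag_cmul (c (?\<beta> \<omega>)) (frag_of \<omega>)"
    have yU: "?y \<in> U" using S(1) U by (intro U_sum U_cmul) auto
    have lk: "lookup ?y \<omega> = c (?\<beta> \<omega>)" if \<omega>: "\<omega> \<in> \<Omega>" for \<omega>
    proof -
      have "lookup ?y \<omega> = (\<Sum>i\<in>S. if \<omega> = i then c (?\<beta> i) else 0)"
        by (simp add: Poly_Mapping.lookup_sum if_distrib[of "\<lambda>t. _ * t"] cong: if_cong)
      also have "\<dots> = (if \<omega> \<in> S then c (?\<beta> \<omega>) else 0)" using finS by simp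
      also have "\<dots> = c (?\<beta> \<omega>)"
      proof -
        have "\<omega> \<in> S" if "c (?\<beta> \<omega>) \<noteq> 0"
        proof -
          have "?\<beta> \<omega> \<in> ?\<beta> ` S" using that S(3) by blast
          then show ?thesis using inj_on_image_mem_iff[OF \<beta> \<omega> S(1)] by simp
        qed
        then show ?thesis by auto
      qed
      finally show ?thesis .
    qed
    have "x = \<phi> y \<longleftrightarrow> \<psi> x = y" if "y \<in> U" for y
      using psi_phi[OF that] phi_psi[OF x] by auto
    then have "x = \<phi> ?y \<longleftrightarrow> \<psi> x = ?y" using yU by blast
    also have "\<dots> \<longleftrightarrow> (\<forall>\<omega>\<in>\<Omega>. c (?\<beta> \<omega>) = lookup (\<psi> x) \<omega>)"
    proof
      assume "\<psi> x = ?y" then show "\<forall>\<omega>\<in>\<Omega>. c (?\<beta> \<omega>) = lookup (\<psi> x) \<omega>" using lk by simp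
    next
      assume a: "\<forall>\<omega>\<in>\<Omega>. c (?\<beta> \<omega>) = lookup (\<psi> x) \<omega>"
      show "\<psi> x = ?y"
      proof (rule poly_mapping_eqI)
        fix \<omega>
        show "lookup (\<psi> x) \<omega> = lookup ?y \<omega>"
        proof (cases "\<omega> \<in> \<Omega>")
          case True then show ?thesis using a lk by simp
        next
          case False
          then have "lookup z \<omega> = 0" if "z \<in> U" for z
            using that unfolding U frags_def by (auto simp: in_keys_iff)
          then show ?thesis using psi_U[OF x] yU by presburger
        qed
      qed
    qed
    finally show ?thesis unfolding e .
  qed
  show "is_int_basis F (?\<beta> ` \<Omega>)"
    unfolding is_int_basis_def
  proof (intro conjI ballI)
    show "?\<beta> ` \<Omega> \<subseteq> carrier F" using ofU by (auto intro: phi_F)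
    fix x assume x: "x \<in> carrier F"
    define c where "c b = (if b \<in> ?\<beta> ` \<Omega> then lookup (\<psi> x) (inv_into \<Omega> ?\<beta> b) else 0)" for b
    have c\<beta>: "c (?\<beta> \<omega>) = lookup (\<psi> x) \<omega>" if "\<omega> \<in> \<Omega>" for \<omega>
      using that inv_into_f_f[OF \<beta>] by (simp add: c_def)
    have sub: "{b. c b \<noteq> 0} \<subseteq> ?\<beta> ` \<Omega>" by (auto simp: c_def)
    have "{b. c b \<noteq> 0} \<subseteq> ?\<beta> ` keys (\<psi> x)"
    proof
      fix b assume b: "b \<in> {b. c b \<noteq> 0}"
      then obtain \<omega> where "\<omega> \<in> \<Omega>" "b = ?\<beta> \<omega>" using sub by blast
      then show "b \<in> ?\<beta> ` keys (\<psi> x)" using b c\<beta> by (auto simp: in_keys_iff)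
    qed
    then have fin: "finite {b. c b \<noteq> 0}" by (rule finite_subset) simp
    show "\<exists>!c :: 't \<Rightarrow> int. finite {b. c b \<noteq> 0} \<and> {b. c b \<noteq> 0} \<subseteq> ?\<beta> ` \<Omega> \<and>
        x = (\<Oplus>\<^bsub>F\<^esub>b\<in>{b. c b \<noteq> 0}. add_pow F (c b) b)"
    proof (rule ex1I[of _ c])
      show "finite {b. c b \<noteq> 0} \<and> {b. c b \<noteq> 0} \<subseteq> ?\<beta> ` \<Omega> \<and>
        x = (\<Oplus>\<^bsub>F\<^esub>b\<in>{b. c b \<noteq> 0}. add_pow F (c b) b)"
        using fin sub coord[OF x fin sub] c\<beta> by blast
    next
      fix c' :: "'t \<Rightarrow> int"
      assume c': "finite {b. c' b \<noteq> 0} \<and> {b. c' b \<noteq> 0} \<subseteq> ?\<beta> ` \<Omega> \<and>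
        x = (\<Oplus>\<^bsub>F\<^esub>b\<in>{b. c' b \<noteq> 0}. add_pow F (c' b) b)"
      then have c'\<beta>: "c' (?\<beta> \<omega>) = lookup (\<psi> x) \<omega>" if "\<omega> \<in> \<Omega>" for \<omega>
        using coord[OF x, of c'] that by blast
      show "c' = c"
      proof
        fix b
        show "c' b = c b"
        proof (cases "b \<in> ?\<beta> ` \<Omega>")
          case True then show ?thesis using c'\<beta> c\<beta> by auto
        next
          case False
          then have "c' b = 0" using c' by blast
          then show ?thesis using False by (simp add: c_def)
        qed
      qed
    qed
  qed
  fix g assume g: "g \<in> carrier G"
  have "bij_betw (\<lambda>\<omega>. ?\<beta> (act g \<omega>)) \<Omega> (?\<beta> ` \<Omega>)"
    using bij_betw_trans[OF act[OF g] bij_betw_imageI[OF \<beta> refl]] by (simp add: comp_def)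
  then have "bij_betw ((\<lambda>b. group_ring_elem g \<odot>\<^bsub>F\<^esub> b) \<circ> ?\<beta>) \<Omega> (?\<beta> ` \<Omega>)"
    by (rule bij_betw_cong[THEN iffD1, rotated]) (use g ofU in \<open>simp add: F_smult_elem\<close>)
  then show "bij_betw (\<lambda>b. group_ring_elem g \<odot>\<^bsub>F\<^esub> b) (?\<beta> ` \<Omega>) (?\<beta> ` \<Omega>)"
    using bij_betw_comp_iff[OF bij_betw_imageI[OF \<beta> refl]] by blast
qed

end

section \<open>The swindle\<close>

lemma frags_lepoll:
  assumes "A \<lesssim> (UNIV :: 'b set)" "infinite (UNIV :: 'b set)"
  shows "frags A \<lesssim> (UNIV :: 'b set)"
proof -
  obtain f :: "'a \<Rightarrow> 'b" where f: "inj_on f A" using assms(1) by (auto simp: lepoll_def)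
  have "inj_on (push f) (frags A)"
  proof (rule inj_onI)
    fix x y assume xy: "x \<in> frags A" "y \<in> frags A" "push f x = push f y"
    show "x = y"
    proof (rule poly_mapping_eqI)
      fix a
      show "lookup x a = lookup y a"
      proof (cases "a \<in> A")
        case True
        then show ?thesis using lookup_push_inj[OF f xy(1) True] lookup_push_inj[OF f xy(2) True] xy(3) by simp
      next
        case False
        then have "lookup z a = 0" if "z \<in> frags A" for z
          using that unfolding frags_def by (auto simp: in_keys_iff)
        then show ?thesis using xy(1,2) by simp
      qed
    qed
  qed
  then have "frags A \<lesssim> (UNIV :: ('b \<Rightarrow>\<^sub>0 int) set)" by (auto simp: lepoll_def)
  also have "(UNIV :: ('b \<Rightarrow>\<^sub>0 int) set) = carrier (free_Abelian_group (UNIV :: 'b set))"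
    by (auto simp: free_Abelian_group_def)
  also have "\<dots> \<approx> (UNIV :: 'b set)" by (rule eqpoll_free_Abelian_group_infinite[OF assms(2)])
  finally show ?thesis .
qed

context G_module
begin

text \<open>
  The permuted basis of a sum of countably many copies of \<open>\<int>[M] \<oplus> \<int>[K]\<close>.
\<close>

definition pts :: "(('m + ('m \<Rightarrow>\<^sub>0 int)) \<times> nat) set" where
  "pts = (Inl ` carrier M \<union> Inr ` K) \<times> UNIV"

definition pact :: "'g \<Rightarrow> ('m + ('m \<Rightarrow>\<^sub>0 int)) \<times> nat \<Rightarrow> ('m + ('m \<Rightarrow>\<^sub>0 int)) \<times> nat" where
  "pact g = (\<lambda>(w, n). (map_sum (am g) (push (am g)) w, n))"

lemma pact_closed: "g \<in> carrier G \<Longrightarrow> w \<in> pts \<Longrightarrow> pact g w \<in> pts"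
  by (auto simp: pts_def pact_def am_closed K_push)

lemma pact_one: "w \<in> pts \<Longrightarrow> pact \<one> w = w"
  by (auto simp: pts_def pact_def am_one push_am_one K_\<Omega>)

lemma pact_mult: "g \<in> carrier G \<Longrightarrow> h \<in> carrier G \<Longrightarrow> w \<in> pts \<Longrightarrow> pact (g \<otimes> h) w = pact g (pact h w)"
  by (auto simp: pts_def pact_def am_mult push_am_mult K_\<Omega>)

lemma pact_bij: "g \<in> carrier G \<Longrightarrow> bij_betw (pact g) pts pts"
proof (rule bij_betwI[of _ _ _ "pact (inv g)"])
  assume g: "g \<in> carrier G"
  show "pact g \<in> pts \<rightarrow> pts" "pact (inv g) \<in> pts \<rightarrow> pts" using g pact_closed by auto
  show "pact (inv g) (pact g w) = w" if "w \<in> pts" for w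
    using pact_mult[of "inv g" g w] g that pact_one by simp
  show "pact g (pact (inv g) w) = w" if "w \<in> pts" for w
    using pact_mult[of g "inv g" w] g that pact_one by simp
qed

text \<open>
  The inclusions of the \<open>n\<close>-th copies of \<open>\<int>[M]\<close> and \<open>\<int>[K]\<close>.
\<close>

definition jM :: "nat \<Rightarrow> ('m \<Rightarrow>\<^sub>0 int) \<Rightarrow> (('m + ('m \<Rightarrow>\<^sub>0 int)) \<times> nat) \<Rightarrow>\<^sub>0 int" where
  "jM n = push (\<lambda>m. (Inl m, n))"

definition jK :: "nat \<Rightarrow> (('m \<Rightarrow>\<^sub>0 int) \<Rightarrow>\<^sub>0 int) \<Rightarrow> (('m + ('m \<Rightarrow>\<^sub>0 int)) \<times> nat) \<Rightarrow>\<^sub>0 int" where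
  "jK n = push (\<lambda>k. (Inr k, n))"

lemma j_simps [simp]: "jM n 0 = 0" "jK n 0 = 0" "jM n (frag_of m) = frag_of (Inl m, n)"
  "jK n (frag_of k) = frag_of (Inr k, n)"
  by (simp_all add: jM_def jK_def)

lemma j_diff: "jM n (x - x') = jM n x - jM n x'" "jK n (y - y') = jK n y - jK n y'"
  by (simp_all add: jM_def jK_def push_diff)

lemma j_add: "jM n (x + x') = jM n x + jM n x'" "jK n (y + y') = jK n y + jK n y'"
  by (simp_all add: jM_def jK_def push_add)

lemma j_closed: "x \<in> \<Omega> \<Longrightarrow> jM n x \<in> frags pts" "y \<in> frags K \<Longrightarrow> jK n y \<in> frags pts"
  unfolding jM_def jK_def by (erule push_frags, simp add: pts_def)+

lemma j_pact: "push (pact g) (jM n x) = jM n (push (am g) x)"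
  "push (pact g) (jK n y) = jK n (push (push (am g)) y)"
  unfolding jM_def jK_def by (simp_all add: push_push pact_def comp_def)

lemma pts_induct [consumes 1, case_names zero M K diff]:
  assumes "x \<in> frags pts" "P 0" "\<And>m n. m \<in> carrier M \<Longrightarrow> P (jM n (frag_of m))"
    "\<And>k n. k \<in> K \<Longrightarrow> P (jK n (frag_of k))"
    "\<And>x y. x \<in> frags pts \<Longrightarrow> y \<in> frags pts \<Longrightarrow> P x \<Longrightarrow> P y \<Longrightarrow> P (x - y)"
  shows "P x"
  using assms(1)
proof (induction rule: frags_induct)
  case (one w)
  then show ?case using assms(3,4) by (auto simp: pts_def)
qed (use assms in auto)

text \<open>
  Let \<open>F\<close> be the sum of copies of \<open>\<int>[M] \<oplus> \<int>[K]\<close>, with elements \<open>(x\<^sub>n, y\<^sub>n)\<close>, and let \<open>p0\<close> be the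
  projection to \<open>x\<^sub>0\<close>; composed with the counit it maps \<open>F\<close> onto \<open>M\<close>, with kernel the elements
  for which \<open>x\<^sub>0\<close> lies in \<open>K\<close>.  This kernel is isomorphic to \<open>F\<close>: shifting makes room for \<open>K\<close> in place of
  the zeroth \<open>\<int>[M]\<close>, and since \<open>s\<close> identifies \<open>\<int>[K]\<close> with \<open>K \<oplus> L\<close> for \<open>L\<close> the kernel of \<open>\<pi>\<close>,
  the sum of copies of \<open>\<int>[K]\<close> absorbs one further \<open>K\<close>.  Explicitly, \<open>\<iota>\<close> sends \<open>(x\<^sub>n, y\<^sub>n)\<close> to the
  element with zeroth components \<open>\<pi> y\<^sub>0\<close> and \<open>y\<^sub>0 - s \<pi> y\<^sub>0 + s \<pi> y\<^sub>1\<close> and, for positive \<open>n\<close>,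
  components \<open>x\<^sub>n\<^sub>-\<^sub>1\<close> and \<open>y\<^sub>n - s \<pi> y\<^sub>n + s \<pi> y\<^sub>n\<^sub>+\<^sub>1\<close>.
\<close>

theorem swindle:
  assumes s: "splits (carrier G) 1 s"
  shows "\<exists>\<iota> p0. (\<forall>x y. \<iota> (x + y) = \<iota> x + \<iota> y) \<and> (\<forall>x\<in>frags pts. \<iota> x \<in> frags pts) \<and>
    (\<forall>g\<in>carrier G. \<forall>x\<in>frags pts. \<iota> (push (pact g) x) = push (pact g) (\<iota> x)) \<and>
    inj_on \<iota> (frags pts) \<and> \<iota> ` frags pts = {x \<in> frags pts. p0 x \<in> K} \<and>
    (\<forall>x y. p0 (x + y) = p0 x + p0 y) \<and> (\<forall>x\<in>frags pts. p0 x \<in> \<Omega>) \<and>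
    (\<forall>g\<in>carrier G. \<forall>x\<in>frags pts. p0 (push (pact g) x) = push (am g) (p0 x)) \<and>
    (\<forall>m\<in>carrier M. p0 (frag_of (Inl m, 0)) = frag_of m)"
proof -
  have s_Q: "s k \<in> frags K" and pi_s: "\<pi> (s k) = k" if "k \<in> K" for k
    using s that by (auto simp: splits_def)
  have s_add: "s (k + k') = s k + s k'" if "k \<in> K" "k' \<in> K" for k k'
    using s that by (auto simp: splits_def)
  have s_push: "s (push (am g) k) = push (push (am g)) (s k)" if "g \<in> carrier G" "k \<in> K" for g k
    using s that by (auto simp: splits_def)
  have s_diff: "s (k - k') = s k - s k'" if "k \<in> K" "k' \<in> K" for k k'
    using s_add[of "k - k'" k'] that by (simp add: K_diff)
  have s_0: "s 0 = 0" using s_diff[OF K_0 K_0] by simp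
  note lin = frag_extend_diff j_diff j_add
  define ib where "ib = (\<lambda>(w, n). case w of Inl m \<Rightarrow> jM (Suc n) (frag_of m)
     | Inr k \<Rightarrow> (case n of 0 \<Rightarrow> jM 0 k | Suc n' \<Rightarrow> jK n' (s k)) + jK n (frag_of k - s k))"
  define \<iota> where "\<iota> = frag_extend ib"
  \<comment> \<open>the inverse of \<open>\<iota>\<close> is the linear extension of \<open>rb\<close> plus \<open>s\<close> applied to \<open>x\<^sub>0\<close>, which is only
    defined where \<open>x\<^sub>0\<close> lies in \<open>K\<close>\<close>
  define rb where "rb = (\<lambda>(w, n). case w of
       Inl m \<Rightarrow> (case n of 0 \<Rightarrow> 0 | Suc n' \<Rightarrow> jM n' (frag_of m))
     | Inr k \<Rightarrow> jK n (frag_of k - s k) + jK (Suc n) (s k))"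
  define rl where "rl = frag_extend rb"
  define pb :: "('m + ('m \<Rightarrow>\<^sub>0 int)) \<times> nat \<Rightarrow> 'm \<Rightarrow>\<^sub>0 int"
    where "pb = (\<lambda>(w, n). case w of Inl m \<Rightarrow> (if n = 0 then frag_of m else 0) | Inr k \<Rightarrow> 0)"
  define p0 where "p0 = frag_extend pb"
  have \<iota>_diff: "\<iota> (x - y) = \<iota> x - \<iota> y" and \<iota>_add: "\<iota> (x + y) = \<iota> x + \<iota> y" and \<iota>_0: "\<iota> 0 = 0" for x y
    by (simp_all add: \<iota>_def frag_extend_diff frag_extend_add)
  have rl_diff: "rl (x - y) = rl x - rl y" and rl_add: "rl (x + y) = rl x + rl y" and rl_0: "rl 0 = 0" for x y
    by (simp_all add: rl_def frag_extend_diff frag_extend_add)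
  have p0_diff: "p0 (x - y) = p0 x - p0 y" and p0_add: "p0 (x + y) = p0 x + p0 y" and p0_0: "p0 0 = 0" for x y
    by (simp_all add: p0_def frag_extend_diff frag_extend_add)
  have U: "x \<in> frags UNIV" for x :: "'z \<Rightarrow>\<^sub>0 int" by (simp add: frags_def)
  have \<iota>M: "\<iota> (jM n x) = jM (Suc n) x" for n x
    using U[of x] by (induction rule: frags_induct) (simp_all add: \<iota>_0 \<iota>_diff j_diff, simp add: \<iota>_def ib_def)
  have rlM: "rl (jM 0 x) = 0" "rl (jM (Suc n) x) = jM n x" for n x
    using U[of x] by (induction rule: frags_induct, simp_all add: rl_0 rl_diff j_diff, simp_all add: rl_def rb_def)
  have p0M: "p0 (jM 0 x) = x" "p0 (jM (Suc n) x) = 0" for n x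
    using U[of x] by (induction rule: frags_induct, simp_all add: p0_0 p0_diff j_diff, simp_all add: p0_def pb_def)
  have p0K: "p0 (jK n y) = 0" for n y
    using U[of y] by (induction rule: frags_induct) (simp_all add: p0_0 p0_diff j_diff, simp add: p0_def pb_def)
  have \<iota>K0: "\<iota> (jK 0 y) = jM 0 (\<pi> y) + jK 0 (y - s (\<pi> y))" if "y \<in> frags K" for y
    using that
  proof (induction rule: frags_induct)
    case zero then show ?case by (simp add: \<iota>_0 s_0)
  next
    case (one k) then show ?case by (simp add: \<iota>_def ib_def)
  next
    case (diff x y)
    have e: "s (\<pi> x - \<pi> y) = s (\<pi> x) - s (\<pi> y)"
      using diff(1,2) pi_K s_diff by blast
    show ?case
      unfolding e lin \<iota>_diff diff(3,4) by (simp add: algebra_simps)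
  qed
  have \<iota>KS: "\<iota> (jK (Suc n) y) = jK n (s (\<pi> y)) + jK (Suc n) (y - s (\<pi> y))" if "y \<in> frags K" for y n
    using that
  proof (induction rule: frags_induct)
    case zero then show ?case by (simp add: \<iota>_0 s_0)
  next
    case (one k) then show ?case by (simp add: \<iota>_def ib_def)
  next
    case (diff x y)
    have e: "s (\<pi> x - \<pi> y) = s (\<pi> x) - s (\<pi> y)"
      using diff(1,2) pi_K s_diff by blast
    show ?case
      unfolding e lin \<iota>_diff diff(3,4) by (simp add: algebra_simps)
  qed
  have rlK: "rl (jK n y) = jK n (y - s (\<pi> y)) + jK (Suc n) (s (\<pi> y))" if "y \<in> frags K" for y n
    using that
  proof (induction rule: frags_induct)
    case zero then show ?case by (simp add: rl_0 s_0)
  next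
    case (one k) then show ?case by (simp add: rl_def rb_def)
  next
    case (diff x y)
    have e: "s (\<pi> x - \<pi> y) = s (\<pi> x) - s (\<pi> y)"
      using diff(1,2) pi_K s_diff by blast
    show ?case
      unfolding e lin rl_diff diff(3,4) by (simp add: algebra_simps)
  qed
  have ks: "frag_of k - s k \<in> frags K" "\<pi> (frag_of k - s k) = 0" if "k \<in> K" for k
    using that s_Q pi_s by (simp_all add: frags_diff frag_extend_diff)
  have \<iota>_closed: "\<iota> x \<in> frags pts" if "x \<in> frags pts" for x
    using that unfolding \<iota>_def
  proof (rule frags_extend)
    fix w :: "('m + ('m \<Rightarrow>\<^sub>0 int)) \<times> nat" assume "w \<in> pts"
    then consider (M) m n where "m \<in> carrier M" "w = (Inl m, n)" | (K) k n where "k \<in> K" "w = (Inr k, n)"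
      by (auto simp: pts_def)
    then show "ib w \<in> frags pts"
    proof cases
      case (M m n)
      then show ?thesis by (cases n) (simp_all add: ib_def j_closed del: j_simps(3))
    next
      case (K k n)
      then show ?thesis by (cases n) (simp_all add: ib_def j_closed frags_add ks s_Q K_\<Omega>)
    qed
  qed
  have rl_closed: "rl x \<in> frags pts" if "x \<in> frags pts" for x
    using that unfolding rl_def
  proof (rule frags_extend)
    fix w :: "('m + ('m \<Rightarrow>\<^sub>0 int)) \<times> nat" assume "w \<in> pts"
    then consider (M) m n where "m \<in> carrier M" "w = (Inl m, n)" | (K) k n where "k \<in> K" "w = (Inr k, n)"
      by (auto simp: pts_def)
    then show "rb w \<in> frags pts"
    proof cases
      case (M m n)
      then show ?thesis by (cases n) (simp_all add: rb_def j_closed del: j_simps(3))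
    next
      case (K k n)
      then show ?thesis by (cases n) (simp_all add: rb_def j_closed frags_add ks s_Q K_\<Omega>)
    qed
  qed
  have p0_closed: "p0 x \<in> \<Omega>" if "x \<in> frags pts" for x
    using that unfolding p0_def by (rule frags_extend) (auto simp: pts_def pb_def)
  define \<rho> where "\<rho> x = rl x + jK 0 (s (p0 x))" for x
  have inv1: "p0 (\<iota> x) \<in> K \<and> \<rho> (\<iota> x) = x" if "x \<in> frags pts" for x
    using that
  proof (induction rule: pts_induct)
    case zero
    then show ?case by (simp add: \<iota>_0 p0_0 K_0 \<rho>_def rl_0 s_0)
  next
    case (M m n)
    then show ?case by (simp add: \<rho>_def \<iota>M p0M K_0 rlM s_0 del: j_simps(3))
  next
    case (K k n)
    show ?case
    proof (cases n)
      case 0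
      have "\<iota> (jK n (frag_of k)) = jM 0 k + jK 0 (frag_of k - s k)"
        unfolding 0 using K by (simp add: \<iota>K0 del: j_simps(4))
      then show ?thesis using K ks[OF K]
        by (simp add: \<rho>_def p0_add rl_add p0M p0K rlM rlK s_0 0 del: j_simps(4)) (simp add: j_diff)
    next
      case (Suc n')
      have "\<iota> (jK n (frag_of k)) = jK n' (s k) + jK (Suc n') (frag_of k - s k)"
        unfolding Suc using K by (simp add: \<iota>KS del: j_simps(4))
      then show ?thesis using K ks[OF K] s_Q[OF K] pi_s[OF K]
        by (simp add: \<rho>_def p0_add rl_add p0K K_0 rlK s_0 Suc del: j_simps(4)) (simp add: j_diff)
    qed
  next
    case (diff x y)
    then have "p0 (\<iota> x) \<in> K" "p0 (\<iota> y) \<in> K" by auto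
    then have "\<rho> (\<iota> (x - y)) = \<rho> (\<iota> x) - \<rho> (\<iota> y)"
      by (simp add: \<rho>_def \<iota>_diff rl_diff p0_diff s_diff j_diff)
    then show ?case using diff by (simp add: \<iota>_diff p0_diff K_diff)
  qed
  have inv2: "\<iota> (rl x) = x - jM 0 (p0 x)" if "x \<in> frags pts" for x
    using that
  proof (induction rule: pts_induct)
    case zero
    then show ?case by (simp add: \<iota>_0 p0_0 rl_0)
  next
    case (M m n)
    show ?case by (cases n) (simp_all add: rlM p0M \<iota>_0 \<iota>M del: j_simps(3))
  next
    case (K k n)
    have "\<iota> (jK n (frag_of k - s k)) = jK n (frag_of k - s k)"
      using ks[OF K] by (cases n) (simp_all add: \<iota>K0 \<iota>KS s_0)
    moreover have "\<iota> (jK (Suc n) (s k)) = jK n (s k)"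
      using s_Q[OF K] pi_s[OF K] by (simp add: \<iota>KS)
    ultimately show ?case
      using K by (simp add: rlK p0K \<iota>_add del: j_simps(4)) (simp add: j_diff)
  next
    case (diff x y)
    then show ?case by (simp add: rl_diff \<iota>_diff p0_diff j_diff)
  qed
  have inv3: "\<iota> (\<rho> x) = x" if "x \<in> frags pts" "p0 x \<in> K" for x
    using that s_Q[OF that(2)] pi_s[OF that(2)]
    by (simp add: \<rho>_def \<iota>_add inv2 \<iota>K0)
  show ?thesis
  proof (intro exI[of _ \<iota>] exI[of _ p0] conjI allI ballI)
    show "\<iota> (x + y) = \<iota> x + \<iota> y" for x y by (rule \<iota>_add)
    show "\<iota> x \<in> frags pts" if "x \<in> frags pts" for x using that by (rule \<iota>_closed)
    show "inj_on \<iota> (frags pts)" by (rule inj_on_inverseI[of _ \<rho>]) (use inv1 in blast)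
    show "\<iota> ` frags pts = {x \<in> frags pts. p0 x \<in> K}"
    proof
      show "\<iota> ` frags pts \<subseteq> {x \<in> frags pts. p0 x \<in> K}" using \<iota>_closed inv1 by blast
      show "{x \<in> frags pts. p0 x \<in> K} \<subseteq> \<iota> ` frags pts"
      proof
        fix x assume "x \<in> {x \<in> frags pts. p0 x \<in> K}"
        then have x: "x \<in> frags pts" "p0 x \<in> K" by auto
        have "\<rho> x \<in> frags pts" unfolding \<rho>_def by (intro frags_add rl_closed j_closed x s_Q)
        then show "x \<in> \<iota> ` frags pts" using inv3[OF x] by (metis image_eqI)
      qed
    qed
    show "p0 (x + y) = p0 x + p0 y" for x y by (rule p0_add)
    show "p0 x \<in> \<Omega>" if "x \<in> frags pts" for x using that by (rule p0_closed)
    show "p0 (frag_of (Inl m, 0)) = frag_of m" for m by (simp add: p0_def pb_def)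
    fix g x assume g: "g \<in> carrier G" and x: "x \<in> frags pts"
    show "p0 (push (pact g) x) = push (am g) (p0 x)"
      using x
    proof (induction rule: pts_induct)
      case (M m n)
      show ?case by (cases n) (simp_all add: j_pact p0M del: j_simps(3))
    next
      case (K k n)
      show ?case by (simp add: j_pact p0K del: j_simps(4))
    qed (simp_all add: p0_0 push_diff p0_diff)
    show "\<iota> (push (pact g) x) = push (pact g) (\<iota> x)"
      using x
    proof (induction rule: pts_induct)
      case (M m n)
      show ?case by (simp add: j_pact \<iota>M del: j_simps(3))
    next
      case (K k n)
      have "push (am g) k \<in> K" using K g by (simp add: K_push)
      then show ?case
        using K g by (cases n) (simp_all add: j_pact \<iota>K0 \<iota>KS push_push_K push_add pi_push s_push push_diff[symmetric] del: j_simps(4),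
          simp_all add: push_diff)
    qed (simp_all add: \<iota>_0 push_diff \<iota>_diff)
  qed
qed

lemma pts_lepoll:
  assumes "infinite (UNIV :: 'm set)"
  shows "pts \<lesssim> (UNIV :: 'm set)"
proof -
  let ?M = "UNIV :: 'm set"
  have "K \<subseteq> \<Omega>" by (auto simp: K_def)
  then have "K \<lesssim> ?M"
    by (rule lepoll_trans[OF subset_imp_lepoll])
       (rule frags_lepoll[OF subset_imp_lepoll[OF subset_UNIV] assms])
  then have "Inr ` K \<lesssim> ?M" by (rule lepoll_trans[OF image_lepoll])
  moreover have "Inl ` carrier M \<lesssim> ?M"
    by (rule lepoll_trans[OF image_lepoll]) (rule subset_imp_lepoll, simp)
  ultimately have "|Inl ` carrier M \<union> Inr ` K| \<le>o |?M|"
    unfolding lepoll_def card_of_ordLeq by (intro card_of_Un_ordLeq_infinite[OF assms])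
  moreover have "|UNIV :: nat set| \<le>o |?M|" using assms by (simp add: infinite_iff_card_of_nat)
  ultimately have "|pts| \<le>o |?M|"
    unfolding pts_def using assms by (intro card_of_Times_ordLeq_infinite) auto
  then show ?thesis unfolding lepoll_def card_of_ordLeq .
qed

end

section \<open>Crossed homomorphisms and the augmentation ideal\<close>

locale finite_group_set = group G for G :: "('g, 'x) monoid_scheme" (structure) +
  fixes act :: "'g \<Rightarrow> 'w \<Rightarrow> 'w" and B :: "'w set"
  assumes finite_G: "finite (carrier G)"
    and act_closed: "\<lbrakk>g \<in> carrier G; y \<in> B\<rbrakk> \<Longrightarrow> act g y \<in> B"
    and act_one: "y \<in> B \<Longrightarrow> act \<one> y = y"
    and act_mult: "\<lbrakk>g \<in> carrier G; h \<in> carrier G; y \<in> B\<rbrakk> \<Longrightarrow> act (g \<otimes> h) y = act g (act h y)"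
begin

abbreviation tr :: "'g \<Rightarrow> ('w \<Rightarrow>\<^sub>0 int) \<Rightarrow> ('w \<Rightarrow>\<^sub>0 int)" where "tr g \<equiv> push (act g)"

lemma act_inv [simp]: "g \<in> carrier G \<Longrightarrow> y \<in> B \<Longrightarrow> act (inv g) (act g y) = y"
  "g \<in> carrier G \<Longrightarrow> y \<in> B \<Longrightarrow> act g (act (inv g) y) = y"
  by (simp_all add: act_mult[symmetric] act_one)

lemma tr_closed: "g \<in> carrier G \<Longrightarrow> x \<in> frags B \<Longrightarrow> tr g x \<in> frags B"
  by (erule push_frags) (rule act_closed)

lemma tr_mult: "g \<in> carrier G \<Longrightarrow> h \<in> carrier G \<Longrightarrow> x \<in> frags B \<Longrightarrow> tr (g \<otimes> h) x = tr g (tr h x)"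
  by (subst push_push, erule push_cong) (simp add: act_mult)

lemma tr_one: "x \<in> frags B \<Longrightarrow> tr \<one> x = x"
  by (erule push_id) (rule act_one)

lemma lookup_tr:
  assumes g: "g \<in> carrier G" and x: "x \<in> frags B" and y: "y \<in> B"
  shows "lookup (tr g x) y = lookup x (act (inv g) y)"
proof -
  have "inj_on (act g) B" by (rule inj_on_inverseI[of _ "act (inv g)"]) (use g in simp)
  from lookup_push_inj[OF this x act_closed[OF inv_closed[OF g] y]] show ?thesis using g y by simp
qed

lemma lookup_outside: "x \<in> frags B \<Longrightarrow> y \<notin> B \<Longrightarrow> lookup x y = 0"
  by (auto simp: frags_def in_keys_iff)

text \<open>
  A permutation module is a sum of modules induced from stabilizers, so a crossed homomorphism into
  it is principal as soon as its restrictions to the stabilizers, evaluated at the fixed basis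
  element, are trivial.  The modulus \<open>m\<close> may be 0; then all congruences are equalities.
\<close>

lemma crossed_hom_principal:
  fixes u :: "'g \<Rightarrow> ('w \<Rightarrow>\<^sub>0 int)" and m :: int
  assumes u: "\<And>g. g \<in> carrier G \<Longrightarrow> u g \<in> frags B"
    and crossed: "\<And>g h y. \<lbrakk>g \<in> carrier G; h \<in> carrier G; y \<in> B\<rbrakk> \<Longrightarrow>
      m dvd lookup (u (g \<otimes> h)) y - lookup (u g) y - lookup (u h) (act (inv g) y)"
    and stab: "\<And>s y. \<lbrakk>s \<in> carrier G; y \<in> B; act s y = y\<rbrakk> \<Longrightarrow> m dvd lookup (u s) y"
  shows "\<exists>v\<in>frags B. \<forall>g\<in>carrier G. \<forall>y. m dvd lookup (u g - (tr g v - v)) y"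
proof -
  define orb where "orb y = (\<lambda>k. act k y) ` carrier G" for y
  define r where "r y = (SOME z. z \<in> orb y)" for y
  have orb_act: "orb (act g y) = orb y" if g: "g \<in> carrier G" and y: "y \<in> B" for g y
  proof
    show "orb (act g y) \<subseteq> orb y" using g y by (auto simp: orb_def simp flip: act_mult)
    show "orb y \<subseteq> orb (act g y)"
    proof
      fix z assume "z \<in> orb y"
      then obtain k where k: "k \<in> carrier G" "z = act k y" by (auto simp: orb_def)
      have "z = act (k \<otimes> inv g) (act g y)" using k g y by (simp add: act_mult act_closed)
      then show "z \<in> orb (act g y)" using k g by (auto simp: orb_def)
    qed
  qed
  have r_act: "r (act g y) = r y" if "g \<in> carrier G" "y \<in> B" for g y
    using orb_act[OF that] by (simp add: r_def)
  have r_orb: "r y \<in> orb y" for y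
  proof -
    have "act \<one> y \<in> orb y" by (simp add: orb_def)
    then show ?thesis unfolding r_def by (rule someI)
  qed
  have r_B: "r y \<in> B" if "y \<in> B" for y using r_orb[of y] that act_closed by (auto simp: orb_def)
  have "\<exists>k. k \<in> carrier G \<and> y = act k (r y)" if y: "y \<in> B" for y
  proof -
    obtain k where k: "k \<in> carrier G" "r y = act k y" using r_orb[of y] by (auto simp: orb_def)
    then show ?thesis using y by (intro exI[of _ "inv k"]) simp
  qed
  then obtain \<kappa> where \<kappa>: "\<And>y. y \<in> B \<Longrightarrow> \<kappa> y \<in> carrier G" "\<And>y. y \<in> B \<Longrightarrow> y = act (\<kappa> y) (r y)"
    by metis
  \<comment> \<open>the equation \<open>u g = g v - v\<close>, with \<open>v\<close> zero at the orbit representatives, determines \<open>v\<close>\<close>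
  define c where "c y = (if y \<in> B then - lookup (u (\<kappa> y)) y else 0)" for y
  have "{y. c y \<noteq> 0} \<subseteq> (\<Union>k\<in>carrier G. keys (u k))"
    using \<kappa>(1) by (auto simp: c_def in_keys_iff split: if_splits)
  then have fin: "finite {y. c y \<noteq> 0}" by (rule finite_subset) (use finite_G in simp)
  define v where "v = Abs_poly_mapping c"
  have lv: "lookup v = c" unfolding v_def by (rule lookup_Abs_poly_mapping[OF fin])
  have vB: "v \<in> frags B" by (auto simp: frags_def in_keys_iff lv c_def split: if_splits)
  have ind: "m dvd lookup (u k) y + c y" if y: "y \<in> B" and k: "k \<in> carrier G" "y = act k (r y)" for y k
  proof -
    let ?s = "inv (\<kappa> y) \<otimes> k"
    have s: "?s \<in> carrier G" "\<kappa> y \<otimes> ?s = k" using \<kappa>(1)[OF y] k by (simp_all add: m_assoc[symmetric])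
    have ki: "act (inv (\<kappa> y)) y = r y" using \<kappa>[OF y] r_B[OF y] act_inv(1) by metis
    then have fix_r: "act ?s (r y) = r y" using \<kappa>(1)[OF y] k r_B[OF y] by (simp add: act_mult)
    have "m dvd lookup (u k) y - lookup (u (\<kappa> y)) y - lookup (u ?s) (r y)"
      using crossed[OF \<kappa>(1)[OF y] s(1) y] unfolding s(2) ki .
    moreover have "m dvd lookup (u ?s) (r y)" by (rule stab[OF s(1) r_B[OF y] fix_r])
    ultimately have "m dvd (lookup (u k) y - lookup (u (\<kappa> y)) y - lookup (u ?s) (r y)) + lookup (u ?s) (r y)"
      by (rule dvd_add)
    then show ?thesis using y by (simp add: c_def)
  qed
  show ?thesis
  proof (intro bexI[OF _ vB] ballI allI)
    fix g y assume g: "g \<in> carrier G"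
    show "m dvd lookup (u g - (tr g v - v)) y"
    proof (cases "y \<in> B")
      case False
      then show ?thesis using lookup_outside[OF _ False] u[OF g] vB tr_closed[OF g vB] by (simp add: lookup_minus)
    next
      case y: True
      let ?y = "act (inv g) y" and ?k = "inv g \<otimes> \<kappa> y"
      have y': "?y \<in> B" using g y by (simp add: act_closed)
      have k: "?k \<in> carrier G" "g \<otimes> ?k = \<kappa> y" using g \<kappa>(1)[OF y] by (simp_all add: m_assoc[symmetric])
      have "?y = act ?k (r ?y)"
        using \<kappa>[OF y] g y r_B[OF y] r_act[of "inv g" y] by (simp add: act_mult)
      then have 1: "m dvd lookup (u ?k) ?y + c ?y" by (rule ind[OF y' k(1)])
      have 2: "m dvd lookup (u (\<kappa> y)) y - lookup (u g) y - lookup (u ?k) ?y"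
        using crossed[OF g k(1) y] unfolding k(2) .
      have "lookup (u g - (tr g v - v)) y = lookup (u g) y - c ?y + c y"
        by (simp add: lookup_minus lookup_tr g vB y lv)
      also have "c y = - lookup (u (\<kappa> y)) y" using y by (simp add: c_def)
      also have "lookup (u g) y - c ?y + - lookup (u (\<kappa> y)) y
          = - ((lookup (u (\<kappa> y)) y - lookup (u g) y - lookup (u ?k) ?y) + (lookup (u ?k) ?y + c ?y))"
        by simp
      finally show ?thesis using dvd_add[OF 2 1] by (simp only: dvd_minus_iff)
    qed
  qed
qed

text \<open>
  On the stabilizer of \<open>y\<close> the coefficient at \<open>y\<close> of a crossed homomorphism is a homomorphism.
\<close>

lemma crossed_hom_power:
  fixes u :: "'g \<Rightarrow> ('w \<Rightarrow>\<^sub>0 int)" and m :: int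
  assumes crossed: "\<And>g h y. \<lbrakk>g \<in> carrier G; h \<in> carrier G; y \<in> B\<rbrakk> \<Longrightarrow>
      m dvd lookup (u (g \<otimes> h)) y - lookup (u g) y - lookup (u h) (act (inv g) y)"
    and s: "s \<in> carrier G" "y \<in> B" "act s y = y"
  shows "m dvd int (ord s) * lookup (u s) y"
proof -
  have si: "act (inv s) y = y" using act_inv(1)[OF s(1,2)] s(3) by simp
  have one: "m dvd lookup (u \<one>) y" using crossed[of \<one> \<one> y] s(2) act_one by simp
  have "m dvd lookup (u (s [^] k)) y - int k * lookup (u s) y" for k :: nat
  proof (induction k)
    case 0 then show ?case using one by simp
  next
    case (Suc k)
    have "m dvd lookup (u (s \<otimes> s [^] k)) y - lookup (u s) y - lookup (u (s [^] k)) y"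
      using crossed[of s "s [^] k" y] s si by simp
    from dvd_add[OF this Suc] show ?case
      unfolding nat_pow_Suc2[OF s(1)] by (simp add: algebra_simps)
  qed
  from this[of "ord s"] have "m dvd lookup (u \<one>) y - int (ord s) * lookup (u s) y"
    using s(1) by simp
  from dvd_diff[OF one this] show ?thesis by simp
qed

end

definition augmentation :: "('a \<Rightarrow>\<^sub>0 int) \<Rightarrow> int" where
  "augmentation x = lookup (push (\<lambda>_. ()) x) ()"

lemma augmentation_simps [simp]:
  "augmentation 0 = 0" "augmentation (frag_of a) = 1"
  "augmentation (x + y) = augmentation x + augmentation y"
  "augmentation (x - y) = augmentation x - augmentation y"
  "augmentation (frag_cmul k x) = k * augmentation x"
  "augmentation (push f x) = augmentation x"
  by (simp_all add: augmentation_def push_add push_diff push_cmul lookup_add lookup_minus push_push comp_def)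

lemma augmentation_eq_sum:
  assumes "finite A" "x \<in> frags A" shows "augmentation x = (\<Sum>a\<in>A. lookup x a)"
  using assms(2)
proof (induction rule: frags_induct)
  case (one a)
  then show ?case using assms(1) by simp
qed (simp_all add: lookup_minus sum_subtractf)

text \<open>
  The coefficients of a \<open>P\<close>-invariant element are constant on the cosets of \<open>P\<close>.
\<close>

lemma (in group) augmentation_invariant:
  assumes fin: "finite (carrier G)" and P: "subgroup P G" and x: "x \<in> frags (carrier G)"
    and inv: "\<And>g. g \<in> P \<Longrightarrow> push ((\<otimes>) g) x = x"
  shows "int (card P) dvd augmentation x"
proof -
  have PG: "P \<subseteq> carrier G" by (rule subgroup.subset[OF P])
  have const: "lookup x (g \<otimes> a) = lookup x a" if "g \<in> P" "a \<in> carrier G" for g a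
  proof -
    have g: "g \<in> carrier G" using that PG by blast
    have "inj_on ((\<otimes>) g) (carrier G)" by (rule inj_onI) (use g in simp)
    from lookup_push_inj[OF this x that(2)] show ?thesis using inv[OF that(1)] by simp
  qed
  have finA: "finite A" if "A \<in> rcosets P" for A
    using that rcosets_part_G[OF P] fin by (metis Union_upper finite_subset)
  have "augmentation x = sum (lookup x) (\<Union>(rcosets P))"
    unfolding rcosets_part_G[OF P] by (rule augmentation_eq_sum[OF fin x])
  also have "\<dots> = (\<Sum>A\<in>rcosets P. sum (lookup x) A)"
    using finA rcos_disjoint[OF P] by (subst sum.Union_disjoint) (auto simp: pairwise_def disjnt_def)
  finally have e: "augmentation x = (\<Sum>A\<in>rcosets P. sum (lookup x) A)" .
  have "int (card P) dvd sum (lookup x) A" if A: "A \<in> rcosets P" for A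
  proof -
    obtain a where a: "a \<in> carrier G" "A = P #> a" using A by (auto simp: RCOSETS_def)
    have "sum (lookup x) A = (\<Sum>b\<in>A. lookup x a)"
      using a const by (intro sum.cong refl) (auto simp: r_coset_def)
    also have "\<dots> = int (card A) * lookup x a" by simp
    also have "card A = card P" using card_rcosets_equal[OF A PG] by simp
    finally show ?thesis by simp
  qed
  then show ?thesis unfolding e by (rule dvd_sum)
qed

text \<open>
  The hypotheses describe a permutation presentation, with maps \<open>I\<close> and \<open>q\<close>, of the augmentation
  ideal of \<open>\<int>[Z]\<close>, restricted to a group \<open>G\<close> of order \<open>p^(a+1)\<close>.  Lift the crossed homomorphism
  \<open>g \<mapsto> g z - z\<close> to a map \<open>\<alpha>\<close> into \<open>\<int>[B]\<close>.  Its failure to be a crossed homomorphism is a 2-cocycle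
  \<open>I \<beta>\<close>.  Summing over the last argument shows that \<open>p^(a+1) \<beta>\<close> is the coboundary of some \<open>u0\<close>.
  Modulo \<open>p^(a+1)\<close>, \<open>u0\<close> is a crossed homomorphism, and its values on stabilizers are divisible by
  \<open>p\<close>, since otherwise a stabilizer would contain an element of order \<open>p^(a+1)\<close>.  So \<open>u0\<close> is
  principal modulo \<open>p\<close>, and already \<open>p^a \<beta>\<close> is a coboundary.  Consequently \<open>p^a \<alpha>\<close> can be
  corrected to a crossed homomorphism into \<open>\<int>[B]\<close>.  This is principal, so \<open>p^a z\<close> differs by an
  element of augmentation 0 from an invariant element, whose augmentation is divisible by
  \<open>p^(a+1)\<close>; this is absurd.
\<close>

lemma (in finite_group_set) augmentation_obstruction:
  fixes Z :: "'z set" and actZ :: "'g \<Rightarrow> 'z \<Rightarrow> 'z" and p a :: nat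
    and q :: "('w \<Rightarrow>\<^sub>0 int) \<Rightarrow> ('z \<Rightarrow>\<^sub>0 int)" and I :: "('w \<Rightarrow>\<^sub>0 int) \<Rightarrow> ('w \<Rightarrow>\<^sub>0 int)"
  assumes p: "Factorial_Ring.prime p" and card: "card (carrier G) = p ^ Suc a"
    and noncyclic: "\<And>s. s \<in> carrier G \<Longrightarrow> ord s \<noteq> p ^ Suc a"
    and Z: "finite_group_set G actZ Z" and z: "z \<in> Z"
    and aug: "\<And>w. w \<in> frags Z \<Longrightarrow> (\<And>g. g \<in> carrier G \<Longrightarrow> push (actZ g) w = w) \<Longrightarrow>
      int (card (carrier G)) dvd augmentation w"
    and q_add: "\<And>x y. x \<in> frags B \<Longrightarrow> y \<in> frags B \<Longrightarrow> q (x + y) = q x + q y"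
    and q_im: "q ` frags B = {w \<in> frags Z. augmentation w = 0}"
    and q_act: "\<And>g x. g \<in> carrier G \<Longrightarrow> x \<in> frags B \<Longrightarrow> q (tr g x) = push (actZ g) (q x)"
    and I_add: "\<And>x y. x \<in> frags B \<Longrightarrow> y \<in> frags B \<Longrightarrow> I (x + y) = I x + I y"
    and I_inj: "inj_on I (frags B)"
    and I_act: "\<And>g x. g \<in> carrier G \<Longrightarrow> x \<in> frags B \<Longrightarrow> I (tr g x) = tr g (I x)"
    and I_im: "I ` frags B = {x \<in> frags B. q x = 0}"
  shows False
proof -
  interpret Z: finite_group_set G actZ Z by (rule Z)
  have q_diff: "q (x - y) = q x - q y" if "x \<in> frags B" "y \<in> frags B" for x y
    using q_add[of "x - y" y] that by (simp add: frags_diff)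
  have I_diff: "I (x - y) = I x - I y" if "x \<in> frags B" "y \<in> frags B" for x y
    using I_add[of "x - y" y] that by (simp add: frags_diff)
  have I_B: "I x \<in> frags B" "q (I x) = 0" if "x \<in> frags B" for x using I_im that by blast+
  note q_cmul = additive_frag_cmul[of B q, OF q_add] and I_cmul = additive_frag_cmul[of B I, OF I_add]
  let ?e = "int (p ^ a)"
  have p_pos: "p > 0" using p by (rule prime_gt_0_nat)
  have "\<exists>x\<in>frags B. q x = frag_of (actZ g z) - frag_of z" if "g \<in> carrier G" for g
  proof -
    have "frag_of (actZ g z) - frag_of z \<in> {w \<in> frags Z. augmentation w = 0}"
      using that z by (simp add: frags_diff Z.act_closed)
    then show ?thesis unfolding q_im[symmetric] by force
  qed
  then obtain \<alpha> where \<alpha>: "\<And>g. g \<in> carrier G \<Longrightarrow> \<alpha> g \<in> frags B"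
    "\<And>g. g \<in> carrier G \<Longrightarrow> q (\<alpha> g) = frag_of (actZ g z) - frag_of z" by metis
  define b where "b g h = tr g (\<alpha> h) - \<alpha> (g \<otimes> h) + \<alpha> g" for g h
  have b_B: "b g h \<in> frags B" if "g \<in> carrier G" "h \<in> carrier G" for g h
    unfolding b_def using that by (intro frags_add frags_diff tr_closed \<alpha>) auto
  have "\<exists>x\<in>frags B. I x = b g h" if "g \<in> carrier G" "h \<in> carrier G" for g h
  proof -
    have "q (b g h) = 0"
      unfolding b_def using that z
      by (simp add: q_add q_diff q_act \<alpha> tr_closed frags_diff push_diff Z.act_mult)
    then have "b g h \<in> {x \<in> frags B. q x = 0}" using b_B[OF that] by simp
    then show ?thesis unfolding I_im[symmetric] by force
  qed
  then obtain \<beta> where \<beta>: "\<And>g h. g \<in> carrier G \<Longrightarrow> h \<in> carrier G \<Longrightarrow> \<beta> g h \<in> frags B"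
    "\<And>g h. g \<in> carrier G \<Longrightarrow> h \<in> carrier G \<Longrightarrow> I (\<beta> g h) = b g h" by metis
  have cocycle: "tr g (\<beta> h k) - \<beta> (g \<otimes> h) k + \<beta> g (h \<otimes> k) = \<beta> g h"
    if "g \<in> carrier G" "h \<in> carrier G" "k \<in> carrier G" for g h k
  proof (rule inj_onD[OF I_inj])
    show "I (tr g (\<beta> h k) - \<beta> (g \<otimes> h) k + \<beta> g (h \<otimes> k)) = I (\<beta> g h)"
      using that
      by (simp add: I_add I_diff I_act \<beta> tr_closed frags_diff b_def push_add push_diff tr_mult \<alpha> m_assoc)
  qed (use that in \<open>simp_all add: frags_add frags_diff tr_closed \<beta>\<close>)
  define u0 where "u0 g = (\<Sum>k\<in>carrier G. \<beta> g k)" for g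
  have u0_B: "u0 g \<in> frags B" if "g \<in> carrier G" for g
    unfolding u0_def using that by (intro frags_sum \<beta>)
  have u0: "tr g (u0 h) - u0 (g \<otimes> h) + u0 g = frag_cmul (int (p ^ Suc a)) (\<beta> g h)"
    if g: "g \<in> carrier G" and h: "h \<in> carrier G" for g h
  proof -
    have bij: "bij_betw ((\<otimes>) h) (carrier G) (carrier G)"
      by (rule bij_betwI[of _ _ _ "(\<otimes>) (inv h)"]) (use h in \<open>auto simp: m_assoc[symmetric]\<close>)
    have "u0 g = (\<Sum>k\<in>carrier G. \<beta> g (h \<otimes> k))"
      unfolding u0_def using sum.reindex_bij_betw[OF bij, of "\<beta> g"] by simp
    then have "tr g (u0 h) - u0 (g \<otimes> h) + u0 g
        = (\<Sum>k\<in>carrier G. tr g (\<beta> h k) - \<beta> (g \<otimes> h) k + \<beta> g (h \<otimes> k))"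
      by (simp add: u0_def push_sum sum.distrib sum_subtractf)
    also have "\<dots> = (\<Sum>k\<in>carrier G. frag_cmul 1 (\<beta> g h))"
      using cocycle g h by (intro sum.cong) auto
    also have "\<dots> = frag_cmul (int (p ^ Suc a)) (\<beta> g h)"
      unfolding frag_cmul_sum_left[symmetric] by (simp add: card)
    finally show ?thesis .
  qed
  have u0_crossed: "int (p ^ Suc a) dvd lookup (u0 (g \<otimes> h)) y - lookup (u0 g) y - lookup (u0 h) (act (inv g) y)"
    if g: "g \<in> carrier G" and h: "h \<in> carrier G" and y: "y \<in> B" for g h y
  proof -
    have "lookup (u0 (g \<otimes> h)) y - lookup (u0 g) y - lookup (u0 h) (act (inv g) y)
        = - lookup (tr g (u0 h) - u0 (g \<otimes> h) + u0 g) y"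
      using lookup_tr[OF g u0_B[OF h] y] by (simp add: lookup_add lookup_minus)
    then show ?thesis unfolding u0[OF g h] by simp
  qed
  have stab: "int p dvd lookup (u0 s) y" if s: "s \<in> carrier G" "y \<in> B" "act s y = y" for s y
  proof (rule ccontr)
    assume nd: "\<not> int p dvd lookup (u0 s) y"
    have "int (p ^ Suc a) dvd int (ord s) * lookup (u0 s) y"
      by (rule crossed_hom_power[OF u0_crossed s])
    moreover have "coprime (int (p ^ Suc a)) (lookup (u0 s) y)"
    proof -
      have "coprime (int p) (lookup (u0 s) y)" using p nd by (intro prime_imp_coprime) auto
      then show ?thesis by (simp del: power_Suc)
    qed
    ultimately have "int (p ^ Suc a) dvd int (ord s)"
      by (metis coprime_dvd_mult_left_iff)
    then have "p ^ Suc a dvd ord s" by (simp only: int_dvd_int_iff)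
    moreover have "ord s dvd p ^ Suc a"
      using ord_dvd_group_order[OF s(1)] card by (simp add: Coset.order_def)
    ultimately show False using noncyclic[OF s(1)] by (metis dvd_antisym)
  qed
  have "int p dvd lookup (u0 (g \<otimes> h)) y - lookup (u0 g) y - lookup (u0 h) (act (inv g) y)"
    if "g \<in> carrier G" "h \<in> carrier G" "y \<in> B" for g h y
    using u0_crossed[OF that] by (rule dvd_trans[rotated]) simp
  from crossed_hom_principal[OF u0_B this stab]
  obtain v where v: "v \<in> frags B" "\<And>g y. g \<in> carrier G \<Longrightarrow> int p dvd lookup (u0 g - (tr g v - v)) y"
    by blast
  have "\<exists>x\<in>frags B. u0 g - (tr g v - v) = frag_cmul (int p) x" if g: "g \<in> carrier G" for g
  proof -
    let ?w = "u0 g - (tr g v - v)"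
    have w: "?w \<in> frags B" using g by (intro frags_diff u0_B tr_closed v)
    define c where "c y = lookup ?w y div int p" for y
    have c: "int p * c y = lookup ?w y" for y unfolding c_def using v(2)[OF g] by simp
    have sub: "{y. c y \<noteq> 0} \<subseteq> keys ?w" using c p_pos by (auto simp: in_keys_iff c_def)
    then have fin: "finite {y. c y \<noteq> 0}" by (rule finite_subset) simp
    have lc: "lookup (Abs_poly_mapping c) = c" by (rule lookup_Abs_poly_mapping[OF fin])
    have "?w = frag_cmul (int p) (Abs_poly_mapping c)" by (rule poly_mapping_eqI) (simp add: lc c)
    moreover have "Abs_poly_mapping c \<in> frags B"
      using sub w by (auto simp: frags_def in_keys_iff lc)
    ultimately show ?thesis by blast
  qed
  then obtain u where u: "\<And>g. g \<in> carrier G \<Longrightarrow> u g \<in> frags B"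
    "\<And>g. g \<in> carrier G \<Longrightarrow> u0 g - (tr g v - v) = frag_cmul (int p) (u g)" by metis
  have u_crossed: "tr g (u h) - u (g \<otimes> h) + u g = frag_cmul ?e (\<beta> g h)"
    if g: "g \<in> carrier G" and h: "h \<in> carrier G" for g h
  proof -
    have "frag_cmul (int p) (tr g (u h) - u (g \<otimes> h) + u g)
        = tr g (frag_cmul (int p) (u h)) - frag_cmul (int p) (u (g \<otimes> h)) + frag_cmul (int p) (u g)"
      by (simp add: push_cmul frag_cmul_distrib2 frag_cmul_diff_distrib2)
    also have "\<dots> = tr g (u0 h - (tr h v - v)) - (u0 (g \<otimes> h) - (tr (g \<otimes> h) v - v)) + (u0 g - (tr g v - v))"
      using g h by (simp add: u(2))
    also have "\<dots> = tr g (u0 h) - u0 (g \<otimes> h) + u0 g"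
      using g h v(1) by (simp add: push_diff tr_mult)
    also have "\<dots> = frag_cmul (int p) (frag_cmul ?e (\<beta> g h))" using u0[OF g h] by simp
    finally have "frag_cmul (int p) ((tr g (u h) - u (g \<otimes> h) + u g) - frag_cmul ?e (\<beta> g h)) = 0"
      by (simp add: frag_cmul_diff_distrib2)
    then show ?thesis using p_pos by (simp only: frag_cmul_eq_0_iff) simp
  qed
  \<comment> \<open>the corrected lift\<close>
  define f where "f g = frag_cmul ?e (\<alpha> g) - I (u g)" for g
  have f_B: "f g \<in> frags B" if "g \<in> carrier G" for g
    unfolding f_def using that by (intro frags_diff frags_cmul \<alpha> I_B u)
  have f_crossed: "f (g \<otimes> h) = f g + tr g (f h)" if g: "g \<in> carrier G" and h: "h \<in> carrier G" for g h
  proof -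
    have "tr g (f h) - f (g \<otimes> h) + f g = frag_cmul ?e (b g h) - I (tr g (u h) - u (g \<otimes> h) + u g)"
      unfolding f_def b_def using g h
      by (simp add: push_diff push_cmul frag_cmul_distrib2 frag_cmul_diff_distrib2 I_add I_diff I_act u tr_closed frags_diff)
    also have "\<dots> = 0" unfolding u_crossed[OF g h] using g h by (simp add: I_cmul \<beta>)
    finally show ?thesis by (simp add: algebra_simps)
  qed
  have fc: "0 dvd lookup (f (g \<otimes> h)) y - lookup (f g) y - lookup (f h) (act (inv g) y)"
    if "g \<in> carrier G" "h \<in> carrier G" "y \<in> B" for g h y
    using that f_B lookup_tr by (simp add: f_crossed lookup_add)
  have "0 dvd lookup (f s) y" if s: "s \<in> carrier G" "y \<in> B" "act s y = y" for s y
    using crossed_hom_power[OF fc s] ord_ge_1[OF finite_G s(1)] by simp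
  from crossed_hom_principal[OF f_B fc this]
  obtain x where x: "x \<in> frags B" "\<And>g y. g \<in> carrier G \<Longrightarrow> 0 dvd lookup (f g - (tr g x - x)) y"
    by blast
  have fx: "f g = tr g x - x" if g: "g \<in> carrier G" for g
  proof -
    have "f g - (tr g x - x) = 0" by (rule poly_mapping_eqI) (use x(2)[OF g] in simp)
    then show ?thesis by simp
  qed
  define w where "w = frag_cmul ?e (frag_of z) - q x"
  have qx: "q x \<in> frags Z" "augmentation (q x) = 0" using q_im x(1) by blast+
  have "push (actZ g) w = w" if g: "g \<in> carrier G" for g
  proof -
    have "push (actZ g) (q x) - q x = q (f g)" unfolding fx[OF g] using g x(1) by (simp add: q_diff q_act tr_closed)
    also have "\<dots> = frag_cmul ?e (frag_of (actZ g z) - frag_of z)"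
      unfolding f_def using g by (simp add: q_diff q_cmul \<alpha> I_B u frags_cmul)
    finally show ?thesis
      by (simp add: w_def push_diff push_cmul frag_cmul_diff_distrib2 algebra_simps)
  qed
  moreover have "w \<in> frags Z" unfolding w_def using z qx by (intro frags_diff frags_cmul) auto
  ultimately have "int (card (carrier G)) dvd augmentation w" by (intro aug)
  then have "int (p ^ Suc a) dvd int (p ^ a)" using qx by (simp add: w_def card)
  then have "p ^ Suc a dvd p ^ a" by (simp only: int_dvd_int_iff)
  then have "p ^ Suc a \<le> p ^ a" using p_pos by (intro dvd_imp_le) auto
  moreover have "p ^ a < p ^ Suc a" using prime_gt_1_nat[OF p] by simp
  ultimately show False by simp
qed

section \<open>Permutation presentations\<close>

lemma left_module_imp_G_module:
  assumes "group G" "finite (carrier G)" "left_module (int_group_ring G) M"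
  shows "G_module G M (\<lambda>g m. group_ring_elem g \<odot>\<^bsub>M\<^esub> m)"
proof -
  interpret group G by fact
  interpret M: left_module "int_group_ring G" M by fact
  show ?thesis
  proof (intro G_module.intro G_module_axioms.intro)
    show "group G" by fact
    show "abelian_group M" by (rule M.M.abelian_group_axioms)
    show "finite (carrier G)" by fact
    show "group_ring_elem \<one>\<^bsub>G\<^esub> \<odot>\<^bsub>M\<^esub> m = m" if "m \<in> carrier M" for m
      using M.smult_one[OF that] by (simp add: group_ring_elem_one)
    show "group_ring_elem (g \<otimes>\<^bsub>G\<^esub> h) \<odot>\<^bsub>M\<^esub> m = group_ring_elem g \<odot>\<^bsub>M\<^esub> (group_ring_elem h \<odot>\<^bsub>M\<^esub> m)"
      if "g \<in> carrier G" "h \<in> carrier G" "m \<in> carrier M" for g h m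
      using M.smult_assoc[of "group_ring_elem g" "group_ring_elem h" m] that
      by (simp add: group_ring_elem_mult[OF assms(1)])
  qed (simp_all add: M.smult_closed M.smult_r_distr)
qed

text \<open>
  The map of the swindle, transported to the type \<open>'f\<close>: the basis \<open>pts\<close> is no larger than the
  infinite type \<open>'m\<close>, so the formal sums over it fit into \<open>'f\<close>.
\<close>

lemma sylow_cyclic_imp_presentation:
  fixes G :: "('g, 'x) monoid_scheme" and M :: "('g \<Rightarrow> int, 'm) module"
  assumes G: "group G" "finite (carrier G)" and inf: "infinite (UNIV :: 'm set)"
    and le: "(UNIV :: 'm set) \<lesssim> (UNIV :: 'f set)" and M: "left_module (int_group_ring G) M"
    and cyc: "\<And>p P. sylow_subgroup p P G \<Longrightarrow> cyclic_group (G\<lparr>carrier := P\<rparr>)"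
  shows "\<exists>(F :: ('g \<Rightarrow> int, 'f) module) i p. permutation_presentation G M F i p"
proof -
  interpret M: left_module "int_group_ring G" M by fact
  interpret A: G_module G M "\<lambda>g m. group_ring_elem g \<odot>\<^bsub>M\<^esub> m"
    by (rule left_module_imp_G_module[OF G M])
  have "\<exists>s. A.splits (carrier G) 1 s" by (rule A.sylow_cyclic_splits) (rule cyc)
  then obtain s where "A.splits (carrier G) 1 s" by blast
  from A.swindle[OF this] obtain \<iota> p0 where
    \<iota>_add: "\<And>x y. \<iota> (x + y) = \<iota> x + \<iota> y" and \<iota>_closed: "\<And>x. x \<in> frags A.pts \<Longrightarrow> \<iota> x \<in> frags A.pts"
    and \<iota>_act: "\<And>g x. g \<in> carrier G \<Longrightarrow> x \<in> frags A.pts \<Longrightarrow> \<iota> (push (A.pact g) x) = push (A.pact g) (\<iota> x)"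
    and \<iota>_inj: "inj_on \<iota> (frags A.pts)" and \<iota>_im: "\<iota> ` frags A.pts = {x \<in> frags A.pts. p0 x \<in> A.K}"
    and p0_add: "\<And>x y. p0 (x + y) = p0 x + p0 y" and p0_closed: "\<And>x. x \<in> frags A.pts \<Longrightarrow> p0 x \<in> A.\<Omega>"
    and p0_act: "\<And>g x. g \<in> carrier G \<Longrightarrow> x \<in> frags A.pts \<Longrightarrow>
      p0 (push (A.pact g) x) = push (\<lambda>m. group_ring_elem g \<odot>\<^bsub>M\<^esub> m) (p0 x)"
    and p0_of: "\<And>m. m \<in> carrier M \<Longrightarrow> p0 (frag_of (Inl m, 0)) = frag_of m"
    by (elim exE conjE) blast
  have inf': "infinite (UNIV :: 'f set)" using le inf by (meson finite_lepoll_infinite lepoll_trans infinite_le_lepoll)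
  have "frags A.pts \<lesssim> (UNIV :: 'f set)"
    by (rule frags_lepoll[OF lepoll_trans[OF A.pts_lepoll[OF inf] le] inf'])
  then obtain \<phi> :: "_ \<Rightarrow> 'f" where \<phi>: "inj_on \<phi> (frags A.pts)" by (auto simp: lepoll_def)
  interpret F: frag_rep G A.pact "frags A.pts" \<phi>
  proof (intro frag_rep.intro frag_rep_axioms.intro)
    show "group G" by fact
    show "finite (carrier G)" by fact
    show "inj_on \<phi> (frags A.pts)" by fact
    show "push (A.pact g) x \<in> frags A.pts" if "g \<in> carrier G" "x \<in> frags A.pts" for g x
      using that(2) by (rule push_frags) (rule A.pact_closed[OF that(1)])
    show "push (A.pact \<one>\<^bsub>G\<^esub>) x = x" if "x \<in> frags A.pts" for x
      using that by (rule push_id) (rule A.pact_one)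
    show "push (A.pact (g \<otimes>\<^bsub>G\<^esub> h)) x = push (A.pact g) (push (A.pact h) x)"
      if "g \<in> carrier G" "h \<in> carrier G" "x \<in> frags A.pts" for g h x
      unfolding push_push using that(3) by (rule push_cong) (simp add: A.pact_mult that)
  qed (simp_all add: frags_diff)
  let ?F = "frag_module G A.pact (frags A.pts) \<phi>" and ?\<psi> = "inv_into (frags A.pts) \<phi>"
  define i where "i y = \<phi> (\<iota> (?\<psi> y))" for y
  define p where "p y = A.counit (p0 (?\<psi> y))" for y
  have F_E: "\<exists>u\<in>frags A.pts. y = \<phi> u" if "y \<in> carrier ?F" for y
    using that F.psi_U[OF that] F.phi_psi[OF that] by metis
  have F_E2: "\<exists>u v. u \<in> frags A.pts \<and> v \<in> frags A.pts \<and> x = \<phi> u \<and> y = \<phi> v"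
    if "x \<in> carrier ?F" "y \<in> carrier ?F" for x y
    using F_E[OF that(1)] F_E[OF that(2)] by blast
  have i_phi: "i (\<phi> x) = \<phi> (\<iota> x)" and p_phi: "p (\<phi> x) = A.counit (p0 x)" if "x \<in> frags A.pts" for x
    using that by (simp_all add: i_def p_def)
  have perm: "permutation_module G ?F"
    by (rule F.permutation_module[OF refl A.pact_bij])
  have i_hom: "i \<in> left_module_hom (int_group_ring G) ?F ?F"
  proof (rule left_module_homI[OF F.left_module F.left_module])
    show "i \<in> hom (add_monoid ?F) (add_monoid ?F)"
    proof (rule homI)
      fix x assume "x \<in> carrier (add_monoid ?F)"
      then have "x \<in> carrier ?F" by simp
      then obtain u where "u \<in> frags A.pts" "x = \<phi> u" using F_E by blast
      then show "i x \<in> carrier (add_monoid ?F)" by (simp add: i_phi F.phi_F \<iota>_closed)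
    next
      fix x y assume "x \<in> carrier (add_monoid ?F)" "y \<in> carrier (add_monoid ?F)"
      then have "x \<in> carrier ?F" "y \<in> carrier ?F" by simp_all
      then obtain u v where "u \<in> frags A.pts" "v \<in> frags A.pts" "x = \<phi> u" "y = \<phi> v" using F_E2 by blast
      then show "i (x \<otimes>\<^bsub>add_monoid ?F\<^esub> y) = i x \<otimes>\<^bsub>add_monoid ?F\<^esub> i y"
        by (simp add: F.F_add i_phi frags_add \<iota>_add \<iota>_closed)
    qed
    fix g x assume g: "g \<in> carrier G" and "x \<in> carrier ?F"
    then obtain u where "u \<in> frags A.pts" "x = \<phi> u" using F_E by blast
    then show "i (group_ring_elem g \<odot>\<^bsub>?F\<^esub> x) = group_ring_elem g \<odot>\<^bsub>?F\<^esub> i x"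
      using g by (simp add: F.F_smult_elem i_phi \<iota>_act \<iota>_closed F.U_push)
  qed
  have p_hom: "p \<in> left_module_hom (int_group_ring G) ?F M"
  proof (rule left_module_homI[OF F.left_module M])
    show "p \<in> hom (add_monoid ?F) (add_monoid M)"
    proof (rule homI)
      fix x assume "x \<in> carrier (add_monoid ?F)"
      then have "x \<in> carrier ?F" by simp
      then obtain u where "u \<in> frags A.pts" "x = \<phi> u" using F_E by blast
      then show "p x \<in> carrier (add_monoid M)" by (simp add: p_phi A.counit_closed p0_closed)
    next
      fix x y assume "x \<in> carrier (add_monoid ?F)" "y \<in> carrier (add_monoid ?F)"
      then have "x \<in> carrier ?F" "y \<in> carrier ?F" by simp_all
      then obtain u v where "u \<in> frags A.pts" "v \<in> frags A.pts" "x = \<phi> u" "y = \<phi> v" using F_E2 by blast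
      then show "p (x \<otimes>\<^bsub>add_monoid ?F\<^esub> y) = p x \<otimes>\<^bsub>add_monoid M\<^esub> p y"
        by (simp add: F.F_add p_phi frags_add p0_add p0_closed A.counit_add)
    qed
    fix g x assume g: "g \<in> carrier G" and "x \<in> carrier ?F"
    then obtain u where "u \<in> frags A.pts" "x = \<phi> u" using F_E by blast
    then show "p (group_ring_elem g \<odot>\<^bsub>?F\<^esub> x) = group_ring_elem g \<odot>\<^bsub>M\<^esub> p x"
      using g by (simp add: F.F_smult_elem p_phi p0_act p0_closed F.U_push A.counit_push)
  qed
  have inj: "inj_on i (carrier ?F)"
  proof (rule inj_onI)
    fix x y assume xy: "x \<in> carrier ?F" "y \<in> carrier ?F" "i x = i y"
    then obtain u v where uv: "u \<in> frags A.pts" "v \<in> frags A.pts" "x = \<phi> u" "y = \<phi> v" using F_E2 by blast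
    then have "\<phi> (\<iota> u) = \<phi> (\<iota> v)" using xy(3) by (simp add: i_phi)
    then have "\<iota> u = \<iota> v" using inj_onD[OF \<phi>] uv \<iota>_closed by blast
    then show "x = y" using inj_onD[OF \<iota>_inj] uv by blast
  qed
  have carr: "carrier ?F = \<phi> ` frags A.pts" by (simp add: frag_module_def)
  have "i ` carrier ?F = \<phi> ` (\<iota> ` frags A.pts)"
    unfolding carr image_image by (intro image_cong refl) (rule i_phi)
  also have "\<dots> = a_kernel ?F M p"
    unfolding a_kernel_def' \<iota>_im carr using p0_closed by (auto simp: p_phi A.K_def)
  finally have ker: "i ` carrier ?F = a_kernel ?F M p" .
  have "p ` carrier ?F = carrier M"
  proof
    show "p ` carrier ?F \<subseteq> carrier M" unfolding carr by (auto simp: p_phi A.counit_closed p0_closed)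
    show "carrier M \<subseteq> p ` carrier ?F"
    proof
      fix m assume m: "m \<in> carrier M"
      have u: "frag_of (Inl m, 0) \<in> frags A.pts" using m by (simp add: A.pts_def)
      have "p (\<phi> (frag_of (Inl m, 0))) = m" using m by (simp add: p_phi[OF u] p0_of A.counit)
      then show "m \<in> p ` carrier ?F" using imageI[OF F.phi_F[OF u], of p] by simp
    qed
  qed
  then have "permutation_presentation G M ?F i p"
    unfolding permutation_presentation_def using perm i_hom p_hom inj ker by blast
  then show ?thesis by blast
qed

text \<open>
  Coordinates identify a module that has a basis with formal sums.
\<close>

lemma int_basis_imp_free:
  assumes F: "abelian_group F" and B: "is_int_basis F B"
  shows "\<exists>E. E \<in> hom (free_Abelian_group B) (add_monoid F) \<and> bij_betw E (frags B) (carrier F) \<and>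
    (\<forall>b\<in>B. E (frag_of b) = b)"
proof -
  interpret F: abelian_group F by fact
  have BF: "B \<subseteq> carrier F" using B by (simp add: is_int_basis_def)
  obtain E where E: "E \<in> hom (free_Abelian_group B) (add_monoid F)" "\<And>b. b \<in> B \<Longrightarrow> E (frag_of b) = b"
    using comm_group.free_Abelian_group_universal[OF F.a_comm_group, of id B] BF by auto
  have E_sum: "E (\<Sum>b\<in>A. frag_cmul (c b) (frag_of b)) = (\<Oplus>\<^bsub>F\<^esub>b\<in>A. add_pow F (c b) b)"
    if A: "finite A" "A \<subseteq> B" for A and c :: "_ \<Rightarrow> int"
    unfolding hom_free_Abelian_group_sum[OF F E(1) A]
    using A(2) BF E(2) by (intro F.finsum_cong') (auto intro!: F.add.int_pow_closed)
  have E_coord: "E x = (\<Oplus>\<^bsub>F\<^esub>b\<in>{b. lookup x b \<noteq> 0}. add_pow F (lookup x b) b)" if "x \<in> frags B" for x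
  proof -
    have "E x = E (\<Sum>b\<in>keys x. frag_cmul (lookup x b) (frag_of b))"
      using frag_expansion[of x] by (simp add: frag_extend_def)
    also have "\<dots> = (\<Oplus>\<^bsub>F\<^esub>b\<in>keys x. add_pow F (lookup x b) b)"
      using that by (intro E_sum) (auto simp: frags_def)
    also have "keys x = {b. lookup x b \<noteq> 0}" by (auto simp: in_keys_iff)
    finally show ?thesis .
  qed
  define coords where "coords y c \<longleftrightarrow> finite {b. c b \<noteq> 0} \<and> {b. c b \<noteq> 0} \<subseteq> B \<and>
      y = (\<Oplus>\<^bsub>F\<^esub>b\<in>{b. c b \<noteq> 0}. add_pow F (c b) b)" for y and c :: "_ \<Rightarrow> int"
  have ex1: "\<exists>!c. coords y c" if "y \<in> carrier F" for y
    using B that by (simp add: is_int_basis_def coords_def)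
  have E_closed: "E x \<in> carrier F" if "x \<in> frags B" for x
    using E(1) that by (auto simp: hom_def frags_def)
  have lk: "coords (E x) (lookup x)" if "x \<in> frags B" for x
    using that E_coord[OF that] by (auto simp: coords_def frags_def in_keys_iff finite_lookup)
  have "bij_betw E (frags B) (carrier F)"
    unfolding bij_betw_def
  proof
    show "inj_on E (frags B)"
    proof (rule inj_onI)
      fix x y assume xy: "x \<in> frags B" "y \<in> frags B" "E x = E y"
      have "lookup x = lookup y"
        using ex1[OF E_closed[OF xy(2)]] lk[OF xy(1)] lk[OF xy(2)] unfolding xy(3) by blast
      then show "x = y" by (simp add: poly_mapping_eqI)
    qed
    show "E ` frags B = carrier F"
    proof
      show "E ` frags B \<subseteq> carrier F" using E_closed by blast
      show "carrier F \<subseteq> E ` frags B"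
      proof
        fix y assume y: "y \<in> carrier F"
        then obtain c :: "_ \<Rightarrow> int" where c: "finite {b. c b \<noteq> 0}" "{b. c b \<noteq> 0} \<subseteq> B"
          "y = (\<Oplus>\<^bsub>F\<^esub>b\<in>{b. c b \<noteq> 0}. add_pow F (c b) b)" using ex1[OF y] unfolding coords_def by blast
        have lc: "lookup (Abs_poly_mapping c) = c" by (rule lookup_Abs_poly_mapping[OF c(1)])
        have x: "Abs_poly_mapping c \<in> frags B" using c(2) by (auto simp: frags_def in_keys_iff lc)
        have "y = E (Abs_poly_mapping c)" unfolding E_coord[OF x] lc by (rule c(3))
        then show "y \<in> E ` frags B" using x by blast
      qed
    qed
  qed
  then show ?thesis using E by blast
qed

text \<open>
  The augmentation ideal of the group ring, transported to the infinite type \<open>'m\<close>, has a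
  presentation only if no Sylow subgroup meets the conditions of \<open>augmentation_obstruction\<close>.
\<close>

lemma presentation_imp_sylow_cyclic:
  fixes G :: "('g, 'x) monoid_scheme"
  assumes G: "group G" "finite (carrier G)" and inf: "infinite (UNIV :: 'm set)"
    and pres: "\<And>M :: ('g \<Rightarrow> int, 'm) module. left_module (int_group_ring G) M \<Longrightarrow>
      \<exists>(F :: ('g \<Rightarrow> int, 'f) module) i p. permutation_presentation G M F i p"
    and syl: "sylow_subgroup p P G"
  shows "cyclic_group (G\<lparr>carrier := P\<rparr>)"
proof (rule ccontr)
  assume nc: "\<not> cyclic_group (G\<lparr>carrier := P\<rparr>)"
  interpret group G by fact
  have p: "Factorial_Ring.prime p" and P: "subgroup P G" and cardP: "\<exists>k. card P = p ^ k"
    using syl by (auto simp: sylow_subgroup_def)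
  have PG: "P \<subseteq> carrier G" by (rule subgroup.subset[OF P])
  have finP: "finite P" using PG G(2) by (rule finite_subset)
  let ?H = "G\<lparr>carrier := P\<rparr>"
  interpret H: group ?H using P by (rule subgroup_imp_group)
  have ord_ne: "H.ord s \<noteq> card P" if s: "s \<in> P" for s
  proof
    assume o: "H.ord s = card P"
    have "card (generate ?H {s}) = card P" using H.generate_pow_card[of s] s o by simp
    moreover have "generate ?H {s} \<subseteq> P" using H.generate_in_carrier[of "{s}"] s by auto
    ultimately have "generate ?H {s} = P" using finP by (simp add: card_subset_eq)
    then have "subgroup_generated ?H {s} = ?H" using s by (simp add: subgroup_generated_def Int_absorb1)
    then show False using nc s by (auto simp: cyclic_group_def)
  qed
  obtain k where k: "card P = p ^ k" using cardP by blast
  have "k \<noteq> 0"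
  proof
    assume "k = 0"
    then have "card P = 1" using k by simp
    moreover have "H.ord \<one>\<^bsub>G\<^esub> = 1" using H.ord_id by simp
    ultimately show False using ord_ne[of "\<one>\<^bsub>G\<^esub>"] subgroup.one_closed[OF P] by simp
  qed
  then obtain a where a: "card P = p ^ Suc a" using k by (cases k) auto
  define U where "U = {x \<in> frags (carrier G). augmentation x = 0}"
  have "frags (carrier G) \<lesssim> (UNIV :: 'm set)"
  proof -
    have "carrier G \<lesssim> (UNIV :: 'm set)" using G(2) inf by (rule finite_lepoll_infinite[rotated])
    then show ?thesis using inf by (rule frags_lepoll)
  qed
  then obtain \<phi> :: "_ \<Rightarrow> 'm" where \<phi>: "inj_on \<phi> (frags (carrier G))" by (auto simp: lepoll_def)
  have mult_set: "finite_group_set G (\<otimes>\<^bsub>G\<^esub>) (carrier G)"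
    by unfold_locales (auto simp: G(2) m_assoc)
  interpret R: finite_group_set G "(\<otimes>\<^bsub>G\<^esub>)" "carrier G" by (rule mult_set)
  interpret M: frag_rep G "(\<otimes>\<^bsub>G\<^esub>)" U \<phi>
  proof (intro frag_rep.intro frag_rep_axioms.intro)
    show "group G" by fact
    show "inj_on \<phi> U" using \<phi> by (rule inj_on_subset) (auto simp: U_def)
  qed (auto simp: U_def G(2) frags_diff R.tr_closed R.tr_one R.tr_mult)
  let ?M = "frag_module G (\<otimes>\<^bsub>G\<^esub>) U \<phi>" and ?\<psi> = "inv_into U \<phi>"
  obtain F :: "('g \<Rightarrow> int, 'f) module" and i q where "permutation_presentation G ?M F i q"
    using pres[OF M.left_module] by blast
  then have permF: "permutation_module G F" and i: "i \<in> left_module_hom (int_group_ring G) F F"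
    and q: "q \<in> left_module_hom (int_group_ring G) F ?M" and i_inj: "inj_on i (carrier F)"
    and i_im: "i ` carrier F = a_kernel F ?M q" and q_im: "q ` carrier F = carrier ?M"
    by (simp_all add: permutation_presentation_def)
  have FM: "left_module (int_group_ring G) F" using permF by (simp add: permutation_module_def)
  interpret FM: left_module "int_group_ring G" F by (rule FM)
  interpret A: G_module G F "\<lambda>g m. group_ring_elem g \<odot>\<^bsub>F\<^esub> m"
    by (rule left_module_imp_G_module[OF G FM])
  let ?am = "\<lambda>g m. group_ring_elem g \<odot>\<^bsub>F\<^esub> m"
  obtain B where B: "is_int_basis F B" "\<And>g. g \<in> carrier G \<Longrightarrow> bij_betw (?am g) B B"
    using permF by (auto simp: permutation_module_def)
  have BF: "B \<subseteq> carrier F" using B(1) by (simp add: is_int_basis_def)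
  obtain E where E: "E \<in> hom (free_Abelian_group B) (add_monoid F)" "bij_betw E (frags B) (carrier F)"
    "\<And>b. b \<in> B \<Longrightarrow> E (frag_of b) = b"
    using int_basis_imp_free[OF FM.M.abelian_group_axioms B(1)] by blast
  have actB: "?am g b \<in> B" if "g \<in> carrier G" "b \<in> B" for g b
    using B(2)[OF that(1)] that(2) by (auto simp: bij_betw_def)
  interpret S: finite_group_set ?H ?am B
  proof (intro finite_group_set.intro finite_group_set_axioms.intro)
    show "group ?H" by (rule H.is_group)
  qed (use PG BF A.am_one A.am_mult actB finP in \<open>auto simp: subset_iff\<close>)
  have E_closed: "E x \<in> carrier F" if "x \<in> frags B" for x using E(2) that by (auto simp: bij_betw_def)
  have E_add: "E (x + y) = E x \<oplus>\<^bsub>F\<^esub> E y" if "x \<in> frags B" "y \<in> frags B" for x y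
    using E(1) that by (auto simp: hom_def frags_def)
  have E_0: "E 0 = \<zero>\<^bsub>F\<^esub>" using E_add[of 0 0] E_closed[of 0] by (simp add: FM.M.add.r_cancel_one')
  have E_diff: "E (x - y) = E x \<ominus>\<^bsub>F\<^esub> E y" if "x \<in> frags B" "y \<in> frags B" for x y
    using E_add[of "x - y" y] E_closed[of "x - y"] E_closed[of y] that
    by (simp add: frags_diff FM.M.minus_eq FM.M.a_assoc FM.M.r_neg)
  have E_act: "E (push (?am g) x) = ?am g (E x)" if g: "g \<in> carrier G" and x: "x \<in> frags B" for g x
    using x
  proof (induction rule: frags_induct)
    case zero then show ?case using A.am_zero[OF g] by (simp add: E_0)
  next
    case (one b) then show ?case using g actB by (simp add: E(3))
  next
    case (diff x y)
    have "push (?am g) x \<in> frags B" "push (?am g) y \<in> frags B"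
      using diff(1,2) by (auto elim!: push_frags intro: actB g)
    then show ?case using diff by (simp add: push_diff E_diff A.am_diff[OF g E_closed E_closed])
  qed
  let ?E' = "inv_into (frags B) E"
  have E'E: "?E' (E x) = x" if "x \<in> frags B" for x
    using E(2) that by (simp add: bij_betw_def inv_into_f_f)
  have EE': "E (?E' y) = y" "?E' y \<in> frags B" if "y \<in> carrier F" for y
    using E(2) that by (auto simp: bij_betw_def f_inv_into_f inv_into_into)
  have E_inj: "x = y" if "x \<in> frags B" "y \<in> frags B" "E x = E y" for x y
    using E'E that by metis
  have i_closed: "i x \<in> carrier F" and i_add: "y \<in> carrier F \<Longrightarrow> i (x \<oplus>\<^bsub>F\<^esub> y) = i x \<oplus>\<^bsub>F\<^esub> i y"
    and i_act: "g \<in> carrier G \<Longrightarrow> i (?am g x) = ?am g (i x)" if "x \<in> carrier F" for x y g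
    using i that by (auto simp: left_module_hom_def hom_def)
  have q_closed: "q x \<in> carrier ?M" and q_add: "y \<in> carrier F \<Longrightarrow> q (x \<oplus>\<^bsub>F\<^esub> y) = q x \<oplus>\<^bsub>?M\<^esub> q y"
    and q_act: "g \<in> carrier G \<Longrightarrow> q (?am g x) = group_ring_elem g \<odot>\<^bsub>?M\<^esub> q x" if "x \<in> carrier F" for x y g
    using q that by (auto simp: left_module_hom_def hom_def)
  define Q where "Q x = ?\<psi> (q (E x))" for x
  define I where "I x = ?E' (i (E x))" for x
  have psi_add: "?\<psi> (x \<oplus>\<^bsub>?M\<^esub> y) = ?\<psi> x + ?\<psi> y" if "x \<in> carrier ?M" "y \<in> carrier ?M" for x y
    using M.F_add[OF M.psi_U[OF that(1)] M.psi_U[OF that(2)]] M.phi_psi that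
    by (simp add: M.U_add M.psi_U)
  have psi_act: "?\<psi> (group_ring_elem g \<odot>\<^bsub>?M\<^esub> x) = push ((\<otimes>\<^bsub>G\<^esub>) g) (?\<psi> x)" if "g \<in> carrier G" "x \<in> carrier ?M" for g x
    using M.F_smult_elem[OF that(1) M.psi_U[OF that(2)]] M.phi_psi[OF that(2)] that
    by (simp add: M.U_push M.psi_U)
  have E_I: "E (I x) = i (E x)" "I x \<in> frags B" if "x \<in> frags B" for x
    unfolding I_def using that EE' i_closed E_closed by blast+
  have carrM: "carrier ?M = \<phi> ` U" by (simp add: frag_module_def)
  have psi_im: "?\<psi> ` carrier ?M = U" unfolding carrM image_image by simp
  have Q_im: "Q ` frags B = U"
  proof -
    have "Q ` frags B = ?\<psi> ` (q ` (E ` frags B))" by (simp add: Q_def image_image)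
    also have "E ` frags B = carrier F" using E(2) by (simp add: bij_betw_def)
    finally show ?thesis using q_im psi_im by simp
  qed
  have psi_0: "?\<psi> y = 0 \<longleftrightarrow> y = \<zero>\<^bsub>?M\<^esub>" if "y \<in> carrier ?M" for y
    using M.phi_psi[OF that] M.F_zero M.psi_phi[OF M.U_0] by metis
  have Q_0: "Q x = 0 \<longleftrightarrow> E x \<in> a_kernel F ?M q" if "x \<in> frags B" for x
    using psi_0[OF q_closed[OF E_closed[OF that]]] E_closed[OF that] by (simp add: Q_def a_kernel_def')
  have "False"
  proof (rule S.augmentation_obstruction[of p a "(\<otimes>\<^bsub>G\<^esub>)" "carrier G" "\<one>\<^bsub>G\<^esub>" Q I])
    show "Factorial_Ring.prime p" by (rule p)
    show "card (carrier ?H) = p ^ Suc a" using a by simp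
    show "H.ord s \<noteq> p ^ Suc a" if "s \<in> carrier ?H" for s using ord_ne[of s] that a by simp
    show "finite_group_set ?H (\<otimes>\<^bsub>G\<^esub>) (carrier G)"
    proof (intro finite_group_set.intro finite_group_set_axioms.intro)
      show "group ?H" by (rule H.is_group)
    qed (use PG finP in \<open>auto simp: subset_iff m_assoc\<close>)
    show "\<one>\<^bsub>G\<^esub> \<in> carrier G" by simp
    show "int (card (carrier ?H)) dvd augmentation w"
      if "w \<in> frags (carrier G)" "\<And>g. g \<in> carrier ?H \<Longrightarrow> push ((\<otimes>\<^bsub>G\<^esub>) g) w = w" for w
      using augmentation_invariant[OF G(2) P that(1)] that(2) by simp
    show "Q (x + y) = Q x + Q y" if "x \<in> frags B" "y \<in> frags B" for x y
      using that E_closed by (simp add: Q_def E_add q_add psi_add q_closed)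
    show "Q ` frags B = {w \<in> frags (carrier G). augmentation w = 0}" using Q_im by (simp add: U_def)
    show "Q (push (?am g) x) = push ((\<otimes>\<^bsub>G\<^esub>) g) (Q x)" if "g \<in> carrier ?H" "x \<in> frags B" for g x
    proof -
      have "g \<in> carrier G" using that PG by auto
      then show ?thesis using that E_closed by (simp add: Q_def E_act q_act psi_act q_closed)
    qed
    show "I (x + y) = I x + I y" if "x \<in> frags B" "y \<in> frags B" for x y
      using that E_closed E_I by (intro E_inj) (simp_all add: frags_add E_add i_add)
    show "inj_on I (frags B)"
    proof (rule inj_onI)
      fix x y assume xy: "x \<in> frags B" "y \<in> frags B" "I x = I y"
      then have "i (E x) = i (E y)" using E_I(1) by metis
      then have "E x = E y" using inj_onD[OF i_inj] xy E_closed by blast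
      then show "x = y" using E_inj xy by blast
    qed
    show "I (push (?am g) x) = push (?am g) (I x)" if "g \<in> carrier ?H" "x \<in> frags B" for g x
    proof -
      have g: "g \<in> carrier G" using that PG by auto
      have pB: "push (?am g) y \<in> frags B" if "y \<in> frags B" for y
        using that by (rule push_frags) (rule actB[OF g])
      show ?thesis using that E_closed E_I g pB by (intro E_inj) (simp_all add: E_act i_act)
    qed
    show "I ` frags B = {x \<in> frags B. Q x = 0}"
    proof
      show "I ` frags B \<subseteq> {x \<in> frags B. Q x = 0}"
      proof
        fix y assume "y \<in> I ` frags B"
        then obtain x where x: "x \<in> frags B" "y = I x" by blast
        then have "E y \<in> a_kernel F ?M q" using i_im E_I(1)[OF x(1)] E_closed[OF x(1)] by blast
        then show "y \<in> {x \<in> frags B. Q x = 0}" using x E_I(2) Q_0 by blast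
      qed
      show "{x \<in> frags B. Q x = 0} \<subseteq> I ` frags B"
      proof
        fix x assume "x \<in> {x \<in> frags B. Q x = 0}"
        then have x: "x \<in> frags B" "E x \<in> i ` carrier F" using Q_0 i_im by auto
        then obtain y where y: "y \<in> carrier F" "E x = i y" by blast
        have "I (?E' y) = x"
          using E_I[OF EE'(2)[OF y(1)]] y x EE'(1)[OF y(1)] by (intro E_inj) simp_all
        then show "x \<in> I ` frags B" using EE'(2)[OF y(1)] by blast
      qed
    qed
  qed
  then show False .
qed

theorem theorem1p4:
  fixes \<Gamma> :: "('g, 'x) monoid_scheme"
  assumes "group \<Gamma>"
    and "finite (carrier \<Gamma>)"
    and "infinite (UNIV :: 'm set)"
    and "(UNIV :: 'm set) \<lesssim> (UNIV :: 'f set)"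
  shows "(\<forall>M :: ('g \<Rightarrow> int, 'm) module. left_module (int_group_ring \<Gamma>) M \<longrightarrow>
            (\<exists>(F :: ('g \<Rightarrow> int, 'f) module) i p. permutation_presentation \<Gamma> M F i p))
         \<longleftrightarrow> (\<forall>p P. sylow_subgroup p P \<Gamma> \<longrightarrow> cyclic_group (\<Gamma>\<lparr>carrier := P\<rparr>))"
proof
  assume "\<forall>M :: ('g \<Rightarrow> int, 'm) module. left_module (int_group_ring \<Gamma>) M \<longrightarrow>
            (\<exists>(F :: ('g \<Rightarrow> int, 'f) module) i p. permutation_presentation \<Gamma> M F i p)"
  then have "\<And>M :: ('g \<Rightarrow> int, 'm) module. left_module (int_group_ring \<Gamma>) M \<Longrightarrow>
            \<exists>(F :: ('g \<Rightarrow> int, 'f) module) i p. permutation_presentation \<Gamma> M F i p"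
    by blast
  from presentation_imp_sylow_cyclic[OF assms(1-3) this]
  show "\<forall>p P. sylow_subgroup p P \<Gamma> \<longrightarrow> cyclic_group (\<Gamma>\<lparr>carrier := P\<rparr>)"
    by blast
next
  assume "\<forall>p P. sylow_subgroup p P \<Gamma> \<longrightarrow> cyclic_group (\<Gamma>\<lparr>carrier := P\<rparr>)"
  then show "\<forall>M :: ('g \<Rightarrow> int, 'm) module. left_module (int_group_ring \<Gamma>) M \<longrightarrow>
            (\<exists>(F :: ('g \<Rightarrow> int, 'f) module) i p. permutation_presentation \<Gamma> M F i p)"
    using sylow_cyclic_imp_presentation[OF assms] by blast
qed

end
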